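(* Let $G$ be an infinite, locally finite, transitive, amenable graph on a countable vertex set $\mathbb V$ and let $\Gamma$ be a group of automorphisms of $G$ acting transitively on $\mathbb V$. Let $S$ be a finite or countable set and let $X=(X_v)_{v\in\mathbb V}$ be an $S$-valued, $\Gamma$-invariant, finitely dependent random field on $G$. Then there exists an i.i.d. process $Y=(Y_v)_{v\in\mathbb V}$ such that $X$ is a finitary $\Gamma$-factor of $Y$.
   Context: Graphs are undirected and $\operatorname{dist}$ is the graph distance ($\operatorname{dist}(u,v)=\infty$ if $u,v$ lie in different components; $G$ is not required to be connected). $G$ is amenable if $\inf |\partial V|/|V|=0$, the infimum being over finite non-empty $V\subset\mathbb V$, where $\partial V$ is the set of edges with exactly one endpoint in $V$. A random field on $G$ is a collection of random variables $X=(X_v)_{v\in\mathbb V}$ on a common probability space. It is $\Gamma$-invariant if $(X_{\gamma v})_{v\in\mathbb V}$ has the same distribution as $X$ for every $\gamma\in\Gamma$. It is $k$-dependent if $(X_u)_{u\in U}$ and $(X_v)_{v\in V}$ are independent for any $U,V\subset\mathbb V$ such that $\operatorname{dist}(u,v)>k$ for all $u\in U$, $v\in V$; it is finitely dependent if it is $k$-dependent for some finite $k$. An i.i.d. process is a random field $Y=(Y_v)_{v\in\mathbb V}$ whose variables are independent and identically distributed. Let $X$ be $S$-valued and $Y$ be $T$-valued, both $\Gamma$-invariant, where $S$ is at most countable and $T$ is finite, countable, or of the form $T_1\times T_2\times\cdots$ with each $T_i$ a finite set. A coding (factor map) from $Y$ to $X$ is a measurable function $\varphi:T^{\mathbb V}\to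 S^{\mathbb V}$ that commutes with the action of every element of $\Gamma$ and such that $\varphi(Y)$ has the same distribution as $X$. Fix a vertex $\mathbf 0\in\mathbb V$. For $T$ finite or countable, the coding radius $R(y)$ of $\varphi$ at $y\in T^{\mathbb V}$ is the minimal integer $r\ge 0$ such that $\varphi(y')_{\mathbf 0}=\varphi(y)_{\mathbf 0}$ for all $y'\in T^{\mathbb V}$ with $y'_v=y_v$ for all $v$ with $\operatorname{dist}(v,\mathbf 0)\le r$ ($R(y)=\infty$ if no such $r$ exists). For $T=T_1\times T_2\times\cdots$, $R(y)$ is the smallest $r$ for which there exists $n$ such that $\varphi(y')_{\mathbf 0}=\varphi(y)_{\mathbf 0}$ for all $y'$ with $y'_{v,i}=y_{v,i}$ for all $(v,i)$ with $\operatorname{dist}(v,\mathbf 0)\le r$ and $1\le i\le n$. The coding is finitary if $R(Y)<\infty$ almost surely, and $X$ is a finitary $\Gamma$-factor of $Y$ if a finitary coding from $Y$ to $X$ exists. *)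

theory Defs
  imports "HOL-Probability.Probability" "HOL-Algebra.Bij"
begin

text \<open>The vertex set is the whole type \<open>'v\<close>; edges are unordered pairs of distinct vertices.\<close>

definition simple_graph :: "'v set set \<Rightarrow> bool" where
  "simple_graph E \<longleftrightarrow> (\<forall>e\<in>E. card e = 2)"

definition locally_finite :: "'v set set \<Rightarrow> bool" where
  "locally_finite E \<longleftrightarrow> (\<forall>v. finite {e \<in> E. v \<in> e})"

definition adj_rel :: "'v set set \<Rightarrow> 'v rel" where
  "adj_rel E = {(u, v). {u, v} \<in> E}"

text \<open>Least length of a walk from \<open>u\<close> to \<open>v\<close>; the infimum of the empty set is \<open>\<infinity>\<close> in \<open>enat\<close>.\<close>

definition graph_dist :: "'v set set \<Rightarrow> 'v \<Rightarrow> 'v \<Rightarrow> enat" where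
  "graph_dist E u v = (INF n\<in>{n. (u, v) \<in> adj_rel E ^^ n}. enat n)"

definition automorphisms :: "'v set set \<Rightarrow> ('v \<Rightarrow> 'v) set" where
  "automorphisms E = {\<gamma>. bij \<gamma> \<and> (\<forall>u v. {\<gamma> u, \<gamma> v} \<in> E \<longleftrightarrow> {u, v} \<in> E)}"

definition acts_transitively :: "('v \<Rightarrow> 'v) set \<Rightarrow> bool" where
  "acts_transitively \<Gamma> \<longleftrightarrow> (\<forall>u v. \<exists>\<gamma>\<in>\<Gamma>. \<gamma> u = v)"

definition transitive_graph :: "'v set set \<Rightarrow> bool" where
  "transitive_graph E \<longleftrightarrow> acts_transitively (automorphisms E)"

definition automorphism_group :: "'v set set \<Rightarrow> ('v \<Rightarrow> 'v) set \<Rightarrow> bool" where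
  "automorphism_group E \<Gamma> \<longleftrightarrow> subgroup \<Gamma> (BijGroup UNIV) \<and> \<Gamma> \<subseteq> automorphisms E"

definition edge_boundary :: "'v set set \<Rightarrow> 'v set \<Rightarrow> 'v set set" where
  "edge_boundary E W = {e \<in> E. card (e \<inter> W) = 1}"

definition amenable_graph :: "'v set set \<Rightarrow> bool" where
  "amenable_graph E \<longleftrightarrow>
    (INF W\<in>{W. finite W \<and> W \<noteq> {}}. real (card (edge_boundary E W)) / real (card W)) = 0"

text \<open>
  In a random field \<open>X\<close> on the probability space \<open>M\<close>, the variable at the vertex \<open>v\<close> is \<open>X v\<close>,
  with values in the measurable space \<open>D\<close>. Configurations are functions on the vertices,
  with the product sigma-algebra \<open>PiM UNIV (\<lambda>_. D)\<close>.
\<close>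

definition random_field :: "'w measure \<Rightarrow> 'a measure \<Rightarrow> ('v \<Rightarrow> 'w \<Rightarrow> 'a) \<Rightarrow> bool" where
  "random_field M D X \<longleftrightarrow> prob_space M \<and> (\<forall>v. X v \<in> measurable M D)"

definition field_law :: "'w measure \<Rightarrow> 'a measure \<Rightarrow> ('v \<Rightarrow> 'w \<Rightarrow> 'a) \<Rightarrow> ('v \<Rightarrow> 'a) measure" where
  "field_law M D X = distr M (PiM UNIV (\<lambda>_. D)) (\<lambda>\<omega> v. X v \<omega>)"

definition invariant_field ::
  "('v \<Rightarrow> 'v) set \<Rightarrow> 'w measure \<Rightarrow> 'a measure \<Rightarrow> ('v \<Rightarrow> 'w \<Rightarrow> 'a) \<Rightarrow> bool" where
  "invariant_field \<Gamma> M D X \<longleftrightarrow> (\<forall>\<gamma>\<in>\<Gamma>. field_law M D (\<lambda>v. X (\<gamma> v)) = field_law M D X)"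

definition k_dependent ::
  "'v set set \<Rightarrow> nat \<Rightarrow> 'w measure \<Rightarrow> 'a measure \<Rightarrow> ('v \<Rightarrow> 'w \<Rightarrow> 'a) \<Rightarrow> bool" where
  "k_dependent E k M D X \<longleftrightarrow>
    (\<forall>U V. (\<forall>u\<in>U. \<forall>v\<in>V. graph_dist E u v > enat k) \<longrightarrow>
      prob_space.indep_var M
        (PiM U (\<lambda>_. D)) (\<lambda>\<omega>. \<lambda>u\<in>U. X u \<omega>)
        (PiM V (\<lambda>_. D)) (\<lambda>\<omega>. \<lambda>v\<in>V. X v \<omega>))"

definition finitely_dependent ::
  "'v set set \<Rightarrow> 'w measure \<Rightarrow> 'a measure \<Rightarrow> ('v \<Rightarrow> 'w \<Rightarrow> 'a) \<Rightarrow> bool" where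
  "finitely_dependent E M D X \<longleftrightarrow> (\<exists>k. k_dependent E k M D X)"

definition iid_process :: "'w measure \<Rightarrow> 'a measure \<Rightarrow> ('v \<Rightarrow> 'w \<Rightarrow> 'a) \<Rightarrow> bool" where
  "iid_process N D Y \<longleftrightarrow>
    random_field N D Y \<and> prob_space.indep_vars N (\<lambda>_. D) Y UNIV \<and>
    (\<forall>u v. distr N D (Y u) = distr N D (Y v))"

text \<open>
  Commutation with \<open>y \<mapsto> (\<lambda>v. y (\<gamma> v))\<close> for all \<open>\<gamma> \<in> \<Gamma>\<close>: since \<open>\<Gamma>\<close> is a group, this is the same
  as commutation with the left action \<open>y \<mapsto> (\<lambda>v. y (inv \<gamma> v))\<close>.
\<close>

definition coding ::
  "('v \<Rightarrow> 'v) set \<Rightarrow> 'n measure \<Rightarrow> 't measure \<Rightarrow> ('v \<Rightarrow> 'n \<Rightarrow> 't) \<Rightarrow>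
   'w measure \<Rightarrow> 's measure \<Rightarrow> ('v \<Rightarrow> 'w \<Rightarrow> 's) \<Rightarrow> (('v \<Rightarrow> 't) \<Rightarrow> 'v \<Rightarrow> 's) \<Rightarrow> bool" where
  "coding \<Gamma> N DT Y M DS X \<phi> \<longleftrightarrow>
    \<phi> \<in> measurable (PiM UNIV (\<lambda>_. DT)) (PiM UNIV (\<lambda>_. DS)) \<and>
    (\<forall>\<gamma>\<in>\<Gamma>. \<forall>y\<in>space (PiM UNIV (\<lambda>_. DT)). \<phi> (\<lambda>v. y (\<gamma> v)) = (\<lambda>v. \<phi> y (\<gamma> v))) \<and>
    field_law N DS (\<lambda>v \<omega>. \<phi> (\<lambda>u. Y u \<omega>) v) = field_law M DS X"

text \<open>Coding radius at the vertex \<open>o'\<close> when the alphabet \<open>T\<close> is discrete.\<close>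

definition coding_radius ::
  "'v set set \<Rightarrow> 'v \<Rightarrow> 't set \<Rightarrow> (('v \<Rightarrow> 't) \<Rightarrow> 'v \<Rightarrow> 's) \<Rightarrow> ('v \<Rightarrow> 't) \<Rightarrow> enat" where
  "coding_radius E o' T \<phi> y =
    (INF r\<in>{r. \<forall>y'. (\<forall>v. y' v \<in> T) \<and> (\<forall>v. graph_dist E v o' \<le> enat r \<longrightarrow> y' v = y v)
              \<longrightarrow> \<phi> y' o' = \<phi> y o'}. enat r)"

text \<open>
  Coding radius when the alphabet is the product of finite sets \<open>T 0 \<times> T 1 \<times> \<dots>\<close>. Coordinates are
  numbered from 0, so \<open>i < n\<close> selects the first \<open>n\<close> of them.
\<close>

definition coding_radius_prod ::
  "'v set set \<Rightarrow> 'v \<Rightarrow> (nat \<Rightarrow> 't set) \<Rightarrow> (('v \<Rightarrow> nat \<Rightarrow> 't) \<Rightarrow> 'v \<Rightarrow> 's) \<Rightarrow> ('v \<Rightarrow> nat \<Rightarrow> 't) \<Rightarrow> enat"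
  where
  "coding_radius_prod E o' T \<phi> y =
    (INF r\<in>{r. \<exists>n. \<forall>y'. (\<forall>v i. y' v i \<in> T i) \<and>
                (\<forall>v i. graph_dist E v o' \<le> enat r \<and> i < n \<longrightarrow> y' v i = y v i)
              \<longrightarrow> \<phi> y' o' = \<phi> y o'}. enat r)"

definition finitary_factor ::
  "'v set set \<Rightarrow> ('v \<Rightarrow> 'v) set \<Rightarrow> 'v \<Rightarrow> 'n measure \<Rightarrow> 't set \<Rightarrow> ('v \<Rightarrow> 'n \<Rightarrow> 't) \<Rightarrow>
   'w measure \<Rightarrow> 's set \<Rightarrow> ('v \<Rightarrow> 'w \<Rightarrow> 's) \<Rightarrow> bool" where
  "finitary_factor E \<Gamma> o' N T Y M S X \<longleftrightarrow>
    (\<exists>\<phi>. coding \<Gamma> N (count_space T) Y M (count_space S) X \<phi> \<and>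
      (AE \<omega> in N. coding_radius E o' T \<phi> (\<lambda>v. Y v \<omega>) < \<infinity>))"

definition prod_space :: "(nat \<Rightarrow> 't set) \<Rightarrow> (nat \<Rightarrow> 't) measure" where
  "prod_space T = PiM UNIV (\<lambda>i. count_space (T i))"

definition finitary_factor_prod ::
  "'v set set \<Rightarrow> ('v \<Rightarrow> 'v) set \<Rightarrow> 'v \<Rightarrow> 'n measure \<Rightarrow> (nat \<Rightarrow> 't set) \<Rightarrow> ('v \<Rightarrow> 'n \<Rightarrow> nat \<Rightarrow> 't) \<Rightarrow>
   'w measure \<Rightarrow> 's set \<Rightarrow> ('v \<Rightarrow> 'w \<Rightarrow> 's) \<Rightarrow> bool" where
  "finitary_factor_prod E \<Gamma> o' N T Y M S X \<longleftrightarrow>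
    (\<exists>\<phi>. coding \<Gamma> N (prod_space T) Y M (count_space S) X \<phi> \<and>
      (AE \<omega> in N. coding_radius_prod E o' T \<phi> (\<lambda>v. Y v \<omega>) < \<infinity>))"

text \<open>
  \<open>X\<close> is a finitary factor of some i.i.d. process, whose alphabet is either countable (possibly
  finite) or a countable product of finite sets. HOL cannot quantify existentially over types, so
  the alphabets are realised as sets of natural numbers (resp. products of such sets), and the
  sample space of \<open>Y\<close> is taken in the type of configurations, which carries the canonical version
  of every such process. Neither choice loses generality.
\<close>

definition finitary_factor_of_iid ::
  "'v set set \<Rightarrow> ('v \<Rightarrow> 'v) set \<Rightarrow> 'v \<Rightarrow> 'w measure \<Rightarrow> 's set \<Rightarrow> ('v \<Rightarrow> 'w \<Rightarrow> 's) \<Rightarrow> bool" where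
  "finitary_factor_of_iid E \<Gamma> o' M S X \<longleftrightarrow>
    (\<exists>(N :: ('v \<Rightarrow> nat) measure) (T :: nat set) Y.
        iid_process N (count_space T) Y \<and> finitary_factor E \<Gamma> o' N T Y M S X) \<or>
    (\<exists>(N :: ('v \<Rightarrow> nat \<Rightarrow> nat) measure) (T :: nat \<Rightarrow> nat set) Y.
        (\<forall>i. finite (T i)) \<and> iid_process N (prod_space T) Y \<and>
        finitary_factor_prod E \<Gamma> o' N T Y M S X)"

end

theory Submission
  imports Defs
begin

text \<open>
  Amenability yields, from independent bits attached to the vertices, nested partitions into finite
  cells of bounded range such that any two vertices of a component end up in a common cell.
  To obtain a partition that rarely separates neighbours, consider all \<open>\<Gamma>\<close>-translates of a connected
  Foelner set and let a translate fire in a round when all its bits are 1; a vertex is labelled by the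
  translates containing it in the first round in which one fires. Averaging over a much larger Foelner
  set, which replaces unimodularity, shows that a given edge is rarely cut.

  Let the level of \<open>v\<close> be the first stage whose cell at \<open>v\<close> contains the ball of radius \<open>k\<close> about \<open>v\<close>, and
  let \<open>u\<close> precede \<open>v\<close> when \<open>u\<close> lies in that cell of \<open>v\<close> and comes earlier in the order given by level and an
  independent random label. Then every vertex has finitely many predecessors, two vertices at distance
  at most \<open>k\<close> are comparable, and two vertices with a common predecessor are comparable. By
  \<open>k\<close>-dependence the conditional law of \<open>X v\<close> given all vertices explored before it therefore depends
  only on the values at its predecessors, so that \<open>X\<close> can be sampled along this order, every value
  being determined by finitely many bits. The conditional laws form countably many \<open>\<Gamma>\<close>-orbits; each
  orbit receives its own independent sample at every vertex.
\<close>

section \<open>Graph balls and automorphisms\<close>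

text \<open>The order has to be transitive, not merely acyclic: predecessor sets are then closed
  downwards, and one finite set of vertices certifies a value. Comparability of vertices with a
  common predecessor is what lets \<open>k\<close>-dependence discard the rest: a vertex near a
  predecessor of a maximal \<open>w\<close> is comparable with \<open>w\<close>, hence itself a
  predecessor. The bits deciding the order are kept apart from those deciding values, so one may
  condition on the order.

  A vertex may have a non-trivial stabiliser, so a pattern of values around it has no canonical
  name; only its orbit has one. Indexing the tosses by orbits makes equivalent situations read the
  same bits, and makes the bias of a bit independent of the vertex, as an i.i.d. field requires.

  That sampling terminates is not shown directly. The probability of each finite pattern of sampled
  values is only bounded below by its probability under \<open>X\<close>; since the latter sum to
  one, the bounds are equalities, and almost sure existence of the values follows.\<close>

definition adj :: "'v set set \<Rightarrow> 'v \<Rightarrow> 'v \<Rightarrow> bool" where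
  "adj E u v \<longleftrightarrow> {u, v} \<in> E"

text \<open>A ball given by walk lengths in \<open>nat\<close>, so that no argument has to compute
  in \<open>enat\<close>; \<open>graph_dist_le_iff\<close> translates back.\<close>

definition nball :: "'v set set \<Rightarrow> 'v \<Rightarrow> nat \<Rightarrow> 'v set" where
  "nball E v r = {u. \<exists>n\<le>r. (u, v) \<in> adj_rel E ^^ n}"

text \<open>Boundary edges are oriented, inner endpoint first, so that their number splits as a sum
  over the vertices of \<open>A\<close>.\<close>

definition bdry :: "'v set set \<Rightarrow> 'v set \<Rightarrow> ('v \<times> 'v) set" where
  "bdry E A = {(x, y). x \<in> A \<and> y \<notin> A \<and> adj E x y}"

text \<open>Connectedness of the induced subgraph, phrased by cuts: this makes a minimal Foelner set connected.\<close>

definition linked :: "'v set set \<Rightarrow> 'v set \<Rightarrow> bool" where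
  "linked E A \<longleftrightarrow> (\<forall>W. A \<inter> W \<noteq> {} \<and> \<not> A \<subseteq> W \<longrightarrow> (\<exists>x\<in>A \<inter> W. \<exists>y\<in>A - W. adj E x y))"

lemma adj_sym: "adj E u v \<longleftrightarrow> adj E v u"
  by (simp add: adj_def insert_commute)

lemma adj_rel_iff: "(u, v) \<in> adj_rel E \<longleftrightarrow> adj E u v"
  by (simp add: adj_rel_def adj_def)

lemma nball_self[simp]: "v \<in> nball E v r"
  by (auto simp: nball_def intro!: exI[of _ 0])

lemma nball_0[simp]: "nball E v 0 = {v}"
  by (auto simp: nball_def)

lemma nball_mono: "r \<le> s \<Longrightarrow> nball E v r \<subseteq> nball E v s"
  by (auto simp: nball_def intro: le_trans)

lemma nball_trans:
  assumes "u \<in> nball E v r" "w \<in> nball E u s" shows "w \<in> nball E v (r + s)"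
proof -
  from assms obtain n m where n: "n \<le> r" "(u, v) \<in> adj_rel E ^^ n" and m: "m \<le> s" "(w, u) \<in> adj_rel E ^^ m"
    by (auto simp: nball_def)
  then have "(w, v) \<in> adj_rel E ^^ (m + n)"
    by (auto simp: relpow_add)
  with n m show ?thesis by (auto simp: nball_def intro!: exI[of _ "m + n"])
qed

lemma relpow_adj_sym: "(u, v) \<in> adj_rel E ^^ n \<Longrightarrow> (v, u) \<in> adj_rel E ^^ n"
proof (induction n arbitrary: u v)
  case (Suc n)
  from Suc.prems obtain w where w: "(u, w) \<in> adj_rel E ^^ n" "(w, v) \<in> adj_rel E" by auto
  then have "(v, w) \<in> adj_rel E" by (simp add: adj_rel_iff adj_sym)
  with Suc.IH[OF w(1)] show ?case by (meson relpow_Suc_I2)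
qed auto

lemma nball_sym: "u \<in> nball E v r \<longleftrightarrow> v \<in> nball E u r"
  unfolding nball_def mem_Collect_eq by (metis relpow_adj_sym)

lemma nball_Suc: "nball E v (Suc r) = nball E v r \<union> {u. \<exists>w\<in>nball E v r. adj E u w}"
proof (intro equalityI subsetI)
  fix u assume "u \<in> nball E v (Suc r)"
  then obtain n where n: "n \<le> Suc r" "(u, v) \<in> adj_rel E ^^ n" by (auto simp: nball_def)
  show "u \<in> nball E v r \<union> {u. \<exists>w\<in>nball E v r. adj E u w}"
  proof (cases n)
    case 0 then show ?thesis using n by (auto simp: nball_def intro!: exI[of _ 0])
  next
    case (Suc m)
    then obtain w where "(u, w) \<in> adj_rel E" "(w, v) \<in> adj_rel E ^^ m"
      using n(2) by (metis relpow_Suc_E2)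
    then show ?thesis using n(1) Suc by (auto simp: adj_rel_iff nball_def)
  qed
next
  fix u assume u: "u \<in> nball E v r \<union> {u. \<exists>w\<in>nball E v r. adj E u w}"
  show "u \<in> nball E v (Suc r)"
  proof (cases "u \<in> nball E v r")
    case True then show ?thesis using nball_mono[of r "Suc r" E v] by auto
  next
    case False
    with u obtain w n where "adj E u w" "n \<le> r" "(w, v) \<in> adj_rel E ^^ n" by (auto simp: nball_def)
    then show ?thesis unfolding nball_def
      by (auto intro!: exI[of _ "Suc n"] relpow_Suc_I2 simp: adj_rel_iff[symmetric] simp del: relpow.simps)
  qed
qed

lemma nball_adj: "w \<in> nball E v r \<Longrightarrow> adj E u w \<Longrightarrow> u \<in> nball E v (Suc r)"
  by (auto simp: nball_Suc)

lemma graph_dist_le_iff: "graph_dist E u v \<le> enat r \<longleftrightarrow> u \<in> nball E v r"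
proof
  assume *: "graph_dist E u v \<le> enat r"
  let ?S = "enat ` {n. (u, v) \<in> adj_rel E ^^ n}"
  have ne: "?S \<noteq> {}"
  proof
    assume "?S = {}"
    then have "graph_dist E u v = \<infinity>" by (simp add: graph_dist_def top_enat_def)
    with * show False by simp
  qed
  then have "Inf ?S \<in> ?S" by (metis wellorder_InfI ex_in_conv)
  then obtain n where "(u, v) \<in> adj_rel E ^^ n" "graph_dist E u v = enat n"
    by (auto simp: graph_dist_def)
  with * show "u \<in> nball E v r" by (auto simp: nball_def)
next
  assume "u \<in> nball E v r"
  then obtain n where "n \<le> r" "(u, v) \<in> adj_rel E ^^ n" by (auto simp: nball_def)
  then show "graph_dist E u v \<le> enat r"
    unfolding graph_dist_def by (intro INF_lower2[of n]) auto
qed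

text \<open>As long as the ball does not swallow \<open>A\<close>, the cut it makes in
  \<open>A\<close> is crossed by an edge, so the next ball contains at least one more vertex of
  \<open>A\<close>.\<close>

lemma linked_subset_nball:
  assumes "finite A" "linked E A" "x \<in> A" shows "A \<subseteq> nball E x (card A)"
proof -
  have "A \<subseteq> nball E x r \<or> r < card (A \<inter> nball E x r)" for r
  proof (induction r)
    case 0 then show ?case using assms(3) by auto
  next
    case (Suc r)
    show ?case
    proof (cases "A \<subseteq> nball E x r")
      case True then show ?thesis using nball_mono[of r "Suc r" E x] by auto
    next
      case False
      have "A \<inter> nball E x r \<noteq> {}" using assms(3) by (auto intro!: exI[of _ x])
      with False assms(2) obtain y z where y: "y \<in> A" "y \<in> nball E x r" "z \<in> A" "z \<notin> nball E x r" "adj E y z"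
        unfolding linked_def by blast
      then have "z \<in> nball E x (Suc r)" by (meson nball_adj adj_sym)
      then have "A \<inter> nball E x r \<subset> A \<inter> nball E x (Suc r)"
        using y nball_mono[of r "Suc r" E x] by auto
      then have "card (A \<inter> nball E x r) < card (A \<inter> nball E x (Suc r))"
        using assms(1) by (intro psubset_card_mono) auto
      with Suc False show ?thesis by auto
    qed
  qed
  from this[of "card A"] show ?thesis
    using card_mono[OF assms(1), of "A \<inter> nball E x (card A)"] by auto
qed

locale aut_graph =
  fixes E :: "'v set set" and \<Gamma> :: "('v \<Rightarrow> 'v) set"
  assumes vcountable: "countable (UNIV :: 'v set)"
    and loc_fin: "locally_finite E"
    and amenable: "amenable_graph E"
    and \<Gamma>_group: "automorphism_group E \<Gamma>"
    and \<Gamma>_trans: "acts_transitively \<Gamma>"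
begin

lemma \<Gamma>_sub: "subgroup \<Gamma> (BijGroup UNIV)"
  using \<Gamma>_group by (simp add: automorphism_group_def)

lemma \<Gamma>_bij: "\<gamma> \<in> \<Gamma> \<Longrightarrow> bij \<gamma>"
  using \<Gamma>_group by (auto simp: automorphism_group_def automorphisms_def)

lemma \<Gamma>_inj: "\<gamma> \<in> \<Gamma> \<Longrightarrow> inj \<gamma>"
  using \<Gamma>_bij bij_def by blast

lemma \<Gamma>_adj: "\<gamma> \<in> \<Gamma> \<Longrightarrow> adj E (\<gamma> u) (\<gamma> v) \<longleftrightarrow> adj E u v"
  using \<Gamma>_group by (auto simp: automorphism_group_def automorphisms_def adj_def)

lemma \<Gamma>_comp: "\<gamma> \<in> \<Gamma> \<Longrightarrow> \<delta> \<in> \<Gamma> \<Longrightarrow> (\<lambda>v. \<gamma> (\<delta> v)) \<in> \<Gamma>"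
proof -
  assume "\<gamma> \<in> \<Gamma>" "\<delta> \<in> \<Gamma>"
  moreover from this have "\<gamma> \<in> Bij UNIV" "\<delta> \<in> Bij UNIV" using \<Gamma>_bij by (auto simp: Bij_def)
  ultimately show ?thesis
    using subgroup.m_closed[OF \<Gamma>_sub, of \<gamma> \<delta>] by (simp add: BijGroup_def compose_def restrict_UNIV)
qed

lemma \<Gamma>_id: "(\<lambda>v. v) \<in> \<Gamma>"
  using subgroup.one_closed[OF \<Gamma>_sub] by (simp add: BijGroup_def restrict_UNIV)

lemma \<Gamma>_inv: "\<gamma> \<in> \<Gamma> \<Longrightarrow> inv_into UNIV \<gamma> \<in> \<Gamma>"
proof -
  assume g: "\<gamma> \<in> \<Gamma>"
  then have "\<gamma> \<in> Bij UNIV" using \<Gamma>_bij by (auto simp: Bij_def)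
  with subgroup.m_inv_closed[OF \<Gamma>_sub g] show ?thesis
    by (simp add: inv_BijGroup restrict_UNIV)
qed

lemma \<Gamma>_inv_simps[simp]: "\<gamma> \<in> \<Gamma> \<Longrightarrow> \<gamma> (inv_into UNIV \<gamma> v) = v" "\<gamma> \<in> \<Gamma> \<Longrightarrow> inv_into UNIV \<gamma> (\<gamma> v) = v"
  using \<Gamma>_bij by (auto simp: bij_is_surj surj_f_inv_f bij_is_inj)

lemma \<Gamma>_moves: "\<exists>\<gamma>\<in>\<Gamma>. \<gamma> u = v"
  using \<Gamma>_trans by (auto simp: acts_transitively_def)

lemma \<Gamma>_all: "\<gamma> \<in> \<Gamma> \<Longrightarrow> (\<forall>v. P (\<gamma> v)) \<longleftrightarrow> (\<forall>v. P v)"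
  by (metis \<Gamma>_inv_simps(1))

lemma \<Gamma>_ex: "\<gamma> \<in> \<Gamma> \<Longrightarrow> (\<exists>v. P (\<gamma> v)) \<longleftrightarrow> (\<exists>v. P v)"
  by (metis \<Gamma>_inv_simps(1))

lemma \<Gamma>_nball: "\<gamma> \<in> \<Gamma> \<Longrightarrow> \<gamma> u \<in> nball E (\<gamma> v) r \<longleftrightarrow> u \<in> nball E v r"
proof (induction r arbitrary: u)
  case 0 then show ?case by (simp add: inj_eq \<Gamma>_inj)
next
  case (Suc r)
  have "(\<exists>w. w \<in> nball E (\<gamma> v) r \<and> adj E (\<gamma> u) w) \<longleftrightarrow> (\<exists>w. \<gamma> w \<in> nball E (\<gamma> v) r \<and> adj E (\<gamma> u) (\<gamma> w))"
    using \<Gamma>_ex[OF Suc.prems, of "\<lambda>w. w \<in> nball E (\<gamma> v) r \<and> adj E (\<gamma> u) w"] by simp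
  then show ?case using Suc by (auto simp: nball_Suc \<Gamma>_adj Bex_def)
qed

lemma finite_nbrs: "finite {u. adj E u v}"
proof -
  have "(\<lambda>u. {u, v}) ` {u. adj E u v} \<subseteq> {e \<in> E. v \<in> e}" by (auto simp: adj_def)
  moreover have "inj_on (\<lambda>u. {u, v}) {u. adj E u v}"
    by (auto simp: inj_on_def doubleton_eq_iff)
  moreover have "finite {e \<in> E. v \<in> e}" using loc_fin by (simp add: locally_finite_def)
  ultimately show ?thesis
    using finite_imageD finite_subset by blast
qed

lemma finite_nball[simp]: "finite (nball E v r)"
proof (induction r)
  case (Suc r)
  have "{u. \<exists>w\<in>nball E v r. adj E u w} = (\<Union>w\<in>nball E v r. {u. adj E u w})" by auto
  with Suc show ?case by (simp add: nball_Suc finite_nbrs)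
qed simp

lemma finite_bdry: "finite A \<Longrightarrow> finite (bdry E A)"
proof -
  assume "finite A"
  moreover have "bdry E A \<subseteq> (SIGMA x:A. {y. adj E y x})" by (auto simp: bdry_def adj_sym)
  ultimately show ?thesis using finite_nbrs by (meson finite_SigmaI finite_subset)
qed

lemma card_bdry_le: "finite A \<Longrightarrow> card (bdry E A) \<le> card (edge_boundary E A)"
proof (rule card_inj_on_le[where f = "\<lambda>(x, y). {x, y}"])
  show "inj_on (\<lambda>(x, y). {x, y}) (bdry E A)"
    by (auto simp: inj_on_def bdry_def doubleton_eq_iff)
  show "(\<lambda>(x, y). {x, y}) ` bdry E A \<subseteq> edge_boundary E A"
  proof clarify
    fix x y assume "(x, y) \<in> bdry E A"
    then have "{x, y} \<inter> A = {x}" "{x, y} \<in> E" by (auto simp: bdry_def adj_def)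
    then show "{x, y} \<in> edge_boundary E A" by (simp add: edge_boundary_def)
  qed
  assume "finite A"
  moreover have "edge_boundary E A \<subseteq> (\<Union>v\<in>A. {e \<in> E. v \<in> e})"
  proof
    fix e assume e: "e \<in> edge_boundary E A"
    then have "e \<inter> A \<noteq> {}" by (auto simp: edge_boundary_def)
    with e show "e \<in> (\<Union>v\<in>A. {e \<in> E. v \<in> e})" by (auto simp: edge_boundary_def)
  qed
  moreover have "finite {e \<in> E. v \<in> e}" for v using loc_fin by (simp add: locally_finite_def)
  ultimately show "finite (edge_boundary E A)"
    by (meson finite_UN_I finite_subset)
qed

section \<open>Foelner sets and their translates\<close>

lemma foelner:
  assumes "\<epsilon> > 0"
  shows "\<exists>A. finite A \<and> A \<noteq> {} \<and> real (card (bdry E A)) \<le> \<epsilon> * real (card A)"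
proof -
  let ?f = "\<lambda>W. real (card (edge_boundary E W)) / real (card W)"
  let ?S = "{W :: 'v set. finite W \<and> W \<noteq> {}}"
  have "Inf (?f ` ?S) < \<epsilon>" using amenable assms by (simp add: amenable_graph_def)
  moreover have "{undefined} \<in> ?S" by simp
  then have "?f ` ?S \<noteq> {}" by blast
  ultimately obtain y where "y \<in> ?f ` ?S" "y < \<epsilon>" by (meson cInf_lessD)
  then obtain A where A: "finite A" "A \<noteq> {}" "?f A < \<epsilon>" by auto
  then have "real (card (edge_boundary E A)) \<le> \<epsilon> * real (card A)"
    by (simp add: divide_less_eq card_gt_0_iff)
  with card_bdry_le[OF A(1)] A show ?thesis by (intro exI[of _ A]) auto
qed

text \<open>Take a set of least cardinality with small boundary ratio. A cut crossed by no edge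
  would split both cardinality and boundary additively, so one of the two halves would be a smaller
  set with ratio at most \<epsilon>.\<close>

lemma foelner_linked:
  assumes "\<epsilon> > 0"
  shows "\<exists>A. finite A \<and> A \<noteq> {} \<and> linked E A \<and> real (card (bdry E A)) \<le> \<epsilon> * real (card A)"
proof -
  let ?P = "\<lambda>A. finite A \<and> A \<noteq> {} \<and> real (card (bdry E A)) \<le> \<epsilon> * real (card A)"
  obtain A where A: "?P A" and min: "\<And>B. card B < card A \<Longrightarrow> \<not> ?P B"
    using exists_least_iff[of "\<lambda>n. \<exists>A. ?P A \<and> card A = n"] foelner[OF assms] by blast
  have "linked E A" unfolding linked_def
  proof (intro allI impI, rule ccontr)
    fix W assume W: "A \<inter> W \<noteq> {} \<and> \<not> A \<subseteq> W" and no: "\<not> (\<exists>x\<in>A \<inter> W. \<exists>y\<in>A - W. adj E x y)"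
    let ?B = "A \<inter> W" and ?C = "A - W"
    have no': "\<not> adj E y x" if "x \<in> A \<inter> W" "y \<in> A - W" for x y
      using no that adj_sym by metis
    have bdry: "bdry E A = bdry E ?B \<union> bdry E ?C"
      using no no' by (auto simp: bdry_def)
    have "bdry E ?B \<inter> bdry E ?C = {}" by (auto simp: bdry_def)
    then have cbd: "card (bdry E A) = card (bdry E ?B) + card (bdry E ?C)"
      unfolding bdry using A by (intro card_Un_disjoint finite_bdry) auto
    have cA: "card A = card ?B + card ?C"
      using A by (metis card_Int_Diff)
    have "card ?B > 0" "card ?C > 0" using W A by (auto simp: card_gt_0_iff)
    then have "\<not> ?P ?B" "\<not> ?P ?C" using cA by (intro min; linarith)+
    then have "real (card (bdry E ?B)) > \<epsilon> * real (card ?B)" "real (card (bdry E ?C)) > \<epsilon> * real (card ?C)"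
      using W A by auto
    then have "real (card (bdry E A)) > \<epsilon> * real (card A)"
      unfolding cbd cA by (simp add: algebra_simps)
    with A show False by simp
  qed
  with A show ?thesis by blast
qed

lemma \<Gamma>_linked: "\<gamma> \<in> \<Gamma> \<Longrightarrow> linked E A \<Longrightarrow> linked E (\<gamma> ` A)"
  unfolding linked_def
proof (intro allI impI)
  fix W assume g: "\<gamma> \<in> \<Gamma>" and W: "\<gamma> ` A \<inter> W \<noteq> {} \<and> \<not> \<gamma> ` A \<subseteq> W"
    and *: "\<forall>W. A \<inter> W \<noteq> {} \<and> \<not> A \<subseteq> W \<longrightarrow> (\<exists>x\<in>A \<inter> W. \<exists>y\<in>A - W. adj E x y)"
  let ?W = "\<gamma> -` W"
  have "A \<inter> ?W \<noteq> {} \<and> \<not> A \<subseteq> ?W" using W by auto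
  from *[rule_format, OF this] obtain x y where "x \<in> A \<inter> ?W" "y \<in> A - ?W" "adj E x y"
    by (elim bexE)
  then have "\<gamma> x \<in> \<gamma> ` A \<inter> W" "\<gamma> y \<in> \<gamma> ` A - W" "adj E (\<gamma> x) (\<gamma> y)" using g by (auto simp: \<Gamma>_adj)
  then show "\<exists>x\<in>\<gamma> ` A \<inter> W. \<exists>y\<in>\<gamma> ` A - W. adj E x y" by blast
qed

lemma \<Gamma>_bdry: "\<gamma> \<in> \<Gamma> \<Longrightarrow> card (bdry E (\<gamma> ` A)) = card (bdry E A)"
proof -
  assume g: "\<gamma> \<in> \<Gamma>"
  have "bdry E (\<gamma> ` A) = map_prod \<gamma> \<gamma> ` bdry E A"
  proof (intro equalityI subsetI)
    fix p assume "p \<in> bdry E (\<gamma> ` A)"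
    then obtain x y where p: "p = (\<gamma> x, y)" "x \<in> A" "y \<notin> \<gamma> ` A" "adj E (\<gamma> x) y" by (auto simp: bdry_def)
    obtain z where z: "y = \<gamma> z" using \<Gamma>_ex[OF g, of "\<lambda>z. y = z"] by blast
    with p g have "adj E x z" "z \<notin> A" by (auto simp: \<Gamma>_adj)
    with p(2) have "(x, z) \<in> bdry E A" by (simp add: bdry_def)
    then show "p \<in> map_prod \<gamma> \<gamma> ` bdry E A" using p(1) z by force
  next
    fix p assume "p \<in> map_prod \<gamma> \<gamma> ` bdry E A"
    then obtain x y where "p = (\<gamma> x, \<gamma> y)" "x \<in> A" "y \<notin> A" "adj E x y" by (auto simp: bdry_def)
    then show "p \<in> bdry E (\<gamma> ` A)"
      using g by (simp add: bdry_def \<Gamma>_adj inj_image_mem_iff[OF \<Gamma>_inj[OF g]])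
  qed
  moreover have "inj (map_prod \<gamma> \<gamma>)" using \<Gamma>_inj[OF g] by (simp add: prod.inj_map)
  then have "inj_on (map_prod \<gamma> \<gamma>) (bdry E A)" by (rule inj_on_subset) simp
  ultimately show ?thesis by (simp add: card_image)
qed

text \<open>The tiles are translates of one linked Foelner set \<open>F\<close>, taken as sets, so
  that only finitely many contain a given vertex even if stabilisers are infinite. The small
  boundary ratio of \<open>F\<close> is an average over the vertices of a tile, whereas the claim
  fixes a vertex and averages over the tiles through it. Double counting tiles and their vertices
  inside a much larger Foelner set \<open>W\<close> passes from one average to the other.\<close>

lemma tiling:
  assumes "\<epsilon> > 0"
  shows "\<exists>\<O> N f. N \<ge> 1 \<and> f \<ge> 1 \<and> (\<forall>A\<in>\<O>. \<forall>\<gamma>\<in>\<Gamma>. \<gamma> ` A \<in> \<O>) \<and>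
    (\<forall>A\<in>\<O>. finite A \<and> card A = f \<and> (\<forall>x\<in>A. A \<subseteq> nball E x f)) \<and>
    (\<forall>x. finite {A\<in>\<O>. x \<in> A} \<and> card {A\<in>\<O>. x \<in> A} = N) \<and>
    (\<forall>x y. adj E x y \<longrightarrow> real (card {A\<in>\<O>. x \<in> A \<and> y \<notin> A}) \<le> \<epsilon> * real N)"
proof -
  obtain F where F: "finite F" "F \<noteq> {}" "linked E F" "real (card (bdry E F)) \<le> \<epsilon> * real (card F)"
    using foelner_linked[OF assms] by blast
  define \<O> where "\<O> = (\<lambda>\<gamma>. \<gamma> ` F) ` \<Gamma>"
  define f where "f = card F"
  define O' where "O' x = {A\<in>\<O>. x \<in> A}" for x
  have closed: "\<gamma> ` A \<in> \<O>" if "A \<in> \<O>" "\<gamma> \<in> \<Gamma>" for A \<gamma>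
    using that \<Gamma>_comp by (auto simp: \<O>_def image_image)
  have fin: "finite A" and card: "card A = f" and con: "linked E A" and bdA: "card (bdry E A) = card (bdry E F)"
    if "A \<in> \<O>" for A
    using that F by (auto simp: \<O>_def f_def \<Gamma>_linked \<Gamma>_bdry intro!: card_image inj_on_subset[OF \<Gamma>_inj])
  have sub: "A \<subseteq> nball E x f" if "A \<in> \<O>" "x \<in> A" for A x
    using linked_subset_nball[OF fin con] that card by auto
  \<comment> \<open>By linkedness, every tile through \<open>x\<close> is a subset of one fixed ball
    about \<open>x\<close>.\<close>
  have finO: "finite (O' x)" for x
    by (rule finite_subset[of _ "Pow (nball E x f)"]) (use sub in \<open>auto simp: O'_def\<close>)
  have eqO: "O' (\<gamma> x) = (\<lambda>A. \<gamma> ` A) ` O' x" if g: "\<gamma> \<in> \<Gamma>" for \<gamma> x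
  proof (intro equalityI subsetI)
    fix A assume A: "A \<in> O' (\<gamma> x)"
    then have "A \<in> \<O>" "\<gamma> x \<in> A" by (auto simp: O'_def)
    then have "inv_into UNIV \<gamma> ` A \<in> \<O>" "inv_into UNIV \<gamma> (\<gamma> x) \<in> inv_into UNIV \<gamma> ` A"
      using closed[OF _ \<Gamma>_inv[OF g]] by blast+
    then have "inv_into UNIV \<gamma> ` A \<in> O' x" using g by (simp add: O'_def)
    moreover have "A = \<gamma> ` inv_into UNIV \<gamma> ` A" using g by (simp add: image_image)
    ultimately show "A \<in> (\<lambda>A. \<gamma> ` A) ` O' x" by blast
  qed (use closed g in \<open>auto simp: O'_def\<close>)
  have injg: "inj_on (\<lambda>A. \<gamma> ` A) X" if g: "\<gamma> \<in> \<Gamma>" for \<gamma> X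
    using \<Gamma>_inj[OF g] by (simp add: inj_on_def inj_image_eq_iff)
  obtain o' :: 'v where True by blast
  define N where "N = card (O' o')"
  have N: "card (O' x) = N" for x
  proof -
    obtain \<gamma> where "\<gamma> \<in> \<Gamma>" "\<gamma> o' = x" using \<Gamma>_moves by blast
    then show ?thesis unfolding N_def using eqO[of \<gamma> o'] by (simp add: card_image injg)
  qed
  define dg where "dg A x = card {y. y \<notin> A \<and> adj E x y}" for A x
  have fdg: "finite {y. y \<notin> A \<and> adj E x y}" for A x
    by (rule finite_subset[OF _ finite_nbrs[of x]]) (auto simp: adj_sym)
  have dg: "dg (\<gamma> ` A) (\<gamma> x) = dg A x" if g: "\<gamma> \<in> \<Gamma>" for \<gamma> A x
  proof -
    have "{y. y \<notin> \<gamma> ` A \<and> adj E (\<gamma> x) y} = \<gamma> ` {y. y \<notin> A \<and> adj E x y}"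
    proof (intro equalityI subsetI)
      fix y assume y: "y \<in> {y. y \<notin> \<gamma> ` A \<and> adj E (\<gamma> x) y}"
      obtain z where z: "y = \<gamma> z" using \<Gamma>_ex[OF g, of "\<lambda>z. y = z"] by blast
      with y g have "adj E x z" "z \<notin> A" by (auto simp: \<Gamma>_adj)
      with z show "y \<in> \<gamma> ` {y. y \<notin> A \<and> adj E x y}" by blast
    next
      fix z assume "z \<in> \<gamma> ` {y. y \<notin> A \<and> adj E x y}"
      then obtain y where y: "z = \<gamma> y" "y \<notin> A" "adj E x y" by blast
      then show "z \<in> {y. y \<notin> \<gamma> ` A \<and> adj E (\<gamma> x) y}"
        using g by (simp add: \<Gamma>_adj inj_image_mem_iff[OF \<Gamma>_inj[OF g]])
    qed
    then show ?thesis unfolding dg_def by (simp add: card_image inj_on_subset[OF \<Gamma>_inj[OF g], OF subset_UNIV])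
  qed
  have sum_dg: "(\<Sum>x\<in>A. dg A x) = card (bdry E A)" if "finite A" for A
  proof -
    have "bdry E A = (SIGMA x:A. {y. y \<notin> A \<and> adj E x y})" by (auto simp: bdry_def)
    then show ?thesis using that fdg by (simp add: dg_def card_SigmaI)
  qed
  \<comment> \<open>The number of boundary edges at a vertex, summed over all tiles containing it.
    It is the same at every vertex, so it may be estimated by averaging.\<close>
  define s where "s = (\<Sum>A\<in>O' o'. dg A o')"
  have s: "(\<Sum>A\<in>O' x. dg A x) = s" for x
  proof -
    obtain \<gamma> where "\<gamma> \<in> \<Gamma>" "\<gamma> o' = x" using \<Gamma>_moves by blast
    then show ?thesis unfolding s_def using eqO[of \<gamma> o'] dg by (auto simp: sum.reindex injg)
  qed
  \<comment> \<open>Tiles inside \<open>W\<close> contribute at most \<epsilon> per vertex by the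
    choice of \<open>F\<close>. A tile sticking out of \<open>W\<close> is charged with its whole
    boundary, and there are at most \<open>N * card (bdry E W)\<close> of these.\<close>
  have main: "real s * real (card W) \<le> \<epsilon> * real N * real (card W) + real (card (bdry E F)) * (real N * real (card (bdry E W)))"
    if W: "finite W" for W
  proof -
    define OW where "OW = (\<Union>x\<in>W. O' x)"
    have fOW: "finite OW" using W finO by (auto simp: OW_def)
    have swap: "(\<Sum>x\<in>W. \<Sum>A\<in>O' x. h A x) = (\<Sum>A\<in>OW. \<Sum>x\<in>A \<inter> W. h A x)" for h :: "'v set \<Rightarrow> 'v \<Rightarrow> real"
    proof -
      have "(\<Sum>x\<in>W. \<Sum>A\<in>O' x. h A x) = (\<Sum>x\<in>W. \<Sum>A | A \<in> OW \<and> x \<in> A. h A x)"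
        by (intro sum.cong) (auto simp: O'_def OW_def)
      also have "\<dots> = (\<Sum>A\<in>OW. \<Sum>x | x \<in> W \<and> x \<in> A. h A x)"
        by (rule sum.swap_restrict[OF W fOW])
      finally show ?thesis by (simp add: Int_def conj_commute)
    qed
    have OW: "A \<in> \<O>" if "A \<in> OW" for A using that by (auto simp: OW_def O'_def)
    have 1: "real N * real (card W) = (\<Sum>A\<in>OW. real (card (A \<inter> W)))"
      using swap[of "\<lambda>_ _. 1"] N by (simp add: mult.commute)
    have 2: "real s * real (card W) = (\<Sum>A\<in>OW. \<Sum>x\<in>A \<inter> W. real (dg A x))"
      using swap[of "\<lambda>A x. real (dg A x)"] s by (simp add: mult.commute flip: of_nat_sum)
    have 3: "(\<Sum>x\<in>A \<inter> W. real (dg A x)) \<le> \<epsilon> * real (card (A \<inter> W)) + (if A \<subseteq> W then 0 else real (card (bdry E F)))"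
      if A: "A \<in> OW" for A
    proof -
      have "(\<Sum>x\<in>A \<inter> W. real (dg A x)) \<le> (\<Sum>x\<in>A. real (dg A x))"
        using fin[OF OW[OF A]] by (intro sum_mono2) auto
      also have "\<dots> = real (card (bdry E F))"
        using sum_dg[OF fin[OF OW[OF A]]] bdA[OF OW[OF A]] by (simp flip: of_nat_sum)
      finally have *: "(\<Sum>x\<in>A \<inter> W. real (dg A x)) \<le> real (card (bdry E F))" .
      show ?thesis
      proof (cases "A \<subseteq> W")
        case True
        then show ?thesis using * F(4) card[OF OW[OF A]] by (simp add: f_def Int_absorb2)
      next
        case False
        have "0 \<le> \<epsilon> * real (card (A \<inter> W))" using assms by simp
        with * False show ?thesis by simp
      qed
    qed
    let ?O2 = "{A\<in>OW. \<not> A \<subseteq> W}"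
    \<comment> \<open>A linked tile that meets \<open>W\<close> without lying in it contains an edge
      leaving \<open>W\<close>.\<close>
    have "?O2 \<subseteq> (\<Union>p\<in>bdry E W. O' (fst p))"
    proof
      fix A assume A: "A \<in> ?O2"
      then have "A \<inter> W \<noteq> {}" by (auto simp: OW_def O'_def)
      with A con[OF OW] obtain x y where "x \<in> A \<inter> W" "y \<in> A - W" "adj E x y"
        unfolding linked_def by blast
      then have "(x, y) \<in> bdry E W" "A \<in> O' x" using A OW by (auto simp: bdry_def O'_def)
      then show "A \<in> (\<Union>p\<in>bdry E W. O' (fst p))" by force
    qed
    then have "card ?O2 \<le> card (\<Union>p\<in>bdry E W. O' (fst p))"
      using finite_bdry[OF W] finO by (intro card_mono) auto
    also have "\<dots> \<le> (\<Sum>p\<in>bdry E W. card (O' (fst p)))" by (rule card_UN_le[OF finite_bdry[OF W]])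
    finally have 4: "card ?O2 \<le> N * card (bdry E W)" by (simp add: N mult.commute)
    have "real s * real (card W) \<le> (\<Sum>A\<in>OW. \<epsilon> * real (card (A \<inter> W)) + (if A \<subseteq> W then 0 else real (card (bdry E F))))"
      unfolding 2 by (intro sum_mono 3)
    also have "\<dots> = \<epsilon> * real N * real (card W) + real (card (bdry E F)) * real (card ?O2)"
    proof -
      have "(\<Sum>A\<in>OW. if A \<subseteq> W then 0 else real (card (bdry E F))) = (\<Sum>A\<in>?O2. real (card (bdry E F)))"
        using fOW by (intro sum.mono_neutral_cong_right) auto
      then show ?thesis unfolding mult.assoc 1 by (simp add: sum.distrib sum_distrib_left)
    qed
    also have "real (card ?O2) \<le> real N * real (card (bdry E W))" using 4 by (metis of_nat_le_iff of_nat_mult)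
    finally show ?thesis by (simp add: mult_left_mono)
  qed
  have s_le: "real s \<le> \<epsilon> * real N"
  proof (rule field_le_epsilon)
    fix e :: real assume e: "e > 0"
    let ?c = "real (card (bdry E F)) * real N"
    have c: "?c \<ge> 0" by simp
    with e have "e / (?c + 1) > 0" by (intro divide_pos_pos) linarith+
    \<comment> \<open>The \<open>+ 1\<close> in the tolerance keeps it positive and well defined
      when \<open>?c\<close> is 0.\<close>
    then obtain W where W: "finite W" "W \<noteq> {}" "real (card (bdry E W)) \<le> e / (?c + 1) * real (card W)"
      using foelner by blast
    have "?c * (e / (?c + 1)) = e * (?c / (?c + 1))" by simp
    also have "?c / (?c + 1) \<le> 1" using c by (subst divide_le_eq_1_pos) linarith+
    then have "e * (?c / (?c + 1)) \<le> e * 1" using e by (intro mult_left_mono) auto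
    finally have "?c * (e / (?c + 1)) \<le> e" by simp
    have "real s * real (card W) \<le> \<epsilon> * real N * real (card W) + ?c * real (card (bdry E W))"
      using main[OF W(1)] by (simp add: mult.assoc)
    also have "?c * real (card (bdry E W)) \<le> ?c * (e / (?c + 1) * real (card W))"
      using W(3) c by (rule mult_left_mono)
    also have "\<dots> \<le> e * real (card W)"
      using \<open>?c * (e / (?c + 1)) \<le> e\<close> by (simp only: mult.assoc[symmetric]) (intro mult_right_mono, auto)
    finally have "real s * real (card W) \<le> (\<epsilon> * real N + e) * real (card W)" by (simp add: algebra_simps)
    then show "real s \<le> \<epsilon> * real N + e" using W by (simp add: card_gt_0_iff)
  qed
  have le: "real (card {A\<in>\<O>. x \<in> A \<and> y \<notin> A}) \<le> \<epsilon> * real N" if "adj E x y" for x y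
  proof -
    have "card {A\<in>\<O>. x \<in> A \<and> y \<notin> A} = (\<Sum>A\<in>O' x. if y \<notin> A then 1 else 0)"
      using finO[of x] by (simp add: sum.If_cases O'_def Int_def conj_assoc)
    \<comment> \<open>A tile containing \<open>x\<close> but not \<open>y\<close> has the edge from
      \<open>x\<close> to \<open>y\<close> in its boundary.\<close>
    also have "\<dots> \<le> (\<Sum>A\<in>O' x. dg A x)"
    proof (intro sum_mono)
      fix A
      have "card {y} \<le> card {y. y \<notin> A \<and> adj E x y}" if "y \<notin> A" using fdg that \<open>adj E x y\<close> by (intro card_mono) auto
      then show "(if y \<notin> A then 1 else 0) \<le> dg A x" by (auto simp: dg_def)
    qed
    finally show ?thesis using s[of x] s_le by linarith
  qed
  obtain v where v: "v \<in> F" using F(2) by blast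
  obtain \<gamma> where "\<gamma> \<in> \<Gamma>" "\<gamma> v = o'" using \<Gamma>_moves by blast
  then have "\<gamma> ` F \<in> O' o'" using v by (auto simp: O'_def \<O>_def)
  then have "N \<ge> 1" unfolding N_def using finO[of o'] by (metis One_nat_def Suc_leI card_gt_0_iff empty_iff)
  moreover have "f \<ge> 1" unfolding f_def using F by (simp add: Suc_leI card_gt_0_iff)
  moreover have "\<forall>A\<in>\<O>. \<forall>\<gamma>\<in>\<Gamma>. \<gamma> ` A \<in> \<O>" using closed by blast
  moreover have "\<forall>A\<in>\<O>. finite A \<and> card A = f \<and> (\<forall>x\<in>A. A \<subseteq> nball E x f)"
    using fin card sub by blast
  moreover have "\<forall>x. finite {A\<in>\<O>. x \<in> A} \<and> card {A\<in>\<O>. x \<in> A} = N"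
    using finO N unfolding O'_def by blast
  moreover have "\<forall>x y. adj E x y \<longrightarrow> real (card {A\<in>\<O>. x \<in> A \<and> y \<notin> A}) \<le> \<epsilon> * real N"
    using le by blast
  ultimately show ?thesis
    by (intro exI[of _ \<O>] exI[of _ N] exI[of _ f] conjI)
qed

end

section \<open>Independent bits\<close>

definition bern :: "('i \<Rightarrow> real) \<Rightarrow> ('i \<Rightarrow> bool) measure" where
  "bern \<rho> = PiM UNIV (\<lambda>i. measure_pmf (bernoulli_pmf (\<rho> i)))"

text \<open>Dependence on a set of coordinates, stated for events without sub-sigma-algebras. One
  implication is enough because agreement on \<open>K\<close> is symmetric.\<close>

definition dep_on :: "'i set \<Rightarrow> ('i \<Rightarrow> bool) set \<Rightarrow> bool" where
  "dep_on K U \<longleftrightarrow> (\<forall>b b'. (\<forall>k\<in>K. b k = b' k) \<longrightarrow> b \<in> U \<longrightarrow> b' \<in> U)"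

text \<open>The open sets of the product topology. Openness yields measurability by
  \<open>fin_open_sets\<close>, and it is also the form in which finitariness of the coding
  appears.\<close>

definition fin_open :: "('i \<Rightarrow> bool) set \<Rightarrow> bool" where
  "fin_open U \<longleftrightarrow> (\<forall>b\<in>U. \<exists>J. finite J \<and> (\<forall>b'. (\<forall>k\<in>J. b k = b' k) \<longrightarrow> b' \<in> U))"

lemma space_bern[simp]: "space (bern \<rho>) = UNIV"
  by (simp add: bern_def space_PiM PiE_UNIV_domain)

lemma prob_space_bern: "prob_space (bern \<rho>)"
  unfolding bern_def by (intro prob_space_PiM measure_pmf.prob_space_axioms)

lemma dep_onI:
  assumes "\<And>b b'. (\<And>k. k \<in> K \<Longrightarrow> b k = b' k) \<Longrightarrow> b \<in> U \<Longrightarrow> b' \<in> U" shows "dep_on K U"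
  unfolding dep_on_def
proof (intro allI impI)
  fix b b' assume "\<forall>k\<in>K. b k = b' k" "b \<in> U"
  then show "b' \<in> U" by (intro assms[of b b']) auto
qed

lemma dep_onD1: "dep_on K U \<Longrightarrow> (\<And>k. k \<in> K \<Longrightarrow> b k = b' k) \<Longrightarrow> b \<in> U \<Longrightarrow> b' \<in> U"
  unfolding dep_on_def by (elim allE[of _ b] allE[of _ b']) simp

lemma dep_onD: "dep_on K U \<Longrightarrow> (\<And>k. k \<in> K \<Longrightarrow> b k = b' k) \<Longrightarrow> b \<in> U \<longleftrightarrow> b' \<in> U"
  using dep_onD1[of K U b b'] dep_onD1[of K U b' b] by auto

lemma dep_on_mono:
  assumes "dep_on K U" "K \<subseteq> L" shows "dep_on L U"
proof (rule dep_onI)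
  fix b b' assume *: "\<And>k. k \<in> L \<Longrightarrow> b k = b' k" "b \<in> U"
  show "b' \<in> U" by (rule dep_onD1[OF assms(1) _ *(2)]) (use *(1) assms(2) in auto)
qed

lemma dep_on_Compl:
  assumes "dep_on K U" shows "dep_on K (- U)"
proof (rule dep_onI)
  fix b b' assume *: "\<And>k. k \<in> K \<Longrightarrow> b k = b' k" "b \<in> - U"
  have "b \<in> U \<longleftrightarrow> b' \<in> U" by (rule dep_onD[OF assms *(1)])
  with *(2) show "b' \<in> - U" by simp
qed

lemma dep_on_INT:
  assumes "\<And>i. i \<in> I \<Longrightarrow> dep_on (K i) (U i)"
  shows "dep_on (\<Union>i\<in>I. K i) (\<Inter>i\<in>I. U i)"
proof (rule dep_onI, rule INT_I)
  fix b b' i assume *: "\<And>k. k \<in> (\<Union>i\<in>I. K i) \<Longrightarrow> b k = b' k" "b \<in> (\<Inter>i\<in>I. U i)" and i: "i \<in> I"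
  show "b' \<in> U i" by (rule dep_onD1[OF assms[OF i], of b]) (use * i in auto)
qed

lemma dep_on_UN:
  assumes "\<And>i. i \<in> I \<Longrightarrow> dep_on (K i) (U i)"
  shows "dep_on (\<Union>i\<in>I. K i) (\<Union>i\<in>I. U i)"
proof (rule dep_onI)
  fix b b' assume *: "\<And>k. k \<in> (\<Union>i\<in>I. K i) \<Longrightarrow> b k = b' k" "b \<in> (\<Union>i\<in>I. U i)"
  then obtain i where i: "i \<in> I" "b \<in> U i" by blast
  have "b' \<in> U i" by (rule dep_onD1[OF assms[OF i(1)], of b]) (use * i in auto)
  with i show "b' \<in> (\<Union>i\<in>I. U i)" by blast
qed

lemma fin_openI:
  assumes "\<And>b. b \<in> U \<Longrightarrow> \<exists>J. finite J \<and> (\<forall>b'. (\<forall>k\<in>J. b k = b' k) \<longrightarrow> b' \<in> U)"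
  shows "fin_open U"
  unfolding fin_open_def using assms by (rule ballI)

lemma fin_openE:
  assumes "fin_open U" "b \<in> U"
  obtains J where "finite J" "\<And>b'. (\<And>k. k \<in> J \<Longrightarrow> b k = b' k) \<Longrightarrow> b' \<in> U"
proof -
  from assms(1)[unfolded fin_open_def, rule_format, OF assms(2)]
  obtain J where "finite J" and J: "\<forall>b'. (\<forall>k\<in>J. b k = b' k) \<longrightarrow> b' \<in> U" by (elim exE conjE)
  show ?thesis by (rule that[OF \<open>finite J\<close>]) (use J in simp)
qed

lemma sets_bern_coord: "{b. b k = c} \<in> sets (bern \<rho>)"
proof -
  have "(\<lambda>b. b k) -` {c} \<inter> space (bern \<rho>) \<in> sets (bern \<rho>)"
    unfolding bern_def by (rule measurable_sets[OF measurable_component_singleton]) auto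
  then show ?thesis by (simp add: vimage_def)
qed

text \<open>An open set is the union of the cylinders inside it. Over countably many coordinates
  there are only countably many cylinders, each named by its finite support and the set of its
  ones.\<close>

lemma fin_open_sets:
  assumes cnt: "countable (UNIV :: 'i set)" and U: "fin_open (U :: ('i \<Rightarrow> bool) set)"
  shows "U \<in> sets (bern \<rho>)"
proof -
  define cyl where "cyl = (\<lambda>(J :: 'i set, a). {b. \<forall>k\<in>J. b k = (k \<in> a)})"
  define I where "I = {p. finite (fst p) \<and> snd p \<subseteq> fst p \<and> cyl p \<subseteq> U}"
  have "countable {A :: 'i set. finite A \<and> A \<subseteq> UNIV}"
    by (rule countable_Collect_finite_subset[OF cnt])
  then have "countable ({A :: 'i set. finite A} \<times> {A :: 'i set. finite A})"
    by (intro countable_SIGMA) auto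
  moreover have "I \<subseteq> {A. finite A} \<times> {A. finite A}"
    unfolding I_def using finite_subset by fastforce
  ultimately have cI: "countable I" by (rule countable_subset[rotated])
  have "U = (\<Union>p\<in>I. cyl p)"
  proof (intro equalityI subsetI)
    fix b assume "b \<in> U"
    then obtain J where J: "finite J" "\<And>b'. (\<And>k. k \<in> J \<Longrightarrow> b k = b' k) \<Longrightarrow> b' \<in> U"
      using fin_openE[OF U] by metis
    let ?p = "(J, {k\<in>J. b k})"
    have "cyl ?p \<subseteq> U" by (auto simp: cyl_def intro!: J(2))
    then have "?p \<in> I" using J(1) by (auto simp: I_def)
    moreover have "b \<in> cyl ?p" by (auto simp: cyl_def)
    ultimately show "b \<in> (\<Union>p\<in>I. cyl p)" by blast
  qed (auto simp: I_def)
  moreover have "cyl p \<in> sets (bern \<rho>)" if "p \<in> I" for p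
  proof -
    obtain J a where p: "p = (J, a)" by (cases p)
    have "cyl p = {b\<in>space (bern \<rho>). \<forall>k\<in>J. b k = (k \<in> a)}" by (auto simp: cyl_def p)
    also have "\<dots> \<in> sets (bern \<rho>)"
    proof (rule sets.sets_Collect_finite_All)
      show "finite J" using that p by (auto simp: I_def)
      show "{b \<in> space (bern \<rho>). b k = (k \<in> a)} \<in> sets (bern \<rho>)" for k
        using sets_bern_coord[of k "k \<in> a" \<rho>] by simp
    qed
    finally show ?thesis .
  qed
  ultimately show ?thesis using cI by auto
qed

lemma fin_open_dep:
  assumes "finite K" "dep_on K U" shows "fin_open U"
proof (rule fin_openI, intro exI conjI allI impI)
  fix b b' assume "b \<in> U" "\<forall>k\<in>K. b k = b' k"
  then show "b' \<in> U" by (intro dep_onD1[OF assms(2), of b b']) auto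
qed (rule assms(1))

lemma fin_open_Int:
  assumes "fin_open U" "fin_open V" shows "fin_open (U \<inter> V)"
  unfolding fin_open_def
proof
  fix b assume "b \<in> U \<inter> V"
  then have b: "b \<in> U" "b \<in> V" by auto
  obtain J where J: "finite J" "\<And>b'. (\<And>k. k \<in> J \<Longrightarrow> b k = b' k) \<Longrightarrow> b' \<in> U"
    using fin_openE[OF assms(1) b(1)] by metis
  obtain K where K: "finite K" "\<And>b'. (\<And>k. k \<in> K \<Longrightarrow> b k = b' k) \<Longrightarrow> b' \<in> V"
    using fin_openE[OF assms(2) b(2)] by metis
  show "\<exists>J. finite J \<and> (\<forall>b'. (\<forall>k\<in>J. b k = b' k) \<longrightarrow> b' \<in> U \<inter> V)"
    using J K by (intro exI[of _ "J \<union> K"]) simp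
qed

lemma fin_open_INT: "finite I \<Longrightarrow> (\<And>i. i \<in> I \<Longrightarrow> fin_open (U i)) \<Longrightarrow> fin_open (\<Inter>i\<in>I. U i)"
proof (induction I rule: finite_induct)
  case empty show ?case by (rule fin_openI) (simp add: exI[of _ "{}"])
next
  case (insert i I) then show ?case by (auto intro!: fin_open_Int)
qed

lemma indep_vars_bern:
  "prob_space.indep_vars (bern \<rho>) (\<lambda>i. measure_pmf (bernoulli_pmf (\<rho> i))) (\<lambda>i b. b i) (UNIV :: 'i set)"
proof -
  interpret prob_space "bern \<rho>" by (rule prob_space_bern)
  have "(\<lambda>b. b i) \<in> measurable (bern \<rho>) (measure_pmf (bernoulli_pmf (\<rho> i)))" for i
    unfolding bern_def by measurable
  then show ?thesis
  proof (subst indep_vars_iff_distr_eq_PiM')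
    have "distr (bern \<rho>) (measure_pmf (bernoulli_pmf (\<rho> i))) (\<lambda>b. b i) = measure_pmf (bernoulli_pmf (\<rho> i))" for i
      unfolding bern_def by (rule distr_PiM_component) (auto intro: measure_pmf.prob_space_axioms)
    then show "distr (bern \<rho>) (Pi\<^sub>M UNIV (\<lambda>i. measure_pmf (bernoulli_pmf (\<rho> i)))) (\<lambda>x. \<lambda>i\<in>UNIV. x i) =
      Pi\<^sub>M UNIV (\<lambda>i. distr (bern \<rho>) (measure_pmf (bernoulli_pmf (\<rho> i))) (\<lambda>b. b i))"
      by (simp add: restrict_UNIV flip: bern_def)
  qed auto
qed

lemma prob_Int_dep:
  assumes UV: "U \<in> sets (bern \<rho>)" "V \<in> sets (bern \<rho>)" and dep: "dep_on K U" "dep_on L V" and KL: "K \<inter> L = {}"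
  shows "measure (bern \<rho>) (U \<inter> V) = measure (bern \<rho>) U * measure (bern \<rho>) V"
proof -
  interpret prob_space "bern \<rho>" by (rule prob_space_bern)
  let ?M = "\<lambda>i. measure_pmf (bernoulli_pmf (\<rho> i))"
  \<comment> \<open>Partial configurations are extended by \<open>False\<close>. For a set depending
    on \<open>K\<close> only, the filler does not matter, so \<open>?F K U\<close> is
    \<open>U\<close> seen from the coordinates in \<open>K\<close>.\<close>
  let ?F = "\<lambda>K U. (\<lambda>c i. if i \<in> K then c i else False) -` U \<inter> space (PiM K ?M)"
  have F: "?F K U \<in> sets (PiM K ?M)" if "U \<in> sets (bern \<rho>)" for K U
  proof (rule measurable_sets[OF _ that])
    show "(\<lambda>c i. if i \<in> K then c i else False) \<in> measurable (PiM K ?M) (bern \<rho>)"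
      unfolding bern_def
    proof (rule measurable_PiM_single')
      fix i show "(\<lambda>c. if i \<in> K then c i else False) \<in> measurable (PiM K ?M) (?M i)"
        by (cases "i \<in> K") auto
    qed auto
  qed
  have eq: "(\<lambda>b. restrict b K) -` ?F K U \<inter> space (bern \<rho>) = U" if "dep_on K U" for K U
  proof -
    have "(\<lambda>i. if i \<in> K then restrict b K i else False) \<in> U \<longleftrightarrow> b \<in> U" for b
      by (rule dep_onD[OF that]) simp
    then show ?thesis by (simp add: space_PiM vimage_def)
  qed
  have "indep_var (PiM K ?M) (\<lambda>b. restrict b K) (PiM L ?M) (\<lambda>b. restrict b L)"
    using indep_var_restrict[OF indep_vars_bern, of K L] KL by simp
  from indep_varD[OF this F[OF UV(1)] F[OF UV(2)]]
  have "prob ((\<lambda>b. (restrict b K, restrict b L)) -` (?F K U \<times> ?F L V) \<inter> space (bern \<rho>)) = prob U * prob V"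
    by (simp only: eq dep)
  also have "(\<lambda>b. (restrict b K, restrict b L)) -` (?F K U \<times> ?F L V) \<inter> space (bern \<rho>) = U \<inter> V"
    using eq[OF dep(1)] eq[OF dep(2)] by blast
  finally show ?thesis .
qed

lemma prob_INT_dep:
  assumes "finite I" "\<And>i. i \<in> I \<Longrightarrow> U i \<in> sets (bern \<rho>)" "\<And>i. i \<in> I \<Longrightarrow> dep_on (K i) (U i)" "disjoint_family_on K I"
  shows "measure (bern \<rho>) (\<Inter>i\<in>I. U i) = (\<Prod>i\<in>I. measure (bern \<rho>) (U i))"
  using assms
proof (induction I rule: finite_induct)
  case empty
  then show ?case using prob_space.prob_space[OF prob_space_bern, of \<rho>] by simp
next
  case (insert i I)
  have "(\<Inter>i\<in>I. U i) \<in> sets (bern \<rho>)"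
  proof (cases "I = {}")
    case True then show ?thesis using sets.top[of "bern \<rho>"] by simp
  next
    case False then show ?thesis using insert.prems(1) insert.hyps(1) by (intro sets.finite_INT) auto
  qed
  moreover have "dep_on (\<Union>i\<in>I. K i) (\<Inter>i\<in>I. U i)" using insert.prems by (intro dep_on_INT) auto
  moreover have "K i \<inter> (\<Union>i\<in>I. K i) = {}"
    using insert.prems(3) insert.hyps(2) by (auto simp: disjoint_family_on_def)
  ultimately have "measure (bern \<rho>) (U i \<inter> (\<Inter>i\<in>I. U i)) = measure (bern \<rho>) (U i) * measure (bern \<rho>) (\<Inter>i\<in>I. U i)"
    using insert.prems by (intro prob_Int_dep) auto
  moreover have "measure (bern \<rho>) (\<Inter>i\<in>I. U i) = (\<Prod>i\<in>I. measure (bern \<rho>) (U i))"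
    using insert.prems by (intro insert.IH) (auto simp: disjoint_family_on_def)
  ultimately show ?case using insert.hyps by simp
qed

lemma prob_bern_coord:
  assumes "0 \<le> \<rho> k" "\<rho> k \<le> 1"
  shows "measure (bern \<rho>) {b. b k = c} = (if c then \<rho> k else 1 - \<rho> k)"
proof -
  let ?M = "\<lambda>i. measure_pmf (bernoulli_pmf (\<rho> i))"
  have "distr (bern \<rho>) (?M k) (\<lambda>b. b k) = ?M k"
    unfolding bern_def by (rule distr_PiM_component) (auto intro: measure_pmf.prob_space_axioms)
  then have "measure (?M k) {c} = measure (distr (bern \<rho>) (?M k) (\<lambda>b. b k)) {c}" by simp
  also have "\<dots> = measure (bern \<rho>) {b. b k = c}"
    by (subst measure_distr) (auto simp: bern_def space_PiM PiE_UNIV_domain vimage_def)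
  finally show ?thesis using assms by (cases c) (simp_all add: measure_pmf_single)
qed

lemma prob_bern_cyl:
  assumes "finite J" "\<And>k. 0 \<le> \<rho> k \<and> \<rho> k \<le> 1"
  shows "measure (bern \<rho>) {b. \<forall>k\<in>J. b k = a k} = (\<Prod>k\<in>J. if a k then \<rho> k else 1 - \<rho> k)"
proof -
  have "{b. \<forall>k\<in>J. b k = a k} = (\<Inter>k\<in>J. {b. b k = a k})" by auto
  also have "measure (bern \<rho>) \<dots> = (\<Prod>k\<in>J. measure (bern \<rho>) {b. b k = a k})"
    by (rule prob_INT_dep[OF assms(1), of _ _ "\<lambda>k. {k}"])
       (auto simp: sets_bern_coord disjoint_family_on_def intro!: dep_onI)
  finally show ?thesis using assms(2) by (simp add: prob_bern_coord)
qed

section \<open>Random partitions of finite range\<close>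

definition on_set :: "('v \<Rightarrow> nat \<Rightarrow> bool) \<Rightarrow> nat \<Rightarrow> 'v set \<Rightarrow> bool" where
  "on_set c t A \<longleftrightarrow> (\<forall>v\<in>A. c v t)"

text \<open>The label keeps all tiles that fire simultaneously at \<open>x\<close>, together with
  their round. No choice among them is made, so labels are equivariant.\<close>

definition tiles :: "'v set set \<Rightarrow> nat \<Rightarrow> ('v \<Rightarrow> nat \<Rightarrow> bool) \<Rightarrow> 'v \<Rightarrow> (nat \<times> 'v set) set" where
  "tiles \<O> K c x = {(t, A). t < K \<and> A \<in> \<O> \<and> x \<in> A \<and> on_set c t A \<and> (\<forall>s<t. \<forall>B\<in>\<O>. x \<in> B \<longrightarrow> \<not> on_set c s B)}"

text \<open>A vertex hit in none of the \<open>K\<close> rounds is a block of its own; otherwise the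
  unlabelled vertices would form one class of unbounded range.\<close>

definition block :: "'v set set \<Rightarrow> nat \<Rightarrow> ('v \<Rightarrow> nat \<Rightarrow> bool) \<Rightarrow> 'v \<Rightarrow> 'v \<Rightarrow> bool" where
  "block \<O> K c x y \<longleftrightarrow> x = y \<or> (tiles \<O> K c x = tiles \<O> K c y \<and> tiles \<O> K c x \<noteq> {})"

lemma block_refl[simp]: "block \<O> K c x x"
  by (simp add: block_def)

lemma block_sym: "block \<O> K c x y \<Longrightarrow> block \<O> K c y x"
  by (auto simp: block_def)

lemma block_trans: "block \<O> K c x y \<Longrightarrow> block \<O> K c y z \<Longrightarrow> block \<O> K c x z"
  by (auto simp: block_def)

lemma block_nball:
  assumes "\<And>A x. A \<in> \<O> \<Longrightarrow> x \<in> A \<Longrightarrow> A \<subseteq> nball E x f" "block \<O> K c x y"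
  shows "y \<in> nball E x f"
proof (cases "x = y")
  case False
  with assms(2) obtain t A where "(t, A) \<in> tiles \<O> K c x" "(t, A) \<in> tiles \<O> K c y"
    by (auto simp: block_def)
  then have "A \<in> \<O>" "x \<in> A" "y \<in> A" by (auto simp: tiles_def)
  with assms(1) show ?thesis by blast
qed simp

lemma tiles_cong:
  assumes sub: "\<And>A. A \<in> \<O> \<Longrightarrow> x \<in> A \<Longrightarrow> A \<subseteq> nball E x f"
    and c: "\<And>v t. v \<in> nball E x f \<Longrightarrow> t < K \<Longrightarrow> c v t = c' v t"
  shows "tiles \<O> K c x = tiles \<O> K c' x"
proof -
  have *: "on_set c t A = on_set c' t A" if "t < K" "A \<in> \<O>" "x \<in> A" for t A
    unfolding on_set_def using sub[OF that(2,3)] c[OF _ that(1)] by (intro ball_cong refl) auto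
  show ?thesis unfolding tiles_def
    by (intro Collect_cong) (use * less_trans in \<open>auto split: prod.splits\<close>)
qed

lemma block_cong:
  assumes "\<And>A x. A \<in> \<O> \<Longrightarrow> x \<in> A \<Longrightarrow> A \<subseteq> nball E x f"
    and "\<And>v t. v \<in> nball E x f \<union> nball E y f \<Longrightarrow> t < K \<Longrightarrow> c v t = c' v t"
  shows "block \<O> K c x y = block \<O> K c' x y"
proof -
  have "tiles \<O> K c x = tiles \<O> K c' x" "tiles \<O> K c y = tiles \<O> K c' y"
    by (rule tiles_cong[of _ _ E f]; use assms in blast)+
  then show ?thesis by (simp add: block_def)
qed

text \<open>If \<open>x\<close> is hit and no separating tile fires up to the first round that hits
  \<open>x\<close>, then \<open>x\<close> and \<open>y\<close> are hit in the same round by the same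
  tiles. The second alternative joins a condition on the rounds before \<open>t\<close> with one on
  round \<open>t\<close>, which will be independent events.\<close>

lemma not_block_cases:
  assumes "\<not> block \<O> K c x y"
  shows "(\<forall>t<K. \<forall>A\<in>\<O>. x \<in> A \<longrightarrow> \<not> on_set c t A) \<or>
    (\<exists>t<K. (\<forall>s<t. \<forall>A\<in>\<O>. x \<in> A \<longrightarrow> \<not> on_set c s A) \<and> (\<exists>A\<in>\<O>. (x \<in> A) \<noteq> (y \<in> A) \<and> on_set c t A))"
proof (rule ccontr)
  assume *: "\<not> ?thesis"
  define h where "h t \<longleftrightarrow> (\<exists>A\<in>\<O>. x \<in> A \<and> on_set c t A)" for t
  have ex: "\<exists>t. t < K \<and> h t" using * by (auto simp: h_def)
  define t where "t = (LEAST t. t < K \<and> h t)"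
  have t: "t < K" "h t" using LeastI_ex[OF ex] by (auto simp: t_def)
  have min: "\<not> h s" if "s < t" for s
    using not_less_Least[of s "\<lambda>t. t < K \<and> h t"] that t(1) by (auto simp: t_def)
  \<comment> \<open>This negates the second alternative at round \<open>s\<close>: nothing fires at
    \<open>x\<close> before \<open>s\<close>, as \<open>s\<close> is at most the first hitting round
    \<open>t\<close>.\<close>
  have same: "x \<in> A \<longleftrightarrow> y \<in> A" if "s \<le> t" "A \<in> \<O>" "on_set c s A" for s A
  proof -
    have "\<forall>r<s. \<forall>A\<in>\<O>. x \<in> A \<longrightarrow> \<not> on_set c r A" using min that(1) by (auto simp: h_def)
    moreover have "s < K" using that t(1) by simp
    ultimately show ?thesis using * that by blast
  qed
  have minx: "\<forall>s<t. \<forall>B\<in>\<O>. x \<in> B \<longrightarrow> \<not> on_set c s B" using min by (auto simp: h_def)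
  have miny: "\<forall>s<t. \<forall>B\<in>\<O>. y \<in> B \<longrightarrow> \<not> on_set c s B"
    using minx same by (meson less_imp_le)
  obtain A where A: "A \<in> \<O>" "x \<in> A" "on_set c t A" using t(2) by (auto simp: h_def)
  then have "y \<in> A" using same by blast
  have first: "s = t" if "\<forall>r<s. \<forall>B\<in>\<O>. z \<in> B \<longrightarrow> \<not> on_set c r B" "B \<in> \<O>" "z \<in> B" "on_set c s B"
     "\<forall>r<t. \<forall>B\<in>\<O>. z \<in> B \<longrightarrow> \<not> on_set c r B" "z \<in> A" for s z B
    using that A(1,3) by (meson linorder_neqE_nat)
  have sx: "tiles \<O> K c x = {t} \<times> {A\<in>\<O>. x \<in> A \<and> on_set c t A}"
  proof (intro equalityI subsetI)
    fix p assume "p \<in> tiles \<O> K c x"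
    then obtain s B where p: "p = (s, B)" "B \<in> \<O>" "x \<in> B" "on_set c s B" "\<forall>r<s. \<forall>B\<in>\<O>. x \<in> B \<longrightarrow> \<not> on_set c r B"
      by (auto simp: tiles_def)
    with first[of s x B] minx A(2) have "s = t" by blast
    with p show "p \<in> {t} \<times> {A\<in>\<O>. x \<in> A \<and> on_set c t A}" by simp
  qed (use t(1) minx in \<open>auto simp: tiles_def\<close>)
  have sy: "tiles \<O> K c y = {t} \<times> {A\<in>\<O>. y \<in> A \<and> on_set c t A}"
  proof (intro equalityI subsetI)
    fix p assume "p \<in> tiles \<O> K c y"
    then obtain s B where p: "p = (s, B)" "B \<in> \<O>" "y \<in> B" "on_set c s B" "\<forall>r<s. \<forall>B\<in>\<O>. y \<in> B \<longrightarrow> \<not> on_set c r B"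
      by (auto simp: tiles_def)
    with first[of s y B] miny \<open>y \<in> A\<close> have "s = t" by blast
    with p show "p \<in> {t} \<times> {A\<in>\<O>. y \<in> A \<and> on_set c t A}" by simp
  qed (use t(1) miny in \<open>auto simp: tiles_def\<close>)
  have "tiles \<O> K c x = tiles \<O> K c y" unfolding sx sy using same[of t] by auto
  moreover have "tiles \<O> K c x \<noteq> {}" unfolding sx using A by auto
  ultimately show False using assms by (simp add: block_def)
qed

context aut_graph begin

lemma block_aut:
  assumes closed: "\<And>A \<gamma>. A \<in> \<O> \<Longrightarrow> \<gamma> \<in> \<Gamma> \<Longrightarrow> \<gamma> ` A \<in> \<O>" and g: "\<gamma> \<in> \<Gamma>"
  shows "block \<O> K (\<lambda>v. c (\<gamma> v)) x y = block \<O> K c (\<gamma> x) (\<gamma> y)"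
proof -
  have on: "on_set (\<lambda>v. c (\<gamma> v)) t A = on_set c t (\<gamma> ` A)" for t A
    by (simp add: on_set_def)
  have im: "\<gamma> z \<in> \<gamma> ` A \<longleftrightarrow> z \<in> A" for z A by (rule inj_image_mem_iff[OF \<Gamma>_inj[OF g]])
  have surj: "\<exists>A\<in>\<O>. B = \<gamma> ` A" if "B \<in> \<O>" for B
    using closed[OF that \<Gamma>_inv[OF g]] g by (intro bexI[of _ "inv_into UNIV \<gamma> ` B"]) (auto simp: image_image)
  have all: "(\<forall>B\<in>\<O>. P B) \<longleftrightarrow> (\<forall>A\<in>\<O>. P (\<gamma> ` A))" for P
  proof
    assume *: "\<forall>A\<in>\<O>. P (\<gamma> ` A)"
    show "\<forall>B\<in>\<O>. P B"
    proof
      fix B assume "B \<in> \<O>"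
      from surj[OF this] obtain A where "A \<in> \<O>" "B = \<gamma> ` A" by blast
      with * show "P B" by simp
    qed
  qed (use closed g in blast)
  have mem: "(t, A) \<in> tiles \<O> K (\<lambda>v. c (\<gamma> v)) z \<longleftrightarrow> A \<in> \<O> \<and> (t, \<gamma> ` A) \<in> tiles \<O> K c (\<gamma> z)" for t A z
  proof (cases "A \<in> \<O>")
    case True
    have "(\<forall>B\<in>\<O>. \<gamma> z \<in> B \<longrightarrow> \<not> on_set c s B) = (\<forall>B\<in>\<O>. z \<in> B \<longrightarrow> \<not> on_set c s (\<gamma> ` B))" for s
      by (subst all) (simp add: im)
    then show ?thesis using True closed[OF True g] by (simp add: tiles_def on im)
  qed (simp add: tiles_def)
  have sigO: "A \<in> \<O>" if "(t, A) \<in> tiles \<O> K c z" for t A c z using that by (simp add: tiles_def)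
  have sub: "tiles \<O> K (\<lambda>v. c (\<gamma> v)) x \<subseteq> tiles \<O> K (\<lambda>v. c (\<gamma> v)) y \<longleftrightarrow> tiles \<O> K c (\<gamma> x) \<subseteq> tiles \<O> K c (\<gamma> y)" for x y
  proof
    assume *: "tiles \<O> K (\<lambda>v. c (\<gamma> v)) x \<subseteq> tiles \<O> K (\<lambda>v. c (\<gamma> v)) y"
    show "tiles \<O> K c (\<gamma> x) \<subseteq> tiles \<O> K c (\<gamma> y)"
    proof
      fix p assume p: "p \<in> tiles \<O> K c (\<gamma> x)"
      obtain t B where tB: "p = (t, B)" by (cases p)
      with p sigO have "B \<in> \<O>" by blast
      from surj[OF this] obtain A where A: "A \<in> \<O>" "B = \<gamma> ` A" by blast
      then have "(t, A) \<in> tiles \<O> K (\<lambda>v. c (\<gamma> v)) x" using p tB by (simp add: mem)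
      then have "(t, A) \<in> tiles \<O> K (\<lambda>v. c (\<gamma> v)) y" using * by blast
      then show "p \<in> tiles \<O> K c (\<gamma> y)" using A tB by (simp add: mem)
    qed
  next
    assume *: "tiles \<O> K c (\<gamma> x) \<subseteq> tiles \<O> K c (\<gamma> y)"
    show "tiles \<O> K (\<lambda>v. c (\<gamma> v)) x \<subseteq> tiles \<O> K (\<lambda>v. c (\<gamma> v)) y"
      using * by (auto simp: mem)
  qed
  have "tiles \<O> K (\<lambda>v. c (\<gamma> v)) x = {} \<longleftrightarrow> tiles \<O> K c (\<gamma> x) = {}"
  proof
    assume *: "tiles \<O> K (\<lambda>v. c (\<gamma> v)) x = {}"
    show "tiles \<O> K c (\<gamma> x) = {}"
    proof (rule ccontr)
      assume "tiles \<O> K c (\<gamma> x) \<noteq> {}"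
      then obtain t B where tB: "(t, B) \<in> tiles \<O> K c (\<gamma> x)" by auto
      from surj[OF sigO[OF this]] obtain A where "A \<in> \<O>" "B = \<gamma> ` A" by blast
      with tB have "(t, A) \<in> tiles \<O> K (\<lambda>v. c (\<gamma> v)) x" by (simp add: mem)
      with * show False by simp
    qed
  qed (auto simp: mem)
  then show ?thesis
    unfolding block_def set_eq_subset[of "tiles \<O> K _ x" "tiles \<O> K _ y"] set_eq_subset[of "tiles \<O> K _ (\<gamma> x)" "tiles \<O> K _ (\<gamma> y)"]
    using sub[of x y] sub[of y x] inj_eq[OF \<Gamma>_inj[OF g], of x y] by simp
qed

text \<open>In each round a separating tile fires with probability at most
  \<open>2 * \<epsilon> * N * p ^ f\<close>, while some tile at \<open>x\<close> fires with
  probability at least \<open>N * p ^ f / 2\<close>. The ratio of these bounds is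
  \<open>4 * \<epsilon>\<close>, whatever the size of \<open>p ^ f\<close>; the other summand bounds
  the chance that no round hits \<open>x\<close>. The choice of \<open>p\<close> makes the expected
  number of ones on the tiles at \<open>x\<close>, which cover at most \<open>N * f\<close>
  vertices, at most 1/2, so that overlaps of firing tiles cost only a factor 2. The injection
  \<open>e\<close> places the rounds among the bits of a vertex.\<close>

lemma prob_not_block:
  fixes \<rho> :: "'v \<times> nat \<Rightarrow> real"
  assumes N: "\<And>x. finite {A\<in>\<O>. x \<in> A}" "\<And>x. card {A\<in>\<O>. x \<in> A} = N" "N \<ge> 1" "f \<ge> 1"
    and O: "\<And>A. A \<in> \<O> \<Longrightarrow> finite A \<and> card A = f"
    and few_cut: "\<And>x y. adj E x y \<Longrightarrow> real (card {A\<in>\<O>. x \<in> A \<and> y \<notin> A}) \<le> \<epsilon> * real N"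
    and p: "p = 1 / (2 * real (N * f))"
    and \<rho>: "\<And>k. 0 \<le> \<rho> k \<and> \<rho> k \<le> 1" "\<And>v t. \<rho> (v, e t) = p" and e: "inj e" and xy: "adj E x y"
  shows "measure (bern \<rho>) {b. \<not> block \<O> K (\<lambda>v t. b (v, e t)) x y} \<le> (1 - real N * p ^ f / 2) ^ K + 4 * \<epsilon>"
proof -
  interpret prob_space "bern \<rho>" by (rule prob_space_bern)
  have cnt: "countable (UNIV :: ('v \<times> nat) set)"
    using countable_SIGMA[OF vcountable, of "\<lambda>_. UNIV :: nat set"] by simp
  define on where "on t A = {b. on_set (\<lambda>v t. b (v, e t)) t A}" for t and A :: "'v set"
  define L where "L t = (UNIV :: 'v set) \<times> {e t}" for t
  define Ox where "Ox = {A\<in>\<O>. x \<in> A}"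
  define Sep where "Sep = {A\<in>\<O>. x \<in> A \<and> y \<notin> A} \<union> {A\<in>\<O>. y \<in> A \<and> x \<notin> A}"
  define H where "H t = (\<Union>A\<in>Ox. on t A)" for t
  define Bd where "Bd t = (\<Union>A\<in>Sep. on t A)" for t
  have finOx: "finite Ox" using N(1) by (simp add: Ox_def)
  have finSep: "finite Sep" unfolding Sep_def
    using finite_subset[OF _ N(1)[of x], of "{A\<in>\<O>. x \<in> A \<and> y \<notin> A}"] finite_subset[OF _ N(1)[of y], of "{A\<in>\<O>. y \<in> A \<and> x \<notin> A}"]
    by auto
  have on_eq: "on t A = {b. \<forall>k\<in>A \<times> {e t}. b k = True}" for t A by (auto simp: on_def on_set_def)
  have on_dep: "dep_on (A \<times> {e t}) (on t A)" for t A unfolding on_eq by (rule dep_onI) simp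
  have on_sets: "on t A \<in> events" if "A \<in> \<O>" for t A
    using O[OF that] by (intro fin_open_sets[OF cnt] fin_open_dep[OF _ on_dep]) simp
  have prob_on: "prob (on t A) = p ^ f" if "A \<in> \<O>" for t A
  proof -
    have "prob (on t A) = (\<Prod>k\<in>A \<times> {e t}. if True then \<rho> k else 1 - \<rho> k)"
      unfolding on_eq using O[OF that] \<rho>(1) by (intro prob_bern_cyl) auto
    also have "\<dots> = (\<Prod>k\<in>A \<times> {e t}. p)" by (intro prod.cong) (auto simp: \<rho>)
    finally show ?thesis using O[OF that] by (simp add: card_cartesian_product)
  qed
  have OxO: "A \<in> \<O>" if "A \<in> Ox" for A using that by (simp add: Ox_def)
  have SepO: "A \<in> \<O>" if "A \<in> Sep" for A using that by (auto simp: Sep_def)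
  have H_sets: "H t \<in> events" for t unfolding H_def using finOx on_sets OxO by (intro sets.finite_UN) auto
  have Bd_sets: "Bd t \<in> events" for t unfolding Bd_def using finSep on_sets SepO by (intro sets.finite_UN) auto
  have dep_UN: "dep_on (L t) (\<Union>A\<in>X. on t A)" for t X
    by (rule dep_on_mono[OF dep_on_UN[of X "\<lambda>A. A \<times> {e t}"]]) (auto simp: on_dep L_def)
  have depH: "dep_on (L t) (- H t)" for t unfolding H_def by (intro dep_on_Compl dep_UN)
  have depBd: "dep_on (L t) (Bd t)" for t unfolding Bd_def by (rule dep_UN)
  have L_disj: "L s \<inter> L t = {}" if "s \<noteq> t" for s t using that inj_eq[OF e] by (auto simp: L_def)
  let ?q = "p ^ f"
  have Nf: "1 \<le> N * f" using N(3,4) by (simp add: Suc_leI)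
  then have p01: "0 < p" "p \<le> 1" "p * real (N * f) = 1 / 2"
  proof -
    have Nf': "1 \<le> real (N * f)" using Nf by (metis of_nat_1 of_nat_le_iff)
    then show "0 < p" "p \<le> 1" "p * real (N * f) = 1 / 2"
      unfolding p using N(3,4) by (simp_all only: divide_simps mult_1) auto
  qed
  have q0: "0 < ?q" using p01 by simp
  have PBd: "prob (Bd t) \<le> 2 * \<epsilon> * real N * ?q" for t
  proof -
    have "prob (Bd t) \<le> (\<Sum>A\<in>Sep. prob (on t A))"
      unfolding Bd_def using finSep on_sets SepO by (intro finite_measure_subadditive_finite) auto
    also have "\<dots> = real (card Sep) * ?q" using SepO by (simp add: prob_on)
    also have "real (card Sep) \<le> 2 * \<epsilon> * real N"
    proof -
      have "card Sep \<le> card {A\<in>\<O>. x \<in> A \<and> y \<notin> A} + card {A\<in>\<O>. y \<in> A \<and> x \<notin> A}"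
        unfolding Sep_def by (rule card_Un_le)
      then have "real (card Sep) \<le> real (card {A\<in>\<O>. x \<in> A \<and> y \<notin> A}) + real (card {A\<in>\<O>. y \<in> A \<and> x \<notin> A})"
        by linarith
      with few_cut[OF xy] few_cut[of y x] xy show ?thesis by (simp add: adj_sym)
    qed
    finally show ?thesis using q0 by (simp add: mult_right_mono)
  qed
  have PH: "prob (H t) \<ge> real N * ?q / 2" for t
  proof -
    define U where "U = \<Union>Ox"
    have finU: "finite U" unfolding U_def using finOx O OxO by auto
    have cardU: "card U \<le> N * f"
    proof -
      have "card U \<le> (\<Sum>A\<in>Ox. card A)" unfolding U_def using card_Union_le_sum_card by blast
      also have "\<dots> = (\<Sum>A\<in>Ox. f)" using O OxO by (intro sum.cong) auto
      finally show ?thesis using N(2) by (simp add: Ox_def)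
    qed
    \<comment> \<open>On the union \<open>U\<close> of the tiles at \<open>x\<close>, exactly the
      bits of \<open>A\<close> are 1. Unlike the firing events themselves, these are disjoint for
      different tiles, so their probabilities add up.\<close>
    define D where "D A = {b. \<forall>k\<in>U \<times> {e t}. b k = (fst k \<in> A)}" for A
    have D_sets: "D A \<in> events" for A
      using finU by (intro fin_open_sets[OF cnt] fin_open_dep[of "U \<times> {e t}"]) (auto simp: D_def intro!: dep_onI)
    have PD: "prob (D A) \<ge> ?q / 2" if A: "A \<in> Ox" for A
    proof -
      have "prob (D A) = (\<Prod>k\<in>U \<times> {e t}. if fst k \<in> A then \<rho> k else 1 - \<rho> k)"
        unfolding D_def using finU \<rho>(1) by (intro prob_bern_cyl) auto
      also have "\<dots> = (\<Prod>k\<in>(\<lambda>v. (v, e t)) ` U. if fst k \<in> A then \<rho> k else 1 - \<rho> k)"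
        by (intro prod.cong) auto
      also have "\<dots> = (\<Prod>v\<in>U. if v \<in> A then p else 1 - p)"
        by (subst prod.reindex) (auto simp: inj_on_def \<rho> intro!: prod.cong)
      also have "\<dots> = p ^ card (U \<inter> A) * (1 - p) ^ card (U - A)"
        using finU by (simp add: prod.If_cases Diff_eq)
      also have "U \<inter> A = A" using A by (auto simp: U_def)
      finally have eq: "prob (D A) = ?q * (1 - p) ^ card (U - A)" using O[OF OxO[OF A]] by simp
      \<comment> \<open>Since \<open>p * (N * f)\<close> is 1/2, Bernoulli's inequality bounds the
        chance that \<open>U\<close> carries no further 1 outside \<open>A\<close>.\<close>
      have "1 / 2 \<le> 1 + real (N * f) * (- p)" using p01(3) by (simp add: mult.commute)
      also have "\<dots> \<le> (1 + - p) ^ (N * f)" using p01 by (intro Bernoulli_inequality) simp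
      also have "\<dots> \<le> (1 - p) ^ card (U - A)"
      proof -
        have "card (U - A) \<le> N * f" using card_mono[OF finU, of "U - A"] cardU by auto
        then show ?thesis using p01 by (auto intro!: power_decreasing)
      qed
      finally have "?q * (1 / 2) \<le> ?q * (1 - p) ^ card (U - A)" using q0 by (intro mult_left_mono) auto
      then show ?thesis unfolding eq by simp
    qed
    have disj: "disjoint_family_on D Ox"
      unfolding disjoint_family_on_def
    proof (intro ballI impI)
      fix A B assume AB: "A \<in> Ox" "B \<in> Ox" "A \<noteq> B"
      then obtain v where v: "(v \<in> A) \<noteq> (v \<in> B)" by blast
      with AB have "v \<in> U" by (auto simp: U_def)
      with v show "D A \<inter> D B = {}" by (auto simp: D_def)
    qed
    have "real N * ?q / 2 = (\<Sum>A\<in>Ox. ?q / 2)" using N(2) by (simp add: Ox_def)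
    also have "\<dots> \<le> (\<Sum>A\<in>Ox. prob (D A))" by (intro sum_mono PD)
    also have "\<dots> = prob (\<Union>A\<in>Ox. D A)"
      using finOx disj D_sets by (intro finite_measure_finite_Union[symmetric]) auto
    also have "\<dots> \<le> prob (H t)"
    proof (rule finite_measure_mono[OF _ H_sets])
      have "D A \<subseteq> on t A" if "A \<in> Ox" for A using that by (auto simp: D_def on_eq U_def)
      then show "(\<Union>A\<in>Ox. D A) \<subseteq> H t" unfolding H_def by blast
    qed
    finally show ?thesis .
  qed
  define z where "z = 1 - real N * ?q / 2"
  have Pc: "prob (- H t) \<le> z" for t
    using prob_compl[OF H_sets[of t]] PH[of t] by (simp add: z_def Compl_eq_Diff_UNIV)
  have z0: "0 \<le> z" using Pc[of 0] measure_nonneg[of "bern \<rho>" "- H 0"] by linarith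
  have HC_sets: "- H t \<in> events" for t using sets.compl_sets[OF H_sets[of t]] by (simp add: Compl_eq_Diff_UNIV)
  have NH_sets: "(\<Inter>s\<in>{..<t}. - H s) \<in> events" for t
  proof (cases "t = 0")
    case True then show ?thesis using sets.top[of "bern \<rho>"] by simp
  next
    case False then show ?thesis using HC_sets by (intro sets.finite_INT) auto
  qed
  have PNH: "prob (\<Inter>s\<in>{..<t}. - H s) \<le> z ^ t" for t
  proof -
    have "prob (\<Inter>s\<in>{..<t}. - H s) = (\<Prod>s\<in>{..<t}. prob (- H s))"
      using HC_sets depH L_disj by (intro prob_INT_dep[of _ _ _ L]) (auto simp: disjoint_family_on_def)
    also have "\<dots> \<le> (\<Prod>s\<in>{..<t}. z)" using Pc by (intro prod_mono) simp
    finally show ?thesis by simp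
  qed
  have PB: "prob ((\<Inter>s\<in>{..<t}. - H s) \<inter> Bd t) \<le> z ^ t * (2 * \<epsilon> * real N * ?q)" for t
  proof -
    have "(\<Union>s\<in>{..<t}. L s) \<inter> L t = {}"
      unfolding L_def using inj_eq[OF e] by auto
    then have "prob ((\<Inter>s\<in>{..<t}. - H s) \<inter> Bd t) = prob (\<Inter>s\<in>{..<t}. - H s) * prob (Bd t)"
      by (intro prob_Int_dep[OF NH_sets Bd_sets dep_on_INT[of _ L] depBd] depH)
    also have "\<dots> \<le> z ^ t * (2 * \<epsilon> * real N * ?q)" using PNH PBd z0 by (intro mult_mono) auto
    finally show ?thesis .
  qed
  let ?G = "(\<Inter>s\<in>{..<K}. - H s) \<union> (\<Union>t\<in>{..<K}. (\<Inter>s\<in>{..<t}. - H s) \<inter> Bd t)"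
  have "{b. \<not> block \<O> K (\<lambda>v t. b (v, e t)) x y} \<subseteq> ?G"
  proof
    fix b assume "b \<in> {b. \<not> block \<O> K (\<lambda>v t. b (v, e t)) x y}"
    then have "\<not> block \<O> K (\<lambda>v t. b (v, e t)) x y" by simp
    from not_block_cases[OF this] show "b \<in> ?G"
    proof
      assume "\<forall>t<K. \<forall>A\<in>\<O>. x \<in> A \<longrightarrow> \<not> on_set (\<lambda>v t. b (v, e t)) t A"
      then show ?thesis by (simp add: H_def on_def Ox_def)
    next
      assume "\<exists>t<K. (\<forall>s<t. \<forall>A\<in>\<O>. x \<in> A \<longrightarrow> \<not> on_set (\<lambda>v t. b (v, e t)) s A) \<and>
        (\<exists>A\<in>\<O>. (x \<in> A) \<noteq> (y \<in> A) \<and> on_set (\<lambda>v t. b (v, e t)) t A)"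
      then obtain t where t: "t < K" "\<forall>s<t. \<forall>A\<in>\<O>. x \<in> A \<longrightarrow> \<not> on_set (\<lambda>v t. b (v, e t)) s A"
        "\<exists>A\<in>\<O>. (x \<in> A) \<noteq> (y \<in> A) \<and> on_set (\<lambda>v t. b (v, e t)) t A" by blast
      have "b \<in> (\<Inter>s\<in>{..<t}. - H s)" using t(2) by (simp add: H_def on_def Ox_def)
      moreover have "b \<in> Bd t" using t(3) by (auto simp: Bd_def on_def Sep_def)
      ultimately show ?thesis using t(1) by blast
    qed
  qed
  then have "prob {b. \<not> block \<O> K (\<lambda>v t. b (v, e t)) x y} \<le> prob ?G"
    using NH_sets Bd_sets by (intro finite_measure_mono sets.Un sets.finite_UN sets.Int) auto
  also have "\<dots> \<le> prob (\<Inter>s\<in>{..<K}. - H s) + prob (\<Union>t\<in>{..<K}. (\<Inter>s\<in>{..<t}. - H s) \<inter> Bd t)"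
    using NH_sets Bd_sets by (intro measure_Un_le sets.finite_UN sets.Int) auto
  also have "prob (\<Union>t\<in>{..<K}. (\<Inter>s\<in>{..<t}. - H s) \<inter> Bd t) \<le> (\<Sum>t\<in>{..<K}. prob ((\<Inter>s\<in>{..<t}. - H s) \<inter> Bd t))"
    using NH_sets Bd_sets by (intro finite_measure_subadditive_finite) auto
  also have "\<dots> \<le> (\<Sum>t\<in>{..<K}. z ^ t * (2 * \<epsilon> * real N * ?q))" by (intro sum_mono PB)
  \<comment> \<open>The factor \<open>2 * \<epsilon> * N * p ^ f\<close> equals
    \<open>4 * \<epsilon> * (1 - z)\<close>, so the geometric series collapses and \<open>p\<close>
    drops out.\<close>
  also have "\<dots> = 4 * \<epsilon> * ((1 - z) * (\<Sum>t<K. z ^ t))"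
    by (simp add: sum_distrib_left sum_distrib_right z_def mult_ac)
  also have "(1 - z) * (\<Sum>t<K. z ^ t) = 1 - z ^ K" by (simp add: one_diff_power_eq)
  also have "4 * \<epsilon> * (1 - z ^ K) \<le> 4 * \<epsilon> * 1"
  proof (rule mult_left_mono)
    have "0 \<le> \<epsilon> * real N" using few_cut[OF xy] by (rule order_trans[rotated]) simp
    then show "0 \<le> 4 * \<epsilon>" using N(3) by (simp add: zero_le_mult_iff)
  qed (use z0 in simp)
  also have "prob (\<Inter>s\<in>{..<K}. - H s) \<le> z ^ K" by (rule PNH)
  finally show ?thesis by (simp add: z_def)
qed

text \<open>The scheme is fixed before any bits are laid out: the bound holds for every product
  measure whose coordinates \<open>e t\<close> have bias \<open>p\<close>. All stages of the
  hierarchy can therefore share one field of bits.\<close>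

lemma partition_scheme:
  assumes "\<delta> > 0"
  shows "\<exists>\<O> K f p. 0 \<le> p \<and> p \<le> 1 \<and> (\<forall>A\<in>\<O>. \<forall>\<gamma>\<in>\<Gamma>. \<gamma> ` A \<in> \<O>) \<and>
    (\<forall>A\<in>\<O>. \<forall>x\<in>A. A \<subseteq> nball E x f) \<and>
    (\<forall>(\<rho> :: 'v \<times> nat \<Rightarrow> real) e x y. (\<forall>k. 0 \<le> \<rho> k \<and> \<rho> k \<le> 1) \<longrightarrow> inj e \<longrightarrow> (\<forall>v t. \<rho> (v, e t) = p) \<longrightarrow> adj E x y \<longrightarrow>
      measure (bern \<rho>) {b. \<not> block \<O> K (\<lambda>v t. b (v, e t)) x y} \<le> \<delta>)"
proof -
  \<comment> \<open>Separation costs \<open>4 * (\<delta> / 8)\<close>, half of \<delta>; the other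
    half is left for the failure to be hit within \<open>K\<close> rounds.\<close>
  have "\<delta> / 8 > 0" using assms by simp
  from tiling[OF this] obtain \<O> N f where O: "N \<ge> 1" "f \<ge> 1" "\<forall>A\<in>\<O>. \<forall>\<gamma>\<in>\<Gamma>. \<gamma> ` A \<in> \<O>"
    "\<forall>A\<in>\<O>. finite A \<and> card A = f \<and> (\<forall>x\<in>A. A \<subseteq> nball E x f)"
    "\<forall>x. finite {A\<in>\<O>. x \<in> A} \<and> card {A\<in>\<O>. x \<in> A} = N"
    "\<forall>x y. adj E x y \<longrightarrow> real (card {A\<in>\<O>. x \<in> A \<and> y \<notin> A}) \<le> \<delta> / 8 * real N"
    by (elim exE conjE)
  define p where "p = 1 / (2 * real (N * f))"
  have "1 \<le> N * f" using O(1,2) by (simp add: Suc_leI)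
  then have Nf': "1 \<le> real (N * f)" by (metis of_nat_1 of_nat_le_iff)
  then have p01: "0 < p" "p \<le> 1" unfolding p_def by (simp_all only: divide_simps mult_1) auto
  define z where "z = 1 - real N * p ^ f / 2"
  have "real N * p ^ f > 0" using O(1) p01 by simp
  then have "z < 1" by (simp add: z_def)
  then obtain K where K: "z ^ K < \<delta> / 2" using real_arch_pow_inv[of "\<delta> / 2" z] assms by auto
  have *: "measure (bern \<rho>) {b. \<not> block \<O> K (\<lambda>v t. b (v, e t)) x y} \<le> \<delta>"
    if "\<forall>k. 0 \<le> \<rho> k \<and> \<rho> k \<le> 1" "inj e" "\<forall>v t. \<rho> (v, e t) = p" "adj E x y" for \<rho> :: "'v \<times> nat \<Rightarrow> real" and e x y
  proof -
    have "measure (bern \<rho>) {b. \<not> block \<O> K (\<lambda>v t. b (v, e t)) x y} \<le> (1 - real N * p ^ f / 2) ^ K + 4 * (\<delta> / 8)"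
      by (rule prob_not_block) (use O that p_def in auto)
    also have "\<dots> \<le> \<delta>" using K by (simp add: z_def)
    finally show ?thesis .
  qed
  have "\<forall>A\<in>\<O>. \<forall>x\<in>A. A \<subseteq> nball E x f" using O(4) by blast
  then show ?thesis using p01 O(3) *
    by (intro exI[of _ \<O>] exI[of _ K] exI[of _ f] exI[of _ p] conjI allI impI) auto
qed

end

section \<open>Nested cells and the exploration order\<close>

text \<open>Relates \<open>x\<close> and \<open>y\<close> when their \<open>Q\<close>-classes meet the same \<open>P\<close>-classes; this coarsens \<open>Q\<close> without
  choosing representatives, so it stays equivariant.\<close>

definition hlift :: "('v \<Rightarrow> 'v \<Rightarrow> bool) \<Rightarrow> ('v \<Rightarrow> 'v \<Rightarrow> bool) \<Rightarrow> 'v \<Rightarrow> 'v \<Rightarrow> bool" where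
  "hlift Q P x y \<longleftrightarrow> (\<forall>z. Q x z \<longrightarrow> (\<exists>w. Q y w \<and> P z w)) \<and> (\<forall>w. Q y w \<longrightarrow> (\<exists>z. Q x z \<and> P z w))"

text \<open>Blocks of different stages are unrelated. Lifting them to unions of earlier cells forces
  nesting, at the price of adding the earlier range to the new one.\<close>

primrec cell :: "(nat \<Rightarrow> 'v set set) \<Rightarrow> (nat \<Rightarrow> nat) \<Rightarrow> (nat \<Rightarrow> 'v \<Rightarrow> nat \<Rightarrow> bool) \<Rightarrow> nat \<Rightarrow> 'v \<Rightarrow> 'v \<Rightarrow> bool" where
  "cell \<O> K c 0 = (=)"
| "cell \<O> K c (Suc n) = hlift (cell \<O> K c n) (block (\<O> n) (K n) (c n))"

lemma hlift_refl: "(\<And>x. P x x) \<Longrightarrow> hlift Q P x x"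
  by (auto simp: hlift_def)

lemma hlift_sym: "(\<And>x y. P x y \<Longrightarrow> P y x) \<Longrightarrow> hlift Q P x y \<Longrightarrow> hlift Q P y x"
  unfolding hlift_def by metis

lemma hlift_trans: "(\<And>x y z. P x y \<Longrightarrow> P y z \<Longrightarrow> P x z) \<Longrightarrow> hlift Q P x y \<Longrightarrow> hlift Q P y z \<Longrightarrow> hlift Q P x z"
  unfolding hlift_def by metis

lemma hlift_mono:
  assumes "\<And>x. P x x" "\<And>x y. Q x y \<Longrightarrow> Q y x" "\<And>x y z. Q x y \<Longrightarrow> Q y z \<Longrightarrow> Q x z" "Q x y"
  shows "hlift Q P x y"
  unfolding hlift_def
proof (intro conjI allI impI)
  fix z assume "Q x z"
  then have "Q y z" by (rule assms(3)[OF assms(2)[OF assms(4)]])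
  then show "\<exists>w. Q y w \<and> P z w" using assms(1) by blast
next
  fix w assume "Q y w"
  then have "Q x w" by (rule assms(3)[OF assms(4)])
  then show "\<exists>z. Q x z \<and> P z w" using assms(1) by blast
qed

lemma cell_refl[simp]: "cell \<O> K c n x x"
  by (induction n) (auto intro: hlift_refl)

lemma cell_sym: "cell \<O> K c n x y \<Longrightarrow> cell \<O> K c n y x"
  by (cases n) (auto intro: hlift_sym block_sym)

lemma cell_trans: "cell \<O> K c n x y \<Longrightarrow> cell \<O> K c n y z \<Longrightarrow> cell \<O> K c n x z"
proof (cases n)
  case (Suc m)
  assume "cell \<O> K c n x y" "cell \<O> K c n y z"
  then show ?thesis unfolding Suc cell.simps by (blast intro: hlift_trans block_trans)
qed simp

lemma cell_Suc: "cell \<O> K c n x y \<Longrightarrow> cell \<O> K c (Suc n) x y"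
  unfolding cell.simps by (rule hlift_mono) (auto intro: cell_sym cell_trans)

lemma cell_mono: "cell \<O> K c n x y \<Longrightarrow> n \<le> m \<Longrightarrow> cell \<O> K c m x y"
proof (induction m)
  case (Suc m) then show ?case by (cases "n = Suc m") (auto intro: cell_Suc simp del: cell.simps)
qed simp

primrec radius :: "(nat \<Rightarrow> nat) \<Rightarrow> nat \<Rightarrow> nat" where
  "radius f 0 = 0"
| "radius f (Suc n) = f n + radius f n"

text \<open>How far the bits deciding the cell relation at \<open>x\<close> may lie: a relevant
  \<open>y\<close> is within \<open>radius f (Suc n)\<close>, its previous cell reaches
  \<open>radius f n\<close> further, and the data of stage \<open>n\<close> there are read within
  \<open>scope f n + f n\<close>.\<close>

primrec scope :: "(nat \<Rightarrow> nat) \<Rightarrow> nat \<Rightarrow> nat" where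
  "scope f 0 = 0"
| "scope f (Suc n) = radius f (Suc n) + (radius f n + (scope f n + f n))"

lemma scope_mono: "m \<le> n \<Longrightarrow> scope f m \<le> scope f n"
  by (rule lift_Suc_mono_le) auto

lemma cell_nball:
  assumes sub: "\<And>n A x. A \<in> \<O> n \<Longrightarrow> x \<in> A \<Longrightarrow> A \<subseteq> nball E x (f n)"
  shows "cell \<O> K c n x y \<Longrightarrow> y \<in> nball E x (radius f n)"
proof (induction n arbitrary: x y)
  case (Suc n)
  from Suc.prems have "\<exists>w. cell \<O> K c n y w \<and> block (\<O> n) (K n) (c n) x w"
    by (simp add: hlift_def)
  then obtain w where w: "cell \<O> K c n y w" "block (\<O> n) (K n) (c n) x w" by blast
  have "w \<in> nball E x (f n)" by (rule block_nball[OF sub w(2)])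
  moreover have "y \<in> nball E w (radius f n)" by (rule Suc.IH[OF cell_sym[OF w(1)]])
  ultimately show ?case by (auto intro: nball_trans)
qed simp

lemma cell_cong:
  assumes sub: "\<And>n A x. A \<in> \<O> n \<Longrightarrow> x \<in> A \<Longrightarrow> A \<subseteq> nball E x (f n)"
  shows "(\<And>m v t. m < n \<Longrightarrow> v \<in> nball E x (scope f n) \<Longrightarrow> t < K m \<Longrightarrow> c m v t = c' m v t) \<Longrightarrow>
    cell \<O> K c n x y = cell \<O> K c' n x y"
proof (induction n arbitrary: x y)
  case (Suc n)
  show ?case
  \<comment> \<open>Outside this ball both sides are false whatever the bits are; inside it, the
    window about \<open>x\<close> also covers the previous cell of \<open>y\<close>.\<close>
  proof (cases "y \<in> nball E x (radius f (Suc n))")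
    case False
    then show ?thesis using cell_nball[of \<O> E f K _ "Suc n" x y, OF sub] by blast
  next
    case True
    have c: "c m v t = c' m v t" if "m < Suc n" "u \<in> nball E x (radius f (Suc n))" "z \<in> nball E u (radius f n)"
      "v \<in> nball E z (scope f n + f n)" "t < K m" for m u z v t
    proof (rule Suc.prems[OF that(1) _ that(5)])
      have "v \<in> nball E u (radius f n + (scope f n + f n))" by (rule nball_trans[OF that(3,4)])
      from nball_trans[OF that(2) this] show "v \<in> nball E x (scope f (Suc n))" by simp
    qed
    have Q: "cell \<O> K c n u z = cell \<O> K c' n u z" if "u \<in> nball E x (radius f (Suc n))" for u z
    proof (rule Suc.IH)
      fix m v t assume *: "m < n" "v \<in> nball E u (scope f n)" "t < K m"
      then have "v \<in> nball E u (scope f n + f n)" using nball_mono[of "scope f n" "scope f n + f n" E u] by auto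
      then show "c m v t = c' m v t" by (intro c[of m u u v t]) (use * that in auto)
    qed
    have P: "block (\<O> n) (K n) (c n) z w = block (\<O> n) (K n) (c' n) z w"
      if "cell \<O> K c' n x z" "cell \<O> K c' n y w" for z w
    proof (rule block_cong[of _ E "f n", OF sub])
      fix v t assume v: "v \<in> nball E z (f n) \<union> nball E w (f n)" and t: "t < K n"
      have z: "z \<in> nball E x (radius f n)" by (rule cell_nball[OF sub that(1)])
      have w: "w \<in> nball E y (radius f n)" by (rule cell_nball[OF sub that(2)])
      have mono: "nball E u (f n) \<subseteq> nball E u (scope f n + f n)" for u by (rule nball_mono) simp
      from v show "c n v t = c' n v t"
      proof
        assume "v \<in> nball E z (f n)" with mono show ?thesis by (intro c[OF _ _ z _ t]) auto
      next
        assume "v \<in> nball E w (f n)" with mono show ?thesis by (intro c[OF _ True w _ t]) auto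
      qed
    qed
    have x: "x \<in> nball E x (radius f (Suc n))" by simp
    have "cell \<O> K c (Suc n) x y = hlift (cell \<O> K c' n) (block (\<O> n) (K n) (c n)) x y"
      unfolding cell.simps hlift_def by (simp only: Q[OF x] Q[OF True])
    also have "\<dots> = cell \<O> K c' (Suc n) x y"
    proof -
      have 1: "(\<exists>w. cell \<O> K c' n y w \<and> block (\<O> n) (K n) (c n) z w) = (\<exists>w. cell \<O> K c' n y w \<and> block (\<O> n) (K n) (c' n) z w)"
        if "cell \<O> K c' n x z" for z using P[OF that] by metis
      have 2: "(\<exists>z. cell \<O> K c' n x z \<and> block (\<O> n) (K n) (c n) z w) = (\<exists>z. cell \<O> K c' n x z \<and> block (\<O> n) (K n) (c' n) z w)"
        if "cell \<O> K c' n y w" for w using P[OF _ that] by metis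
      show ?thesis unfolding cell.simps hlift_def
        by (intro conj_cong all_cong1 imp_cong refl) (rule 1, assumption, rule 2, assumption)
    qed
    finally show ?thesis .
  qed
qed simp

text \<open>If no edge inside the ball is cut by the blocks of stage \<open>n\<close>, the whole
  ball lies in one block. It contains the previous cells of both \<open>x\<close> and
  \<open>y\<close>, which are therefore merged. The \<open>+ 1\<close> in the radius is the step
  from \<open>x\<close> to \<open>y\<close>.\<close>

lemma cell_separated:
  assumes sub: "\<And>n A x. A \<in> \<O> n \<Longrightarrow> x \<in> A \<Longrightarrow> A \<subseteq> nball E x (f n)"
    and xy: "adj E x y" and sep: "\<not> cell \<O> K c (Suc n) x y"
  shows "\<exists>u\<in>nball E x (radius f n + 1). \<exists>v\<in>nball E x (radius f n + 1). adj E u v \<and> \<not> block (\<O> n) (K n) (c n) u v"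
proof (rule ccontr)
  assume *: "\<not> ?thesis"
  let ?P = "block (\<O> n) (K n) (c n)"
  have P: "u \<in> nball E x r \<Longrightarrow> r \<le> radius f n + 1 \<Longrightarrow> ?P x u" for r u
  proof (induction r arbitrary: u)
    case (Suc r)
    from Suc.prems(1) consider "u \<in> nball E x r" | w where "w \<in> nball E x r" "adj E u w" by (auto simp: nball_Suc)
    then show ?case
    proof cases
      case 1 then show ?thesis using Suc by simp
    next
      case 2
      have "w \<in> nball E x (radius f n + 1)" using 2(1) nball_mono[of r "radius f n + 1" E x] Suc.prems(2) by auto
      moreover have "u \<in> nball E x (radius f n + 1)"
        using Suc.prems nball_mono[of "Suc r" "radius f n + 1" E x] by auto
      ultimately have "?P u w" using * 2(2) by blast
      moreover have "?P x w" using Suc.IH[OF 2(1)] Suc.prems(2) by simp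
      ultimately show ?thesis by (meson block_sym block_trans)
    qed
  qed simp
  have "?P z w" if "cell \<O> K c n x z" "cell \<O> K c n y w" for z w
  proof -
    have "z \<in> nball E x (radius f n)" by (rule cell_nball[OF sub that(1)])
    moreover have "w \<in> nball E y (radius f n)" by (rule cell_nball[OF sub that(2)])
    moreover have "y \<in> nball E x 1" using xy nball_adj[of x E x 0 y] by (simp add: adj_sym)
    ultimately have "z \<in> nball E x (radius f n + 1)" "w \<in> nball E x (radius f n + 1)"
      using nball_mono[of "radius f n" "radius f n + 1" E x] nball_trans[of y E x 1 w "radius f n"] by (auto simp: add.commute)
    then show ?thesis using P[of z "radius f n + 1"] P[of w "radius f n + 1"] by (meson order_refl block_sym block_trans)
  qed
  then have "cell \<O> K c (Suc n) x y" unfolding cell.simps hlift_def by (metis cell_refl)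
  with sep show False by contradiction
qed

section \<open>Levels, predecessors and their locality\<close>

definition full :: "'v set set \<Rightarrow> (nat \<Rightarrow> 'v set set) \<Rightarrow> (nat \<Rightarrow> nat) \<Rightarrow> nat \<Rightarrow> (nat \<Rightarrow> 'v \<Rightarrow> nat \<Rightarrow> bool) \<Rightarrow> nat \<Rightarrow> 'v \<Rightarrow> bool" where
  "full E \<O> K k c n v \<longleftrightarrow> (\<forall>u\<in>nball E v k. cell \<O> K c n v u)"

definition level :: "'v set set \<Rightarrow> (nat \<Rightarrow> 'v set set) \<Rightarrow> (nat \<Rightarrow> nat) \<Rightarrow> nat \<Rightarrow> (nat \<Rightarrow> 'v \<Rightarrow> nat \<Rightarrow> bool) \<Rightarrow> 'v \<Rightarrow> nat" where
  "level E \<O> K k c v = (LEAST n. full E \<O> K k c n v)"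

text \<open>The strict lexicographic order of bit sequences: whenever it holds, finitely many bits
  certify it.\<close>

definition label_less :: "('v \<Rightarrow> nat \<Rightarrow> bool) \<Rightarrow> 'v \<Rightarrow> 'v \<Rightarrow> bool" where
  "label_less l u v \<longleftrightarrow> (\<exists>j. \<not> l u j \<and> l v j \<and> (\<forall>i<j. l u i = l v i))"

text \<open>Asking \<open>u\<close> to be \<open>full\<close> at the level of \<open>v\<close> keeps
  out vertices without a full stage, whose \<open>level\<close> is an unspecified
  \<open>LEAST\<close>. For the others it bounds the level by that of \<open>v\<close>, so that
  membership is decided within a finite window.\<close>

definition preds where
  "preds E \<O> K k c l v = {u. cell \<O> K c (level E \<O> K k c v) v u \<and> full E \<O> K k c (level E \<O> K k c v) u \<and>
     (level E \<O> K k c u < level E \<O> K k c v \<or> level E \<O> K k c u = level E \<O> K k c v \<and> label_less l u v)}"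

text \<open>Labels are compared only inside the cell at the level of \<open>v\<close>. Asking for
  distinct labels at all pairs of vertices would not be a local condition.\<close>

definition resolved where
  "resolved E \<O> K k c l v \<longleftrightarrow> (\<exists>n. full E \<O> K k c n v) \<and>
     (\<forall>u w. cell \<O> K c (level E \<O> K k c v) v u \<and> cell \<O> K c (level E \<O> K k c v) v w \<and> u \<noteq> w \<longrightarrow> label_less l u w \<or> label_less l w u)"

lemma label_less_irrefl: "\<not> label_less l u u"
  by (simp add: label_less_def)

lemma label_less_trans:
  assumes "label_less l u v" "label_less l v w" shows "label_less l u w"
proof -
  from assms obtain i j where i: "\<not> l u i" "l v i" "\<forall>m<i. l u m = l v m" and j: "\<not> l v j" "l w j" "\<forall>m<j. l v m = l w m"
    by (auto simp: label_less_def)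
  from i j have "i \<noteq> j" by auto
  then consider "i < j" | "j < i" by linarith
  then show ?thesis
  proof cases
    case 1 then show ?thesis unfolding label_less_def by (intro exI[of _ i]) (use i j in auto)
  next
    case 2 then show ?thesis unfolding label_less_def by (intro exI[of _ j]) (use i j in auto)
  qed
qed

lemma full_mono: "full E \<O> K k c n v \<Longrightarrow> n \<le> m \<Longrightarrow> full E \<O> K k c m v"
  by (simp add: full_def cell_mono[of _ _ _ n _ _ m])

lemma level_full: "full E \<O> K k c n v \<Longrightarrow> full E \<O> K k c (level E \<O> K k c v) v"
  unfolding level_def by (rule LeastI)

lemma level_le: "full E \<O> K k c n v \<Longrightarrow> level E \<O> K k c v \<le> n"
  unfolding level_def by (rule Least_le)

lemma preds_irrefl: "v \<notin> preds E \<O> K k c l v"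
  by (simp add: preds_def label_less_irrefl)

text \<open>Cells are nested and the level of \<open>u\<close> is at most that of \<open>v\<close>,
  so the cell in which \<open>w\<close> was found is contained in the cell of
  \<open>v\<close>.\<close>

lemma preds_trans:
  assumes "u \<in> preds E \<O> K k c l v" "w \<in> preds E \<O> K k c l u" shows "w \<in> preds E \<O> K k c l v"
proof -
  let ?lev = "level E \<O> K k c"
  have le: "?lev u \<le> ?lev v" using assms(1) by (auto simp: preds_def)
  have "cell \<O> K c (?lev v) u w" using assms(2) le cell_mono by (auto simp: preds_def)
  moreover have "cell \<O> K c (?lev v) v u" using assms(1) by (simp add: preds_def)
  ultimately have "cell \<O> K c (?lev v) v w" by (meson cell_trans)
  moreover have "full E \<O> K k c (?lev v) w" using assms(2) le full_mono by (auto simp: preds_def)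
  ultimately show ?thesis using assms label_less_trans[of l w u v] by (auto simp: preds_def)
qed

lemma preds_comparable:
  assumes "resolved E \<O> K k c l u" "resolved E \<O> K k c l v" "u \<noteq> v" "level E \<O> K k c u \<le> level E \<O> K k c v"
    "cell \<O> K c (level E \<O> K k c v) v u"
  shows "u \<in> preds E \<O> K k c l v \<or> v \<in> preds E \<O> K k c l u"
proof -
  let ?lev = "level E \<O> K k c"
  have fu: "full E \<O> K k c (?lev u) u" and fv: "full E \<O> K k c (?lev v) v"
    using assms(1,2) level_full by (auto simp: resolved_def)
  have "full E \<O> K k c (?lev v) u" by (rule full_mono[OF fu assms(4)])
  moreover have "label_less l u v \<or> label_less l v u"
    using assms(2)[unfolded resolved_def, THEN conjunct2, rule_format, of u v] assms(3,5) by simp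
  ultimately show ?thesis
    using assms(4,5) fv cell_sym[OF assms(5)] by (auto simp: preds_def)
qed

text \<open>At its own level a vertex has its ball of radius \<open>k\<close> in its cell, so of two
  near vertices the one of higher level sees the other.\<close>

lemma preds_comparable_near:
  assumes "resolved E \<O> K k c l u" "resolved E \<O> K k c l v" "u \<noteq> v" "u \<in> nball E v k"
  shows "u \<in> preds E \<O> K k c l v \<or> v \<in> preds E \<O> K k c l u"
proof -
  let ?lev = "level E \<O> K k c"
  have fu: "full E \<O> K k c (?lev u) u" and fv: "full E \<O> K k c (?lev v) v"
    using assms(1,2) level_full by (auto simp: resolved_def)
  then have "cell \<O> K c (?lev v) v u" "cell \<O> K c (?lev u) u v"
    using assms(4) nball_sym[of u E v k] by (auto simp: full_def)
  then show ?thesis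
    using preds_comparable[of E \<O> K k c l u v] preds_comparable[of E \<O> K k c l v u] assms
    by (metis nat_le_linear)
qed

text \<open>Cells of one stage are equal or disjoint. At the larger of the two levels both vertices
  share a cell with \<open>p\<close>, hence with each other.\<close>

lemma preds_comparable_common:
  assumes "resolved E \<O> K k c l u" "resolved E \<O> K k c l v" "u \<noteq> v" "p \<in> preds E \<O> K k c l u" "p \<in> preds E \<O> K k c l v"
  shows "u \<in> preds E \<O> K k c l v \<or> v \<in> preds E \<O> K k c l u"
proof -
  let ?lev = "level E \<O> K k c"
  have *: "cell \<O> K c (?lev w) w z" if "?lev z \<le> ?lev w" "p \<in> preds E \<O> K k c l z" "p \<in> preds E \<O> K k c l w" for z w
  proof -
    have "cell \<O> K c (?lev w) w p" using that(3) by (simp add: preds_def)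
    moreover have "cell \<O> K c (?lev w) z p" using that(1,2) cell_mono by (auto simp: preds_def)
    ultimately show ?thesis by (meson cell_sym cell_trans)
  qed
  show ?thesis
    using *[of u v] *[of v u] preds_comparable[of E \<O> K k c l u v] preds_comparable[of E \<O> K k c l v u] assms
    by (metis nat_le_linear)
qed

lemma finite_bounded_witnesses:
  assumes "finite P" "\<And>p. p \<in> P \<Longrightarrow> \<exists>j::nat. \<phi> p j"
  shows "\<exists>J. \<forall>p\<in>P. \<exists>j<J. \<phi> p j"
  using assms
proof (induction P rule: finite_induct)
  case (insert p P)
  then obtain J where J: "\<forall>p\<in>P. \<exists>j<J. \<phi> p j" by auto
  obtain j where j: "\<phi> p j" using insert.prems by blast
  show ?case
  proof (rule exI[of _ "J + Suc j"], rule ballI)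
    fix q assume "q \<in> insert p P"
    then consider "q = p" | "q \<in> P" by blast
    then show "\<exists>i<J + Suc j. \<phi> q i"
    proof cases
      case 1 with j show ?thesis by (intro exI[of _ j]) simp
    next
      case 2
      then obtain i where "i < J" "\<phi> q i" using J by blast
      then show ?thesis by (intro exI[of _ i]) simp
    qed
  qed
qed simp

text \<open>Being unresolved may take infinitely many bits to see, but being resolved is an open
  condition. The window has to fix the level of \<open>v\<close>, its finite cell, fullness and
  levels of the members, and the label comparisons among them.\<close>

lemma resolved_local:
  assumes sub: "\<And>n A x. A \<in> \<O> n \<Longrightarrow> x \<in> A \<Longrightarrow> A \<subseteq> nball E x (f n)"
    and fin: "\<And>x r. finite (nball E x r)" and dom: "resolved E \<O> K k c l v"
  shows "\<exists>r. \<forall>c' l'. (\<forall>u\<in>nball E v r. (\<forall>m<r. \<forall>t<r. c m u t = c' m u t) \<and> (\<forall>j<r. l u j = l' u j)) \<longrightarrow>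
    resolved E \<O> K k c' l' v \<and> preds E \<O> K k c' l' v = preds E \<O> K k c l v"
proof -
  define n0 where "n0 = level E \<O> K k c v"
  define D where "D = radius f n0 + k"
  define cls where "cls = {u. cell \<O> K c n0 v u}"
  have cls_sub: "cls \<subseteq> nball E v (radius f n0)" using cell_nball[OF sub] by (auto simp: cls_def)
  then have fin_cls: "finite cls" using fin finite_subset by blast
  have clsD: "u \<in> nball E v D" if "u \<in> cls" for u
    using cls_sub that nball_mono[of "radius f n0" D E v] by (auto simp: D_def)
  \<comment> \<open>Only comparisons that hold have finite certificates. Those that fail follow by
    totality on the cell, since the reversed comparison holds.\<close>
  define LP where "LP = {p\<in>cls \<times> cls. label_less l (fst p) (snd p)}"
  have "finite LP" unfolding LP_def using fin_cls by simp
  then have "\<exists>J. \<forall>p\<in>LP. \<exists>j<J. \<not> l (fst p) j \<and> l (snd p) j \<and> (\<forall>i<j. l (fst p) i = l (snd p) i)"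
    by (rule finite_bounded_witnesses) (simp add: LP_def label_less_def)
  then obtain J where J: "\<And>p. p \<in> LP \<Longrightarrow> \<exists>j<J. \<not> l (fst p) j \<and> l (snd p) j \<and> (\<forall>i<j. l (fst p) i = l (snd p) i)"
    by blast
  define T where "T = (\<Sum>m<n0. K m)"
  have T: "K m \<le> T" if "m < n0" for m unfolding T_def using that by (intro member_le_sum) auto
  define r where "r = D + scope f n0 + n0 + T + J"
  have main: "resolved E \<O> K k c' l' v \<and> preds E \<O> K k c' l' v = preds E \<O> K k c l v"
    if agree: "\<forall>u\<in>nball E v r. (\<forall>m<r. \<forall>t<r. c m u t = c' m u t) \<and> (\<forall>j<r. l u j = l' u j)" for c' l'
  proof -
    have C: "cell \<O> K c m x y = cell \<O> K c' m x y" if m: "m \<le> n0" and x: "x \<in> nball E v D" for m x y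
    proof (rule cell_cong[OF sub])
      fix i w t assume *: "i < m" "w \<in> nball E x (scope f m)" "t < K i"
      have "w \<in> nball E v (D + scope f m)" by (rule nball_trans[OF x *(2)])
      moreover have "D + scope f m \<le> r" using scope_mono[OF m, of f] by (simp add: r_def)
      ultimately have "w \<in> nball E v r" using nball_mono[of "D + scope f m" r E v] by auto
      moreover have "i < r" using * m by (simp add: r_def)
      moreover have "t < r" using * m T[of i] by (simp add: r_def)
      ultimately show "c i w t = c' i w t" using agree by simp
    qed
    have F: "full E \<O> K k c m u = full E \<O> K k c' m u" if "m \<le> n0" "u \<in> nball E v D" for m u
      unfolding full_def using C[OF that] by simp
    have L: "level E \<O> K k c' u = level E \<O> K k c u" if u: "full E \<O> K k c n0 u" "u \<in> nball E v D" for u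
    proof -
      have le: "level E \<O> K k c u \<le> n0" by (rule level_le[OF u(1)])
      have "full E \<O> K k c' (level E \<O> K k c u) u" using level_full[OF u(1)] F[OF le u(2)] by simp
      \<comment> \<open>A smaller full stage for \<open>c'\<close> would be among the stages up to
        \<open>n0\<close>, on which \<open>c\<close> and \<open>c'\<close> agree.\<close>
      moreover have "level E \<O> K k c u \<le> b" if "full E \<O> K k c' b u" for b
      proof (rule ccontr)
        assume b: "\<not> ?thesis"
        then have "full E \<O> K k c b u" using that F[OF _ u(2), of b] le by simp
        from level_le[OF this] b show False by simp
      qed
      ultimately show ?thesis unfolding level_def[of E \<O> K k c'] by (rule Least_equality)
    qed
    have fv: "full E \<O> K k c n0 v" unfolding n0_def using dom level_full by (auto simp: resolved_def)
    have level': "level E \<O> K k c' v = n0" using L[OF fv] by (simp add: n0_def)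
    have cls': "cell \<O> K c' n0 v u \<longleftrightarrow> u \<in> cls" for u using C[of n0 v u] by (simp add: cls_def)
    have lv: "l u j = l' u j" if "u \<in> cls" "j < J" for u j
    proof -
      have "u \<in> nball E v r" using clsD[OF that(1)] nball_mono[of D r E v] by (auto simp: r_def)
      then show ?thesis using agree that(2) by (simp add: r_def)
    qed
    have la1: "label_less l' u w" if "u \<in> cls" "w \<in> cls" "label_less l u w" for u w
    proof -
      have "(u, w) \<in> LP" using that by (simp add: LP_def)
      from J[OF this] obtain j where "j < J" "\<not> l u j" "l w j" "\<forall>i<j. l u i = l w i" by auto
      then show ?thesis unfolding label_less_def using lv that by (intro exI[of _ j]) auto
    qed
    have tot: "label_less l u w \<or> label_less l w u" if "u \<in> cls" "w \<in> cls" "u \<noteq> w" for u w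
      using dom[unfolded resolved_def, THEN conjunct2, rule_format, of u w] that by (simp add: cls_def n0_def)
    have la: "label_less l' u w = label_less l u w" if "u \<in> cls" "w \<in> cls" for u w
    proof
      assume *: "label_less l' u w"
      show "label_less l u w"
      proof (rule ccontr)
        assume no: "\<not> label_less l u w"
        have "u \<noteq> w" using * label_less_irrefl by metis
        then have "label_less l w u" using tot[OF that] no by simp
        then have "label_less l' w u" by (rule la1[OF that(2,1)])
        with * show False using label_less_trans label_less_irrefl by metis
      qed
    qed (rule la1[OF that])
    have "resolved E \<O> K k c' l' v"
      unfolding resolved_def level' cls'
    proof (intro conjI allI impI)
      show "\<exists>n. full E \<O> K k c' n v" using F[of n0 v] fv by auto
      fix u w assume "u \<in> cls \<and> w \<in> cls \<and> u \<noteq> w"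
      then show "label_less l' u w \<or> label_less l' w u" using tot[of u w] la[of u w] la[of w u] by simp
    qed
    moreover have "preds E \<O> K k c' l' v = preds E \<O> K k c l v"
      unfolding preds_def level' cls' n0_def[symmetric]
    proof (intro Collect_cong)
      fix u
      have v: "v \<in> cls" by (simp add: cls_def)
      show "(u \<in> cls \<and> full E \<O> K k c' n0 u \<and> (level E \<O> K k c' u < n0 \<or> level E \<O> K k c' u = n0 \<and> label_less l' u v)) =
        (cell \<O> K c n0 v u \<and> full E \<O> K k c n0 u \<and> (level E \<O> K k c u < n0 \<or> level E \<O> K k c u = n0 \<and> label_less l u v))"
        using F[OF order_refl clsD, of u] L[OF _ clsD, of u] la[OF _ v, of u]
        by (cases "u \<in> cls") (auto simp: cls_def)
    qed
    ultimately show ?thesis by simp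
  qed
  show ?thesis by (intro exI[of _ r] allI impI) (rule main)
qed

context aut_graph begin

lemma cell_aut:
  assumes closed: "\<forall>n. \<forall>A\<in>\<O> n. \<forall>\<gamma>\<in>\<Gamma>. \<gamma> ` A \<in> \<O> n" and g: "\<gamma> \<in> \<Gamma>"
  shows "cell \<O> K (\<lambda>n v. c n (\<gamma> v)) n x y = cell \<O> K c n (\<gamma> x) (\<gamma> y)"
proof (induction n arbitrary: x y)
  case 0 then show ?case using inj_eq[OF \<Gamma>_inj[OF g]] by simp
next
  case (Suc n)
  let ?P = "block (\<O> n) (K n) (c n)" and ?Q = "cell \<O> K c n"
  have P: "block (\<O> n) (K n) (\<lambda>v. c n (\<gamma> v)) z w = ?P (\<gamma> z) (\<gamma> w)" for z w
    by (rule block_aut) (use closed g in blast)+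
  have ex1: "(\<exists>w. ?Q (\<gamma> y) w \<and> ?P a w) = (\<exists>w. ?Q (\<gamma> y) (\<gamma> w) \<and> ?P a (\<gamma> w))" for a y
    by (rule \<Gamma>_ex[OF g, of "\<lambda>w. ?Q (\<gamma> y) w \<and> ?P a w", symmetric])
  have ex2: "(\<exists>w. ?Q (\<gamma> y) w \<and> ?P w a) = (\<exists>w. ?Q (\<gamma> y) (\<gamma> w) \<and> ?P (\<gamma> w) a)" for a y
    by (rule \<Gamma>_ex[OF g, of "\<lambda>w. ?Q (\<gamma> y) w \<and> ?P w a", symmetric])
  have all1: "(\<forall>z. ?Q (\<gamma> x) z \<longrightarrow> (\<exists>w. ?Q (\<gamma> y) (\<gamma> w) \<and> ?P z (\<gamma> w))) =
    (\<forall>z. ?Q (\<gamma> x) (\<gamma> z) \<longrightarrow> (\<exists>w. ?Q (\<gamma> y) (\<gamma> w) \<and> ?P (\<gamma> z) (\<gamma> w)))" for x y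
    by (rule \<Gamma>_all[OF g, of "\<lambda>z. ?Q (\<gamma> x) z \<longrightarrow> (\<exists>w. ?Q (\<gamma> y) (\<gamma> w) \<and> ?P z (\<gamma> w))", symmetric])
  have all2: "(\<forall>z. ?Q (\<gamma> x) z \<longrightarrow> (\<exists>w. ?Q (\<gamma> y) (\<gamma> w) \<and> ?P (\<gamma> w) z)) =
    (\<forall>z. ?Q (\<gamma> x) (\<gamma> z) \<longrightarrow> (\<exists>w. ?Q (\<gamma> y) (\<gamma> w) \<and> ?P (\<gamma> w) (\<gamma> z)))" for x y
    by (rule \<Gamma>_all[OF g, of "\<lambda>z. ?Q (\<gamma> x) z \<longrightarrow> (\<exists>w. ?Q (\<gamma> y) (\<gamma> w) \<and> ?P (\<gamma> w) z)", symmetric])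
  show ?case unfolding cell.simps hlift_def Suc.IH P ex1 ex2 all1 all2 by (rule refl)
qed

lemma full_aut:
  assumes closed: "\<forall>n. \<forall>A\<in>\<O> n. \<forall>\<gamma>\<in>\<Gamma>. \<gamma> ` A \<in> \<O> n" and g: "\<gamma> \<in> \<Gamma>"
  shows "full E \<O> K k (\<lambda>n v. c n (\<gamma> v)) n v = full E \<O> K k c n (\<gamma> v)"
proof -
  have "full E \<O> K k (\<lambda>n v. c n (\<gamma> v)) n v = (\<forall>u. \<gamma> u \<in> nball E (\<gamma> v) k \<longrightarrow> cell \<O> K c n (\<gamma> v) (\<gamma> u))"
    unfolding full_def Ball_def cell_aut[OF closed g] \<Gamma>_nball[OF g] by (rule refl)
  also have "\<dots> = full E \<O> K k c n (\<gamma> v)"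
    unfolding full_def Ball_def by (rule \<Gamma>_all[OF g, of "\<lambda>u. u \<in> nball E (\<gamma> v) k \<longrightarrow> cell \<O> K c n (\<gamma> v) u"])
  finally show ?thesis .
qed

lemma label_less_aut: "label_less (\<lambda>v. l (\<gamma> v)) u w = label_less l (\<gamma> u) (\<gamma> w)"
  by (simp add: label_less_def)

lemma level_aut:
  assumes closed: "\<forall>n. \<forall>A\<in>\<O> n. \<forall>\<gamma>\<in>\<Gamma>. \<gamma> ` A \<in> \<O> n" and g: "\<gamma> \<in> \<Gamma>"
  shows "level E \<O> K k (\<lambda>n v. c n (\<gamma> v)) v = level E \<O> K k c (\<gamma> v)"
  unfolding level_def full_aut[OF closed g] by (rule refl)

lemma preds_aut:
  assumes closed: "\<forall>n. \<forall>A\<in>\<O> n. \<forall>\<gamma>\<in>\<Gamma>. \<gamma> ` A \<in> \<O> n" and g: "\<gamma> \<in> \<Gamma>"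
  shows "u \<in> preds E \<O> K k (\<lambda>n v. c n (\<gamma> v)) (\<lambda>v. l (\<gamma> v)) v \<longleftrightarrow> \<gamma> u \<in> preds E \<O> K k c l (\<gamma> v)"
  unfolding preds_def mem_Collect_eq level_aut[OF closed g] full_aut[OF closed g] cell_aut[OF closed g] label_less_aut
  by (rule refl)

lemma resolved_aut:
  assumes closed: "\<forall>n. \<forall>A\<in>\<O> n. \<forall>\<gamma>\<in>\<Gamma>. \<gamma> ` A \<in> \<O> n" and g: "\<gamma> \<in> \<Gamma>"
  shows "resolved E \<O> K k (\<lambda>n v. c n (\<gamma> v)) (\<lambda>v. l (\<gamma> v)) v \<longleftrightarrow> resolved E \<O> K k c l (\<gamma> v)"
proof -
  let ?R = "\<lambda>u w. cell \<O> K c (level E \<O> K k c (\<gamma> v)) (\<gamma> v) u \<and> cell \<O> K c (level E \<O> K k c (\<gamma> v)) (\<gamma> v) w \<and> u \<noteq> w \<longrightarrow>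
    label_less l u w \<or> label_less l w u"
  have "(\<forall>u w. ?R (\<gamma> u) (\<gamma> w)) = (\<forall>u w. ?R (\<gamma> u) w)"
    by (intro all_cong1 \<Gamma>_all[OF g])
  also have "\<dots> = (\<forall>u w. ?R u w)" by (rule \<Gamma>_all[OF g, of "\<lambda>u. \<forall>w. ?R u w"])
  finally show ?thesis
    unfolding resolved_def level_aut[OF closed g] full_aut[OF closed g] cell_aut[OF closed g] label_less_aut
      inj_eq[OF \<Gamma>_inj[OF g]] by simp
qed

end

lemma label_less_total: "\<exists>j. l u j \<noteq> l w j \<Longrightarrow> label_less l u w \<or> label_less l w u"
proof -
  assume ex: "\<exists>j. l u j \<noteq> l w j"
  define j where "j = (LEAST j. l u j \<noteq> l w j)"
  have "l u j \<noteq> l w j" unfolding j_def using ex by (rule LeastI_ex)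
  moreover have "l u i = l w i" if "i < j" for i
    using not_less_Least[of i "\<lambda>j. l u j \<noteq> l w j"] that by (auto simp: j_def)
  ultimately show ?thesis unfolding label_less_def by (cases "l u j") auto
qed

lemma null_set_bern:
  assumes "U \<in> sets (bern \<rho>)" "\<And>e. e > 0 \<Longrightarrow> measure (bern \<rho>) U \<le> e"
  shows "AE b in bern \<rho>. b \<notin> U"
proof -
  interpret prob_space "bern \<rho>" by (rule prob_space_bern)
  have "prob U \<le> 0" by (rule field_le_epsilon) (simp add: assms(2))
  then have "prob U = 0" using measure_nonneg[of "bern \<rho>" U] by linarith
  then show ?thesis using prob_eq_0[OF assms(1)] by simp
qed

section \<open>Almost sure merging of cells and distinctness of labels\<close>

context aut_graph begin

lemma countable_coords: "countable (UNIV :: ('v \<times> nat) set)"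
  using countable_SIGMA[OF vcountable, of "\<lambda>_. UNIV :: nat set"] by simp

lemma AE_all_vertices:
  assumes "\<And>x :: 'v. AE b in M. P b x" shows "AE b in M. \<forall>x. P b x"
proof -
  have "AE b in M. \<forall>x\<in>UNIV. P b x"
    by (subst AE_ball_countable[OF vcountable]) (intro ballI assms)
  then show ?thesis by simp
qed

lemma sets_cell:
  assumes sub: "\<And>n A x. A \<in> \<O> n \<Longrightarrow> x \<in> A \<Longrightarrow> A \<subseteq> nball E x (f n)"
  shows "{b. \<not> cell \<O> K (\<lambda>n v t. b (v, eN n t)) n x y} \<in> sets (bern (\<rho> :: 'v \<times> nat \<Rightarrow> real))"
proof (rule fin_open_sets[OF countable_coords], rule fin_open_dep)
  let ?J = "nball E x (scope f n) \<times> (\<Union>m\<in>{..<n}. eN m ` {..<K m})"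
  show "finite ?J" by simp
  show "dep_on ?J {b. \<not> cell \<O> K (\<lambda>n v t. b (v, eN n t)) n x y}"
  proof (rule dep_onI)
    fix b b' :: "'v \<times> nat \<Rightarrow> bool"
    assume eq: "\<And>k. k \<in> ?J \<Longrightarrow> b k = b' k" and b: "b \<in> {b. \<not> cell \<O> K (\<lambda>n v t. b (v, eN n t)) n x y}"
    have "cell \<O> K (\<lambda>n v t. b (v, eN n t)) n x y = cell \<O> K (\<lambda>n v t. b' (v, eN n t)) n x y"
      by (rule cell_cong[OF sub]) (use eq in auto)
    with b show "b' \<in> {b. \<not> cell \<O> K (\<lambda>n v t. b (v, eN n t)) n x y}" by simp
  qed
qed

lemma sets_block:
  assumes sub: "\<And>A x. A \<in> \<O> \<Longrightarrow> x \<in> A \<Longrightarrow> A \<subseteq> nball E x f"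
  shows "{b. \<not> block \<O> K (\<lambda>v t. b (v, e t)) x y} \<in> sets (bern (\<rho> :: 'v \<times> nat \<Rightarrow> real))"
proof (rule fin_open_sets[OF countable_coords], rule fin_open_dep)
  let ?J = "(nball E x f \<union> nball E y f) \<times> e ` {..<K}"
  show "finite ?J" by simp
  show "dep_on ?J {b. \<not> block \<O> K (\<lambda>v t. b (v, e t)) x y}"
  proof (rule dep_onI)
    fix b b' :: "'v \<times> nat \<Rightarrow> bool"
    assume eq: "\<And>k. k \<in> ?J \<Longrightarrow> b k = b' k" and b: "b \<in> {b. \<not> block \<O> K (\<lambda>v t. b (v, e t)) x y}"
    have "block \<O> K (\<lambda>v t. b (v, e t)) x y = block \<O> K (\<lambda>v t. b' (v, e t)) x y"
      by (rule block_cong[OF sub]) (use eq in auto)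
    with b show "b' \<in> {b. \<not> block \<O> K (\<lambda>v t. b (v, e t)) x y}" by simp
  qed
qed

text \<open>Lets one tolerance serve the union bounds at all vertices.\<close>

lemma card_nball_eq: "card (nball E x r) = card (nball E y r)"
proof -
  obtain \<gamma> where g: "\<gamma> \<in> \<Gamma>" "\<gamma> y = x" using \<Gamma>_moves by blast
  have "nball E x r = \<gamma> ` nball E y r"
  proof (intro equalityI subsetI)
    fix u assume u: "u \<in> nball E x r"
    obtain z where z: "u = \<gamma> z" using \<Gamma>_ex[OF g(1), of "\<lambda>z. u = z"] by blast
    with u g have "z \<in> nball E y r" using \<Gamma>_nball[OF g(1), of z y r] by simp
    with z show "u \<in> \<gamma> ` nball E y r" by blast
  next
    fix u assume "u \<in> \<gamma> ` nball E y r"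
    then show "u \<in> nball E x r" using \<Gamma>_nball[OF g(1), of _ y r] g(2) by auto
  qed
  then show ?thesis by (simp add: card_image inj_on_subset[OF \<Gamma>_inj[OF g(1)], OF subset_UNIV])
qed

lemma AE_label_less:
  fixes \<rho> :: "'v \<times> nat \<Rightarrow> real"
  assumes \<rho>: "\<And>k. 0 \<le> \<rho> k \<and> \<rho> k \<le> 1" "\<And>v j. \<rho> (v, eL j) = 1 / 2" and inj: "inj eL" and uw: "u \<noteq> w"
  shows "AE b in bern \<rho>. label_less (\<lambda>v j. b (v, eL j)) u w \<or> label_less (\<lambda>v j. b (v, eL j)) w u"
proof -
  interpret prob_space "bern \<rho>" by (rule prob_space_bern)
  define D where "D j = {b :: 'v \<times> nat \<Rightarrow> bool. b (u, eL j) = b (w, eL j)}" for j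
  let ?k = "\<lambda>j. {(u, eL j), (w, eL j)}"
  have depD: "dep_on (?k j) (D j)" for j by (rule dep_onI) (auto simp: D_def)
  have setsD: "D j \<in> events" for j by (rule fin_open_sets[OF countable_coords fin_open_dep[OF _ depD]]) simp
  have PD: "prob (D j) = 1 / 2" for j
  proof -
    let ?C = "\<lambda>a. {b. \<forall>k\<in>?k j. b k = a}"
    have PC: "prob (?C a) = 1 / 4" for a
    proof -
      have "prob (?C a) = (\<Prod>k\<in>?k j. if a then \<rho> k else 1 - \<rho> k)" using \<rho>(1) by (intro prob_bern_cyl) auto
      also have "\<dots> = (\<Prod>k\<in>?k j. 1 / 2)" by (intro prod.cong) (auto simp: \<rho>(2))
      also have "\<dots> = 1 / 4" using uw by (simp add: power2_eq_square)
      finally show ?thesis .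
    qed
    have CS: "?C a \<in> events" for a
      by (rule fin_open_sets[OF countable_coords fin_open_dep[of "?k j"]]) (auto intro!: dep_onI)
    have "D j = ?C True \<union> ?C False" by (auto simp: D_def)
    also have "prob \<dots> = prob (?C True) + prob (?C False)" by (rule finite_measure_Union[OF CS CS]) auto
    finally show ?thesis unfolding PC by simp
  qed
  define U where "U = (\<Inter>j. D j)"
  have U_sets: "U \<in> events" unfolding U_def using setsD by (intro sets.countable_INT) auto
  have small: "prob U \<le> e" if pos: "e > 0" for e
  proof -
    obtain m :: nat where m: "(1 / 2) ^ m < e" using real_arch_pow_inv[OF pos, of "1 / 2"] by auto
    have fs: "(\<Inter>j\<in>{..<m}. D j) \<in> events"
    proof (cases "m = 0")
      case True then show ?thesis using sets.top[of "bern \<rho>"] by simp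
    next
      case False then show ?thesis using setsD by (intro sets.finite_INT) auto
    qed
    have "prob U \<le> prob (\<Inter>j\<in>{..<m}. D j)" by (rule finite_measure_mono[OF _ fs]) (auto simp: U_def)
    also have "\<dots> = (\<Prod>j\<in>{..<m}. prob (D j))"
      by (rule prob_INT_dep[of _ _ _ ?k]) (auto simp: setsD depD disjoint_family_on_def inj_eq[OF inj])
    also have "\<dots> = (1 / 2) ^ m" by (simp add: PD)
    finally show ?thesis using m by simp
  qed
  have "AE b in bern \<rho>. b \<notin> U" by (rule null_set_bern[OF U_sets]) (rule small)
  then show ?thesis
  proof eventually_elim
    case (elim b)
    then have "\<exists>j. b (u, eL j) \<noteq> b (w, eL j)" by (auto simp: U_def D_def)
    from label_less_total[of "\<lambda>v j. b (v, eL j)", OF this] show ?case .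
  qed
qed

text \<open>Adjacent vertices are apart at stage \<open>n + 1\<close> only if an edge in a ball of
  known size is cut, which the tolerance makes at most \<open>1 / (n + 1)\<close> likely. Being
  apart at every stage is contained in each of these events, so it suffices that the bounds tend to
  0; summability or independence between stages does not enter.\<close>

lemma hierarchy_exists:
  "\<exists>\<O> K f p. (\<forall>n. 0 \<le> p n \<and> p n \<le> 1) \<and> (\<forall>n. \<forall>A\<in>\<O> n. \<forall>\<gamma>\<in>\<Gamma>. \<gamma> ` A \<in> \<O> n) \<and>
    (\<forall>n. \<forall>A\<in>\<O> n. \<forall>x\<in>A. A \<subseteq> nball E x (f n)) \<and>
    (\<forall>(\<rho> :: 'v \<times> nat \<Rightarrow> real) eN eL. (\<forall>k. 0 \<le> \<rho> k \<and> \<rho> k \<le> 1) \<longrightarrow> (\<forall>n. inj (eN n)) \<longrightarrow> inj eL \<longrightarrow>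
      (\<forall>v n t. \<rho> (v, eN n t) = p n) \<longrightarrow> (\<forall>v j. \<rho> (v, eL j) = 1 / 2) \<longrightarrow>
      (AE b in bern \<rho>. \<forall>v. resolved E \<O> K k (\<lambda>n v t. b (v, eN n t)) (\<lambda>v j. b (v, eL j)) v))"
proof -
  define good where "good \<delta> = (\<lambda>(\<O>, K, f, p). 0 \<le> p \<and> p \<le> 1 \<and> (\<forall>A\<in>\<O>. \<forall>\<gamma>\<in>\<Gamma>. \<gamma> ` A \<in> \<O>) \<and>
    (\<forall>A\<in>\<O>. \<forall>x\<in>A. A \<subseteq> nball E x f) \<and>
    (\<forall>(\<rho> :: 'v \<times> nat \<Rightarrow> real) e x y. (\<forall>k. 0 \<le> \<rho> k \<and> \<rho> k \<le> 1) \<longrightarrow> inj e \<longrightarrow> (\<forall>v t. \<rho> (v, e t) = p) \<longrightarrow> adj E x y \<longrightarrow>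
      measure (bern \<rho>) {b. \<not> block \<O> K (\<lambda>v t. b (v, e t)) x y} \<le> \<delta>))" for \<delta> :: real
  define G where "G \<delta> = (SOME q. good \<delta> q)" for \<delta>
  have G: "good \<delta> (G \<delta>)" if "\<delta> > 0" for \<delta>
  proof -
    have "\<exists>\<O> K f p. good \<delta> (\<O>, K, f, p)"
      unfolding good_def prod.case by (rule partition_scheme[OF that])
    then have "\<exists>q. good \<delta> q" by (elim exE) (rule exI)
    then show ?thesis unfolding G_def by (rule someI_ex)
  qed
  obtain o' :: 'v where True by blast
  define nb where "nb r = card (nball E o' r)" for r
  have nb_pos: "nb r > 0" for r unfolding nb_def by (simp add: card_gt_0_iff) (metis empty_iff nball_self)
  \<comment> \<open>A ball of radius \<open>r + 1\<close> contains at most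
    \<open>nb (r + 1) ^ 2\<close> edges, counted as ordered pairs, so the union bound leaves
    \<open>1 / (n + 1)\<close>.\<close>
  define \<delta> where "\<delta> n r = 1 / (real (Suc n) * real (nb (r + 1)) ^ 2)" for n r
  have \<delta>_pos: "\<delta> n r > 0" for n r unfolding \<delta>_def using nb_pos by simp
  \<comment> \<open>The tolerance of a stage depends on the radius reached so far, and that depends
    on the ranges of the schemes chosen earlier. The radius is therefore the value carried by the
    recursion.\<close>
  define rd where "rd = rec_nat 0 (\<lambda>n r. fst (snd (snd (G (\<delta> n r)))) + r)"
  define q where "q n = G (\<delta> n (rd n))" for n
  define \<O> where "\<O> n = fst (q n)" for n
  define K where "K n = fst (snd (q n))" for n
  define f where "f n = fst (snd (snd (q n)))" for n
  define p where "p n = snd (snd (snd (q n)))" for n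
  have rd: "rd n = radius f n" for n
    by (induction n) (simp_all add: rd_def f_def q_def)
  have gq: "good (\<delta> n (radius f n)) (\<O> n, K n, f n, p n)" for n
    using G[OF \<delta>_pos[of n "rd n"]] by (simp add: \<O>_def K_def f_def p_def q_def flip: rd)
  note gq1 = gq[unfolded good_def prod.case]
  have p01: "\<forall>n. 0 \<le> p n \<and> p n \<le> 1"
    using gq1[THEN conjunct1] gq1[THEN conjunct2, THEN conjunct1] by simp
  have closed: "\<forall>n. \<forall>A\<in>\<O> n. \<forall>\<gamma>\<in>\<Gamma>. \<gamma> ` A \<in> \<O> n"
    using gq1[THEN conjunct2, THEN conjunct2, THEN conjunct1] by (rule allI)
  have sub0: "\<forall>n. \<forall>A\<in>\<O> n. \<forall>x\<in>A. A \<subseteq> nball E x (f n)"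
    using gq1[THEN conjunct2, THEN conjunct2, THEN conjunct2, THEN conjunct1] by (rule allI)
  then have sub: "A \<subseteq> nball E x (f n)" if "A \<in> \<O> n" "x \<in> A" for n A x using that by blast
  have "AE b in bern \<rho>. \<forall>v. resolved E \<O> K k (\<lambda>n v t. b (v, eN n t)) (\<lambda>v j. b (v, eL j)) v"
    if \<rho>: "\<forall>k. 0 \<le> \<rho> k \<and> \<rho> k \<le> 1" and iN: "\<forall>n. inj (eN n)" and iL: "inj eL"
      and \<rho>N: "\<forall>v n t. \<rho> (v, eN n t) = p n" and \<rho>L: "\<forall>v j. \<rho> (v, eL j) = 1 / 2"
    for \<rho> :: "'v \<times> nat \<Rightarrow> real" and eN eL
  proof -
    interpret prob_space "bern \<rho>" by (rule prob_space_bern)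
    let ?c = "\<lambda>b n v t. b (v, eN n t)" and ?l = "\<lambda>b v j. b (v, eL j)"
    have Ppart: "prob {b. \<not> block (\<O> n) (K n) (?c b n) u v} \<le> \<delta> n (radius f n)" if "adj E u v" for n u v
      using gq1[of n, THEN conjunct2, THEN conjunct2, THEN conjunct2, THEN conjunct2, rule_format, of \<rho> "eN n" u v]
        \<rho> iN \<rho>N that by simp
    have Pcell: "prob {b. \<not> cell \<O> K (?c b) (Suc n) x y} \<le> 1 / real (Suc n)" if xy: "adj E x y" for n x y
    proof -
      let ?B = "nball E x (radius f n + 1)"
      let ?S = "{s\<in>?B \<times> ?B. adj E (fst s) (snd s)}"
      let ?U = "\<lambda>s. {b. \<not> block (\<O> n) (K n) (?c b n) (fst s) (snd s)}"
      have fin: "finite ?S" by simp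
      have sU: "?U s \<in> events" for s using sets_block[OF sub, where e = "eN n"] by simp
      have "prob {b. \<not> cell \<O> K (?c b) (Suc n) x y} \<le> prob (\<Union>s\<in>?S. ?U s)"
      proof (rule finite_measure_mono)
        show "{b. \<not> cell \<O> K (?c b) (Suc n) x y} \<subseteq> (\<Union>s\<in>?S. ?U s)"
        proof
          fix b assume "b \<in> {b. \<not> cell \<O> K (?c b) (Suc n) x y}"
          then have sep: "\<not> cell \<O> K (?c b) (Suc n) x y" by simp
          have "\<exists>u\<in>?B. \<exists>v\<in>?B. adj E u v \<and> \<not> block (\<O> n) (K n) (?c b n) u v"
            by (rule cell_separated[OF sub xy sep])
          then obtain u v where "u \<in> ?B" "v \<in> ?B" "adj E u v" "\<not> block (\<O> n) (K n) (?c b n) u v" by blast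
          then show "b \<in> (\<Union>s\<in>?S. ?U s)" by (intro UN_I[of "(u, v)"]) simp_all
        qed
        show "(\<Union>s\<in>?S. ?U s) \<in> events" using fin sU by (intro sets.finite_UN) auto
      qed
      also have "\<dots> \<le> (\<Sum>s\<in>?S. prob (?U s))"
        using fin sU by (intro finite_measure_subadditive_finite) auto
      also have "\<dots> \<le> (\<Sum>s\<in>?S. \<delta> n (radius f n))" by (intro sum_mono Ppart) simp
      also have "\<dots> = real (card ?S) * \<delta> n (radius f n)" by simp
      also have "\<dots> \<le> real (nb (radius f n + 1)) ^ 2 * \<delta> n (radius f n)"
      proof (rule mult_right_mono)
        have "card ?S \<le> card (?B \<times> ?B)" by (intro card_mono) auto
        also have "\<dots> = nb (radius f n + 1) ^ 2"
          by (simp add: card_cartesian_product nb_def card_nball_eq[of x _ o'] power2_eq_square)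
        finally have "real (card ?S) \<le> real (nb (radius f n + 1) ^ 2)" by (rule of_nat_mono)
        then show "real (card ?S) \<le> real (nb (radius f n + 1)) ^ 2" by (simp only: of_nat_power)
      qed (use \<delta>_pos[of n "radius f n"] in simp)
      also have "\<dots> = 1 / real (Suc n)" unfolding \<delta>_def using nb_pos[of "radius f n + 1"] by (simp del: of_nat_Suc)
      finally show ?thesis .
    qed
    have "AE b in bern \<rho>. \<exists>n. cell \<O> K (?c b) n x y" if xy: "adj E x y" for x y
    proof -
      let ?U = "\<Inter>n. {b. \<not> cell \<O> K (?c b) n x y}"
      have sc: "{b. \<not> cell \<O> K (?c b) n x y} \<in> events" for n by (rule sets_cell[OF sub])
      have sU: "?U \<in> events" using sc by (intro sets.countable_INT) auto
      have small: "prob ?U \<le> e" if pos: "e > 0" for e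
      proof -
        obtain n where n: "inverse (real (Suc n)) < e" using reals_Archimedean[OF pos] by blast
        have "prob ?U \<le> prob {b. \<not> cell \<O> K (?c b) (Suc n) x y}" 
          by (rule finite_measure_mono[OF _ sc], rule INT_lower, rule UNIV_I)
        also have "\<dots> \<le> 1 / real (Suc n)" by (rule Pcell[OF xy])
        finally show ?thesis using n by (simp add: inverse_eq_divide)
      qed
      have "AE b in bern \<rho>. b \<notin> ?U" by (rule null_set_bern[OF sU]) (rule small)
      then show ?thesis by eventually_elim auto
    qed
    then have "AE b in bern \<rho>. \<forall>x y. adj E x y \<longrightarrow> (\<exists>n. cell \<O> K (?c b) n x y)"
      by (intro AE_all_vertices AE_impI)
    moreover have "AE b in bern \<rho>. \<forall>u w. u \<noteq> w \<longrightarrow> label_less (?l b) u w \<or> label_less (?l b) w u"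
    proof -
      have "AE b in bern \<rho>. u \<noteq> w \<longrightarrow> label_less (?l b) u w \<or> label_less (?l b) w u" for u w
        using AE_label_less[of \<rho> eL u w] \<rho> \<rho>L iL by (cases "u = w") simp_all
      then show ?thesis by (intro AE_all_vertices)
    qed
    ultimately show ?thesis
    proof eventually_elim
      case (elim b)
      have edge: "\<exists>n. cell \<O> K (?c b) n x y" if "adj E x y" for x y using elim(1) that by simp
      have lab: "label_less (?l b) u w \<or> label_less (?l b) w u" if "u \<noteq> w" for u w using elim(2) that by simp
      \<comment> \<open>Each edge of a walk is eventually inside one cell, and nesting brings the
        stages of finitely many edges to a common one.\<close>
      have reach: "u \<in> nball E v r \<Longrightarrow> \<exists>n. cell \<O> K (?c b) n v u" for u v r
      proof (induction r arbitrary: u)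
        case 0 then show ?case by (intro exI[of _ 0]) simp
      next
        case (Suc r)
        from Suc.prems consider "u \<in> nball E v r" | w where "w \<in> nball E v r" "adj E u w" by (auto simp: nball_Suc)
        then show ?case
        proof cases
          case 1 then show ?thesis by (rule Suc.IH)
        next
          case 2
          from Suc.IH[OF 2(1)] obtain n where "cell \<O> K (?c b) n v w" by blast
          then have n: "cell \<O> K (?c b) (n + m) v w" for m by (rule cell_mono) simp
          from edge[OF 2(2)] obtain m where "cell \<O> K (?c b) m u w" by blast
          then have "cell \<O> K (?c b) (n + m) u w" by (rule cell_mono) simp
          then have "cell \<O> K (?c b) (n + m) v u" by (rule cell_trans[OF n[of m] cell_sym])
          then show ?thesis by (rule exI)
        qed
      qed
      have full: "\<exists>n. full E \<O> K k (?c b) n v" for v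
      proof -
        have "\<exists>N. \<forall>u\<in>nball E v k. \<exists>n<N. cell \<O> K (?c b) n v u"
          by (rule finite_bounded_witnesses[OF finite_nball]) (rule reach)
        then obtain N where N: "\<forall>u\<in>nball E v k. \<exists>n<N. cell \<O> K (?c b) n v u" by (elim exE)
        have "full E \<O> K k (?c b) N v" unfolding full_def
        proof
          fix u assume "u \<in> nball E v k"
          with N obtain n where n: "n < N" "cell \<O> K (?c b) n v u" by blast
          show "cell \<O> K (?c b) N v u" by (rule cell_mono[OF n(2)]) (use n(1) in simp)
        qed
        then show ?thesis by (rule exI)
      qed
      show ?case using full lab by (simp add: resolved_def)
    qed
  qed
  note main = this
  show ?thesis
    by (rule exI[of _ \<O>], rule exI[of _ K], rule exI[of _ f], rule exI[of _ p],
        intro conjI p01 closed sub0, intro allI impI, rule main)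
qed

end

section \<open>Local events and conditional sampling\<close>

text \<open>One number bounds both the distance and the index of the bits that are compared, so a
  window is a finite set of coordinates.\<close>

definition agree :: "'v set set \<Rightarrow> 'v \<Rightarrow> nat \<Rightarrow> ('v \<times> nat \<Rightarrow> bool) \<Rightarrow> ('v \<times> nat \<Rightarrow> bool) \<Rightarrow> bool" where
  "agree E v r b b' \<longleftrightarrow> (\<forall>u\<in>nball E v r. \<forall>i<r. b (u, i) = b' (u, i))"

text \<open>Validity in a neighbourhood of the configuration \<open>b\<close>, with windows centred
  at \<open>v\<close>; \<open>locally_shift\<close> moves the centre.\<close>

definition locally_at :: "'v set set \<Rightarrow> 'v \<Rightarrow> ('v \<times> nat \<Rightarrow> bool) \<Rightarrow> (('v \<times> nat \<Rightarrow> bool) \<Rightarrow> bool) \<Rightarrow> bool" where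
  "locally_at E v b \<Phi> \<longleftrightarrow> (\<exists>r. \<forall>b'. agree E v r b b' \<longrightarrow> \<Phi> b')"

lemma agree_mono: "agree E v r b b' \<Longrightarrow> s \<le> r \<Longrightarrow> agree E v s b b'"
  using nball_mono[of s r E v] by (auto simp: agree_def)

lemma agree_shift: "agree E v (d + r) b b' \<Longrightarrow> u \<in> nball E v d \<Longrightarrow> agree E u r b b'"
  unfolding agree_def using nball_trans[of u E v d _ r] by simp

lemma locally_shift:
  assumes "u \<in> nball E v d" "locally_at E u b \<Phi>" shows "locally_at E v b \<Phi>"
proof -
  from assms(2) obtain r where "\<forall>b'. agree E u r b b' \<longrightarrow> \<Phi> b'" by (auto simp: locally_at_def)
  then show ?thesis unfolding locally_at_def
    using agree_shift[OF _ assms(1)] by (intro exI[of _ "d + r"]) simp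
qed

lemma locally_conj:
  assumes "locally_at E v b \<Phi>" "locally_at E v b \<Psi>" shows "locally_at E v b (\<lambda>b. \<Phi> b \<and> \<Psi> b)"
proof -
  from assms obtain r s where rs: "\<forall>b'. agree E v r b b' \<longrightarrow> \<Phi> b'" "\<forall>b'. agree E v s b b' \<longrightarrow> \<Psi> b'"
    by (auto simp: locally_at_def)
  show ?thesis unfolding locally_at_def
  proof (intro exI[of _ "max r s"] allI impI)
    fix b' assume a: "agree E v (max r s) b b'"
    show "\<Phi> b' \<and> \<Psi> b'" using rs agree_mono[OF a, of r] agree_mono[OF a, of s] by simp
  qed
qed

lemma locally_ball:
  assumes "finite W" "\<And>u. u \<in> W \<Longrightarrow> locally_at E v b (\<Phi> u)" shows "locally_at E v b (\<lambda>b. \<forall>u\<in>W. \<Phi> u b)"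
  using assms
proof (induction W rule: finite_induct)
  case empty then show ?case by (simp add: locally_at_def)
next
  case (insert u W)
  then have "locally_at E v b (\<lambda>b. \<Phi> u b \<and> (\<forall>u\<in>W. \<Phi> u b))" by (intro locally_conj) auto
  then show ?case by simp
qed

lemma locally_mono:
  assumes "locally_at E v b \<Phi>" "\<And>b. \<Phi> b \<Longrightarrow> \<Psi> b" shows "locally_at E v b \<Psi>"
proof -
  from assms(1) obtain r where "\<forall>b'. agree E v r b b' \<longrightarrow> \<Phi> b'" by (auto simp: locally_at_def)
  then show ?thesis unfolding locally_at_def using assms(2) by (intro exI[of _ r]) simp
qed

text \<open>Patterns are sets of vertex-value pairs: an automorphism acts on them by
  \<open>map_prod \<gamma> id\<close>, and joining patterns is union.\<close>

definition graph_of :: "('v \<Rightarrow> nat) \<Rightarrow> 'v set \<Rightarrow> ('v \<times> nat) set" where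
  "graph_of x A = (\<lambda>u. (u, x u)) ` A"

lemma graph_of_Un: "graph_of x (A \<union> B) = graph_of x A \<union> graph_of x B"
  by (simp add: graph_of_def image_Un)

lemma graph_of_insert: "graph_of x (insert u A) = insert (u, x u) (graph_of x A)"
  by (simp add: graph_of_def)

lemma graph_of_cong: "(\<And>u. u \<in> A \<Longrightarrow> x u = y u) \<Longrightarrow> graph_of x A = graph_of y A"
  by (simp add: graph_of_def)

lemma finite_graph_of[simp]: "finite A \<Longrightarrow> finite (graph_of x A)"
  by (simp add: graph_of_def)

text \<open>The law of \<open>X\<close> enters through the probabilities \<open>q\<close> of finite
  patterns, with values coded as natural numbers. A pattern that gives two values to one vertex has
  probability 0.\<close>

locale dependent_field = aut_graph E \<Gamma> for E :: "'v set set" and \<Gamma> :: "('v \<Rightarrow> 'v) set" +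
  fixes M :: "'w measure" and X :: "'v \<Rightarrow> 'w \<Rightarrow> nat" and k :: nat
    and q :: "('v \<times> nat) set \<Rightarrow> real"
  assumes prob_M: "prob_space M"
    and rv: "\<And>v. X v \<in> measurable M (count_space UNIV)"
    and q_def: "q P = measure M {\<omega>\<in>space M. \<forall>p\<in>P. X (fst p) \<omega> = snd p}"
    and q_inv: "finite P \<Longrightarrow> \<gamma> \<in> \<Gamma> \<Longrightarrow> q (map_prod \<gamma> id ` P) = q P"
    and q_indep: "finite P \<Longrightarrow> finite P' \<Longrightarrow>
      (\<And>p p'. p \<in> P \<Longrightarrow> p' \<in> P' \<Longrightarrow> fst p \<notin> nball E (fst p') k) \<Longrightarrow> q (P \<union> P') = q P * q P'"
begin

definition cyl :: "('v \<times> nat) set \<Rightarrow> 'w set" where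
  "cyl P = {\<omega>\<in>space M. \<forall>p\<in>P. X (fst p) \<omega> = snd p}"

lemma q_cyl: "q P = measure M (cyl P)"
  by (simp add: q_def cyl_def)

lemma sets_cyl: "finite P \<Longrightarrow> cyl P \<in> sets M"
proof -
  assume "finite P"
  moreover have "{\<omega>\<in>space M. X v \<omega> = s} \<in> sets M" for v s
    using measurable_sets[OF rv[of v], of "{s}"] by (simp add: vimage_def Int_def conj_commute)
  ultimately show ?thesis unfolding cyl_def by (intro sets.sets_Collect_finite_All) auto
qed

lemma q_empty: "q {} = 1"
  using prob_space.prob_space[OF prob_M] by (simp add: q_def)

lemma q_nonneg: "0 \<le> q P"
  by (simp add: q_def)

lemma q_sums:
  assumes "finite P" shows "(\<lambda>s. q (insert (v, s) P)) sums q P"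
proof -
  interpret prob_space M by (rule prob_M)
  have "range (\<lambda>s. cyl (insert (v, s) P)) \<subseteq> events" using assms sets_cyl by auto
  moreover have "disjoint_family (\<lambda>s. cyl (insert (v, s) P))"
    by (auto simp: disjoint_family_on_def cyl_def)
  ultimately have "(\<lambda>s. prob (cyl (insert (v, s) P))) sums prob (\<Union>s. cyl (insert (v, s) P))"
    by (rule finite_measure_UNION)
  moreover have "(\<Union>s. cyl (insert (v, s) P)) = cyl P" by (auto simp: cyl_def)
  ultimately show ?thesis by (simp add: q_cyl)
qed

text \<open>
  Conditional probability of the value \<open>j\<close> at \<open>v\<close> given the values \<open>P\<close> and given that the value at \<open>v\<close> is at
  least \<open>j\<close>, so that a value is sampled by successive coin tosses. When the conditioning event is null
  this is \<open>0 / 0 = 0\<close>.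
\<close>

definition hazard :: "'v \<times> ('v \<times> nat) set \<Rightarrow> nat \<Rightarrow> real" where
  "hazard = (\<lambda>(v, P) j. q (insert (v, j) P) / (q P - (\<Sum>i<j. q (insert (v, i) P))))"

lemma q_tail:
  assumes "finite P" shows "q (insert (v, j) P) \<le> q P - (\<Sum>i<j. q (insert (v, i) P))"
proof -
  have "(\<Sum>i<Suc j. q (insert (v, i) P)) \<le> (\<Sum>i. q (insert (v, i) P))"
    using sums_summable[OF q_sums[OF assms]] q_nonneg by (intro sum_le_suminf) auto
  also have "\<dots> = q P" using q_sums[OF assms] by (rule sums_unique[symmetric])
  finally show ?thesis by simp
qed

lemma hazard_bounds: assumes "finite P" shows "0 \<le> hazard (v, P) j" "hazard (v, P) j \<le> 1"
proof -
  let ?t = "q P - (\<Sum>i<j. q (insert (v, i) P))"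
  have "0 \<le> q (insert (v, j) P)" "q (insert (v, j) P) \<le> ?t" using q_tail[OF assms] q_nonneg by auto
  then show "0 \<le> hazard (v, P) j" "hazard (v, P) j \<le> 1"
    by (auto simp: hazard_def divide_le_eq_1)
qed

definition sample_pr :: "'v \<Rightarrow> ('v \<times> nat) set \<Rightarrow> nat \<Rightarrow> real" where
  "sample_pr v P s = hazard (v, P) s * (\<Prod>i<s. 1 - hazard (v, P) i)"

text \<open>Multiplied by \<open>q P\<close>, the products of \<open>1 - hazard\<close> telescope to
  the mass not yet used up. Stating the chain rule without division covers null patterns, for which
  every toss has bias 0 and no value is ever drawn.\<close>

lemma q_sample_pr:
  assumes "finite P" shows "q P * sample_pr v P s = q (insert (v, s) P)"
proof -
  let ?t = "\<lambda>j. q P - (\<Sum>i<j. q (insert (v, i) P))"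
  have z: "q (insert (v, j) P) = 0" if "?t j = 0" for j
    using q_tail[OF assms, of v j] q_nonneg[of "insert (v, j) P"] that by linarith
  have h: "?t j * hazard (v, P) j = q (insert (v, j) P)" for j
    using z[of j] by (cases "?t j = 0") (simp_all add: hazard_def)
  have "q P * (\<Prod>i<j. 1 - hazard (v, P) i) = ?t j" for j
  proof (induction j)
    case (Suc j)
    have "q P * (\<Prod>i<Suc j. 1 - hazard (v, P) i) = (q P * (\<Prod>i<j. 1 - hazard (v, P) i)) * (1 - hazard (v, P) j)"
      by (simp add: mult.assoc)
    also have "\<dots> = ?t j - ?t j * hazard (v, P) j" unfolding Suc.IH by (simp add: right_diff_distrib)
    finally show ?case unfolding h by simp
  qed simp
  moreover have "q P * sample_pr v P s = q P * (\<Prod>i<s. 1 - hazard (v, P) i) * hazard (v, P) s"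
    by (simp add: sample_pr_def mult_ac)
  ultimately show ?thesis using h[of s] by simp
qed

lemma hazard_aut:
  assumes "finite P" "\<gamma> \<in> \<Gamma>" shows "hazard (\<gamma> v, map_prod \<gamma> id ` P) j = hazard (v, P) j"
proof -
  have "q (insert (\<gamma> v, i) (map_prod \<gamma> id ` P)) = q (insert (v, i) P)" for i
    using q_inv[of "insert (v, i) P" \<gamma>] assms by simp
  then show ?thesis using q_inv[OF assms] by (simp add: hazard_def)
qed

section \<open>Orbits of vertices with patterns\<close>

definition orbit :: "'v \<times> ('v \<times> nat) set \<Rightarrow> ('v \<times> ('v \<times> nat) set) set" where
  "orbit = (\<lambda>(v, P). {(\<gamma> v, map_prod \<gamma> id ` P) | \<gamma>. \<gamma> \<in> \<Gamma>})"

definition orbits :: "('v \<times> ('v \<times> nat) set) set set" where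
  "orbits = orbit ` (UNIV \<times> {P. finite P})"

definition orbit_id :: "'v \<Rightarrow> ('v \<times> nat) set \<Rightarrow> nat" where
  "orbit_id v P = to_nat_on orbits (orbit (v, P))"

text \<open>For the field to be identically distributed, the bias of a bit may depend on its index
  but not on the vertex. Invariance of \<open>q\<close> makes \<open>hazard\<close> constant on
  orbits, so any representative serves; numbers that name no orbit get bias 0.\<close>

definition hazard_at :: "nat \<Rightarrow> nat \<Rightarrow> real" where
  "hazard_at c j = (if \<exists>v P. finite P \<and> orbit_id v P = c then hazard (SOME x. finite (snd x) \<and> orbit_id (fst x) (snd x) = c) j else 0)"

lemma countable_orbits: "countable orbits"
proof -
  have "countable {A :: ('v \<times> nat) set. finite A \<and> A \<subseteq> UNIV}"
    by (rule countable_Collect_finite_subset[OF countable_coords])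
  then have "countable ((UNIV :: 'v set) \<times> {A :: ('v \<times> nat) set. finite A})"
    using vcountable by (intro countable_SIGMA) auto
  then show ?thesis unfolding orbits_def by (rule countable_image)
qed

lemma orbit_self: "(v, P) \<in> orbit (v, P)"
proof -
  have "(v, P) = ((\<lambda>v. v) v, map_prod (\<lambda>v. v) id ` P)" by (simp add: map_prod_def id_def)
  then show ?thesis unfolding orbit_def prod.case using \<Gamma>_id
    by (intro CollectI exI[of _ "\<lambda>v. v"] conjI)
qed

lemma orbit_aut:
  assumes g: "\<gamma> \<in> \<Gamma>" shows "orbit (\<gamma> v, map_prod \<gamma> id ` P) = orbit (v, P)"
proof (intro equalityI subsetI)
  fix x assume "x \<in> orbit (\<gamma> v, map_prod \<gamma> id ` P)"
  then obtain \<delta> where d: "\<delta> \<in> \<Gamma>" "x = (\<delta> (\<gamma> v), map_prod \<delta> id ` map_prod \<gamma> id ` P)" by (auto simp: orbit_def)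
  then have "x = ((\<lambda>v. \<delta> (\<gamma> v)) v, map_prod (\<lambda>v. \<delta> (\<gamma> v)) id ` P)"
    by (simp add: image_image map_prod_def split_beta)
  then show "x \<in> orbit (v, P)" using \<Gamma>_comp[OF d(1) g] by (auto simp: orbit_def)
next
  fix x assume "x \<in> orbit (v, P)"
  then obtain \<delta> where d: "\<delta> \<in> \<Gamma>" "x = (\<delta> v, map_prod \<delta> id ` P)" by (auto simp: orbit_def)
  let ?e = "\<lambda>u. \<delta> (inv_into UNIV \<gamma> u)"
  have "x = (?e (\<gamma> v), map_prod ?e id ` map_prod \<gamma> id ` P)"
    using d(2) g by (simp add: image_image map_prod_def split_beta)
  then show "x \<in> orbit (\<gamma> v, map_prod \<gamma> id ` P)" using \<Gamma>_comp[OF d(1) \<Gamma>_inv[OF g]] by (auto simp: orbit_def)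
qed

lemma orbit_id_aut: "\<gamma> \<in> \<Gamma> \<Longrightarrow> orbit_id (\<gamma> v) (map_prod \<gamma> id ` P) = orbit_id v P"
  by (simp add: orbit_id_def orbit_aut)

lemma hazard_orbit_id:
  assumes "finite P" "finite P'" "orbit_id v P = orbit_id v' P'" shows "hazard (v, P) j = hazard (v', P') j"
proof -
  have "orbit (v, P) \<in> orbits" "orbit (v', P') \<in> orbits" using assms by (auto simp: orbits_def)
  then have "orbit (v, P) = orbit (v', P')"
    using assms(3) countable_orbits by (simp add: orbit_id_def)
  then have "(v', P') \<in> orbit (v, P)" using orbit_self by simp
  then obtain \<gamma> where "\<gamma> \<in> \<Gamma>" "v' = \<gamma> v" "P' = map_prod \<gamma> id ` P" by (auto simp: orbit_def)
  then show ?thesis using hazard_aut[OF assms(1)] by simp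
qed

lemma hazard_at_orbit_id:
  assumes "finite P" shows "hazard_at (orbit_id v P) j = hazard (v, P) j"
proof -
  let ?R = "\<lambda>x. finite (snd x) \<and> orbit_id (fst x) (snd x) = orbit_id v P"
  have "?R (SOME x. ?R x)" by (rule someI[of ?R "(v, P)"]) (simp add: assms)
  then have "hazard (fst (SOME x. ?R x), snd (SOME x. ?R x)) j = hazard (v, P) j"
    using hazard_orbit_id[OF _ assms] by blast
  then show ?thesis unfolding hazard_at_def using assms by auto
qed

lemma hazard_at_bounds: "0 \<le> hazard_at c j \<and> hazard_at c j \<le> 1"
proof (cases "\<exists>v P. finite P \<and> orbit_id v P = c")
  case True
  then obtain v P where "finite P" "orbit_id v P = c" by blast
  then show ?thesis using hazard_at_orbit_id[of P v j] hazard_bounds[of P v j] by simp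
next
  case False then show ?thesis unfolding hazard_at_def by auto
qed

end

section \<open>The sampled field\<close>

text \<open>What sampling needs to know about the order, separated from the construction of the
  order. \<open>eS c j\<close> is the coordinate of toss \<open>j\<close> for orbit
  \<open>c\<close>. By \<open>prd_struct\<close> the order reads none of these coordinates and is
  therefore independent of all tosses.\<close>

locale sampler = dependent_field E \<Gamma> M X k q
  for E :: "'v set set" and \<Gamma> :: "('v \<Rightarrow> 'v) set" and M :: "'w measure" and X :: "'v \<Rightarrow> 'w \<Rightarrow> nat"
    and k :: nat and q :: "('v \<times> nat) set \<Rightarrow> real" +
  fixes \<rho> :: "'v \<times> nat \<Rightarrow> real" and eS :: "nat \<Rightarrow> nat \<Rightarrow> nat"
    and dom :: "('v \<times> nat \<Rightarrow> bool) \<Rightarrow> 'v \<Rightarrow> bool" and prd :: "('v \<times> nat \<Rightarrow> bool) \<Rightarrow> 'v \<Rightarrow> 'v set"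
  assumes \<rho>01: "0 \<le> \<rho> i \<and> \<rho> i \<le> 1"
    and \<rho>S: "\<rho> (v, eS c j) = hazard_at c j"
    and eS_inj: "eS c j = eS c' j' \<longleftrightarrow> c = c' \<and> j = j'"
    and prd_ball: "\<exists>r. prd b v \<subseteq> nball E v r"
    and prd_irrefl: "v \<notin> prd b v"
    and prd_trans: "u \<in> prd b v \<Longrightarrow> w \<in> prd b u \<Longrightarrow> w \<in> prd b v"
    and prd_near: "dom b u \<Longrightarrow> dom b v \<Longrightarrow> u \<noteq> v \<Longrightarrow> u \<in> nball E v k \<Longrightarrow> u \<in> prd b v \<or> v \<in> prd b u"
    and prd_common: "dom b u \<Longrightarrow> dom b v \<Longrightarrow> u \<noteq> v \<Longrightarrow> w \<in> prd b u \<Longrightarrow> w \<in> prd b v \<Longrightarrow> u \<in> prd b v \<or> v \<in> prd b u"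
    and prd_local: "dom b v \<Longrightarrow> locally_at E v b (\<lambda>b'. dom b' v \<and> prd b' v = prd b v)"
    and dom_aut: "\<gamma> \<in> \<Gamma> \<Longrightarrow> dom (\<lambda>p. b (\<gamma> (fst p), snd p)) v = dom b (\<gamma> v)"
    and prd_aut: "\<gamma> \<in> \<Gamma> \<Longrightarrow> u \<in> prd (\<lambda>p. b (\<gamma> (fst p), snd p)) v \<longleftrightarrow> \<gamma> u \<in> prd b (\<gamma> v)"
    and prd_struct: "(\<And>v i. (\<And>c j. i \<noteq> eS c j) \<Longrightarrow> b (v, i) = b' (v, i)) \<Longrightarrow> dom b v = dom b' v \<and> prd b v = prd b' v"
    and AE_dom: "AE b in bern \<rho>. \<forall>v. dom b v"
begin

lemma finite_prd: "finite (prd b v)"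
  using prd_ball[of b v] finite_nball finite_subset by metis

definition sampled :: "('v \<times> nat \<Rightarrow> bool) \<Rightarrow> 'v \<Rightarrow> ('v \<times> nat) set \<Rightarrow> nat \<Rightarrow> bool" where
  "sampled b v P s \<longleftrightarrow> (\<forall>i<s. \<not> b (v, eS (orbit_id v P) i)) \<and> b (v, eS (orbit_id v P) s)"

text \<open>A finite certificate: values on a set closed under predecessors, each drawn by the
  sampling rule. Certificates replace a recursion along the order, which would have to deal with
  tosses that never succeed and with vertices outside \<open>dom\<close>.\<close>

definition consistent :: "('v \<times> nat \<Rightarrow> bool) \<Rightarrow> 'v set \<Rightarrow> ('v \<Rightarrow> nat) \<Rightarrow> bool" where
  "consistent b W x \<longleftrightarrow> finite W \<and> (\<forall>u\<in>W. dom b u \<and> prd b u \<subseteq> W \<and> sampled b u (graph_of x (prd b u)) (x u))"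

definition val :: "('v \<times> nat \<Rightarrow> bool) \<Rightarrow> 'v \<Rightarrow> nat \<Rightarrow> bool" where
  "val b v s \<longleftrightarrow> (\<exists>W x. v \<in> W \<and> consistent b W x \<and> x v = s)"

lemma sampled_unique: "sampled b v P s \<Longrightarrow> sampled b v P t \<Longrightarrow> s = t"
  unfolding sampled_def by (metis linorder_neqE_nat)

text \<open>The number of predecessors drops strictly along the order, by transitivity and
  irreflexivity, so equality propagates by induction on it.\<close>

lemma consistent_unique:
  assumes "consistent b W x" "consistent b W' x'"
  shows "v \<in> W \<Longrightarrow> v \<in> W' \<Longrightarrow> x v = x' v"
proof (induction "card (prd b v)" arbitrary: v rule: less_induct)
  case less
  have "x u = x' u" if u: "u \<in> prd b v" for u
  proof (rule less.hyps)
    have "prd b u \<subset> prd b v" using u prd_trans[OF u] prd_irrefl[of u b] by blast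
    then show "card (prd b u) < card (prd b v)" by (rule psubset_card_mono[OF finite_prd])
    show "u \<in> W" "u \<in> W'" using u less.prems assms by (auto simp: consistent_def)
  qed
  then have "graph_of x (prd b v) = graph_of x' (prd b v)" by (rule graph_of_cong)
  moreover have "sampled b v (graph_of x (prd b v)) (x v)" "sampled b v (graph_of x' (prd b v)) (x' v)"
    using assms less.prems by (auto simp: consistent_def)
  ultimately show ?case using sampled_unique by metis
qed

lemma val_unique: "val b v s \<Longrightarrow> val b v t \<Longrightarrow> s = t"
  unfolding val_def using consistent_unique by metis

lemma sampled_local:
  assumes "sampled b v P s" shows "locally_at E v b (\<lambda>b'. sampled b' v P s)"
  unfolding locally_at_def
proof (intro exI[of _ "Suc (\<Sum>i\<le>s. eS (orbit_id v P) i)"] allI impI)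
  fix b' assume a: "agree E v (Suc (\<Sum>i\<le>s. eS (orbit_id v P) i)) b b'"
  have "b (v, eS (orbit_id v P) i) = b' (v, eS (orbit_id v P) i)" if "i \<le> s" for i
  proof -
    have "eS (orbit_id v P) i \<le> (\<Sum>i\<le>s. eS (orbit_id v P) i)" using that by (intro member_le_sum) auto
    then show ?thesis using a by (simp add: agree_def)
  qed
  then show "sampled b' v P s" using assms by (simp add: sampled_def)
qed

text \<open>By transitivity a certificate can be cut down to \<open>v\<close> and its predecessors.
  What remains are finitely many local conditions; this is where finiteness of the coding radius
  comes from.\<close>

lemma val_local:
  assumes "val b v s" shows "locally_at E v b (\<lambda>b'. val b' v s)"
proof -
  from assms obtain W x where W: "v \<in> W" "consistent b W x" "x v = s" by (auto simp: val_def)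
  let ?V = "insert v (prd b v)"
  have sub: "?V \<subseteq> W" using W by (auto simp: consistent_def)
  obtain d where d: "prd b v \<subseteq> nball E v d" using prd_ball by blast
  have loc: "locally_at E v b (\<lambda>b'. \<forall>u\<in>?V. (dom b' u \<and> prd b' u = prd b u) \<and> sampled b' u (graph_of x (prd b u)) (x u))"
  proof (rule locally_ball)
    show "finite ?V" using finite_prd by simp
    fix u assume u: "u \<in> ?V"
    have "dom b u" "sampled b u (graph_of x (prd b u)) (x u)" using u sub W(2) by (auto simp: consistent_def)
    then have "locally_at E u b (\<lambda>b'. (dom b' u \<and> prd b' u = prd b u) \<and> sampled b' u (graph_of x (prd b u)) (x u))"
      by (intro locally_conj prd_local sampled_local)
    moreover have "u \<in> nball E v d" using u d by auto
    ultimately show "locally_at E v b (\<lambda>b'. (dom b' u \<and> prd b' u = prd b u) \<and> sampled b' u (graph_of x (prd b u)) (x u))"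
      by (rule locally_shift[rotated])
  qed
  show ?thesis
  proof (rule locally_mono[OF loc])
    fix b' assume *: "\<forall>u\<in>?V. (dom b' u \<and> prd b' u = prd b u) \<and> sampled b' u (graph_of x (prd b u)) (x u)"
    have "consistent b' ?V x" unfolding consistent_def
    proof (intro conjI ballI)
      show "finite ?V" using finite_prd by simp
      fix u assume u: "u \<in> ?V"
      then have "dom b' u" and pe: "prd b' u = prd b u" and "sampled b' u (graph_of x (prd b u)) (x u)" using * by auto
      then show "dom b' u" "sampled b' u (graph_of x (prd b' u)) (x u)" by simp_all
      have "prd b u \<subseteq> ?V" using u prd_trans[of u b v] by auto
      then show "prd b' u \<subseteq> ?V" using pe by simp
    qed
    then show "val b' v s" unfolding val_def using W(3) by (intro exI[of _ ?V] exI[of _ x]) simp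
  qed
qed

lemma fin_open_locally:
  assumes "\<And>b. \<Phi> b \<Longrightarrow> locally_at E v b \<Phi>" shows "fin_open {b. \<Phi> b}"
proof (rule fin_openI)
  fix b assume "b \<in> {b. \<Phi> b}"
  then have "locally_at E v b \<Phi>" using assms by simp
  then obtain r where r: "\<forall>b'. agree E v r b b' \<longrightarrow> \<Phi> b'" by (auto simp: locally_at_def)
  show "\<exists>J. finite J \<and> (\<forall>b'. (\<forall>k\<in>J. b k = b' k) \<longrightarrow> b' \<in> {b. \<Phi> b})"
  proof (intro exI[of _ "nball E v r \<times> {..<r}"] conjI allI impI)
    fix b' assume "\<forall>k\<in>nball E v r \<times> {..<r}. b k = b' k"
    then have "agree E v r b b'" by (simp add: agree_def)
    then show "b' \<in> {b. \<Phi> b}" using r by simp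
  qed simp
qed

lemma sets_val: "{b. val b v s} \<in> sets (bern \<rho>)"
  by (rule fin_open_sets[OF countable_coords fin_open_locally[OF val_local]])

lemma sets_sampled: "{b. sampled b v P s} \<in> sets (bern \<rho>)"
  by (rule fin_open_sets[OF countable_coords fin_open_locally[OF sampled_local]])

text \<open>Automorphisms carry certificates to certificates, because a pattern and its image have
  the same \<open>orbit_id\<close> and so consult the same tosses.\<close>

lemma val_aut1:
  assumes g: "\<gamma> \<in> \<Gamma>" and v: "val (\<lambda>p. b (\<gamma> (fst p), snd p)) v s"
  shows "val b (\<gamma> v) s"
proof -
  let ?b = "\<lambda>p. b (\<gamma> (fst p), snd p)"
  let ?i = "inv_into UNIV \<gamma>"
  from v obtain W x where W: "v \<in> W" "consistent ?b W x" "x v = s" by (auto simp: val_def)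
  have pim: "prd b (\<gamma> u) = \<gamma> ` prd ?b u" for u
  proof (intro equalityI subsetI)
    fix w assume w: "w \<in> prd b (\<gamma> u)"
    obtain z where z: "w = \<gamma> z" using \<Gamma>_ex[OF g, of "\<lambda>z. w = z"] by blast
    with w have "z \<in> prd ?b u" using prd_aut[OF g, of z b u] by simp
    with z show "w \<in> \<gamma> ` prd ?b u" by blast
  next
    fix w assume "w \<in> \<gamma> ` prd ?b u"
    then obtain z where "w = \<gamma> z" "z \<in> prd ?b u" by blast
    then show "w \<in> prd b (\<gamma> u)" using prd_aut[OF g, of z b u] by simp
  qed
  have "consistent b (\<gamma> ` W) (\<lambda>u. x (?i u))" unfolding consistent_def
  proof (intro conjI ballI)
    show "finite (\<gamma> ` W)" using W(2) by (simp add: consistent_def)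
    fix u' assume "u' \<in> \<gamma> ` W"
    then obtain u where u: "u' = \<gamma> u" "u \<in> W" by blast
    have c: "dom ?b u" "prd ?b u \<subseteq> W" "sampled ?b u (graph_of x (prd ?b u)) (x u)" using W(2) u(2) by (auto simp: consistent_def)
    show "dom b u'" using c(1) dom_aut[OF g] u(1) by simp
    show "prd b u' \<subseteq> \<gamma> ` W" using c(2) pim u(1) by auto
    have "graph_of (\<lambda>u. x (?i u)) (\<gamma> ` prd ?b u) = map_prod \<gamma> id ` graph_of x (prd ?b u)"
      using g by (simp add: graph_of_def image_image)
    then show "sampled b u' (graph_of (\<lambda>u. x (?i u)) (prd b u')) (x (?i u'))"
      using c(3) g u(1) pim[of u] by (simp add: sampled_def orbit_id_aut)
  qed
  then show ?thesis unfolding val_def using W(1,3) g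
    by (intro exI[of _ "\<gamma> ` W"] exI[of _ "\<lambda>u. x (?i u)"]) simp
qed

lemma val_aut:
  assumes g: "\<gamma> \<in> \<Gamma>"
  shows "val (\<lambda>p. b (\<gamma> (fst p), snd p)) v s \<longleftrightarrow> val b (\<gamma> v) s"
proof
  let ?b = "\<lambda>p. b (\<gamma> (fst p), snd p)"
  assume "val b (\<gamma> v) s"
  then have "val (\<lambda>p. ?b (inv_into UNIV \<gamma> (fst p), snd p)) (\<gamma> v) s" using g by simp
  from val_aut1[OF \<Gamma>_inv[OF g] this] show "val ?b v s" using g by simp
qed (rule val_aut1[OF g])

lemma prob_sampled:
  assumes "finite P" shows "measure (bern \<rho>) {b. sampled b v P s} = sample_pr v P s"
proof -
  let ?e = "\<lambda>i. (v, eS (orbit_id v P) i)"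
  have inj: "inj_on ?e {..s}" by (auto simp: inj_on_def eS_inj)
  have "{b. sampled b v P s} = {b. \<forall>i\<in>?e ` {..s}. b i = (i = ?e s)}"
    unfolding sampled_def by (auto simp: eS_inj le_less)
  also have "measure (bern \<rho>) \<dots> = (\<Prod>i\<in>?e ` {..s}. if i = ?e s then \<rho> i else 1 - \<rho> i)"
    using \<rho>01 by (intro prob_bern_cyl) auto
  also have "\<dots> = (\<Prod>i\<in>{..s}. if i = s then hazard (v, P) i else 1 - hazard (v, P) i)"
    by (subst prod.reindex[OF inj]) (auto simp: \<rho>S hazard_at_orbit_id[OF assms] eS_inj intro!: prod.cong)
  also have "{..s} = insert s {..<s}" by auto
  also have "(\<Prod>i\<in>insert s {..<s}. if i = s then hazard (v, P) i else 1 - hazard (v, P) i) = hazard (v, P) s * (\<Prod>i<s. 1 - hazard (v, P) i)"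
    by (subst prod.insert) (auto intro!: prod.cong)
  finally show ?thesis by (simp add: sample_pr_def)
qed

lemma dep_sampled: "dep_on {(v, eS c j) | c j. True} {b. sampled b v P s}"
proof (rule dep_onI)
  fix b b' :: "'v \<times> nat \<Rightarrow> bool"
  assume eq: "\<And>i. i \<in> {(v, eS c j) | c j. True} \<Longrightarrow> b i = b' i" and "b \<in> {b. sampled b v P s}"
  moreover have "b (v, eS c j) = b' (v, eS c j)" for c j by (rule eq) blast
  ultimately show "b' \<in> {b. sampled b v P s}" by (simp add: sampled_def)
qed

text \<open>Remove from \<open>W\<close> a vertex maximal in the order: the vertices of \<open>W\<close> that are not its predecessors
  are at distance more than \<open>k\<close> from it and from its predecessors.\<close>

lemma q_product:
  shows "finite W \<Longrightarrow> \<forall>u\<in>W. dom b u \<and> prd b u \<subseteq> W \<Longrightarrow> q (graph_of x W) = (\<Prod>u\<in>W. sample_pr u (graph_of x (prd b u)) (x u))"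
proof (induction "card W" arbitrary: W)
  case 0
  then show ?case by (simp add: graph_of_def q_empty)
next
  case (Suc n)
  have ne: "W \<noteq> {}" using Suc.hyps(2) by auto
  let ?c = "\<lambda>w. card (prd b w)"
  \<comment> \<open>A vertex with the most predecessors is maximal: a vertex above it would have
    strictly more.\<close>
  obtain w where w: "w \<in> W" and max: "\<And>u. u \<in> W \<Longrightarrow> ?c u \<le> ?c w"
  proof -
    have "Max (?c ` W) \<in> ?c ` W" using Suc.prems(1) ne by (intro Max_in) auto
    then obtain w where "w \<in> W" "?c w = Max (?c ` W)" by auto
    then show ?thesis using that[of w] Suc.prems(1) by simp
  qed
  have top: "w \<notin> prd b u" if "u \<in> W" for u
  proof
    assume wu: "w \<in> prd b u"
    have "prd b w \<subset> prd b u" using wu prd_trans[OF wu] prd_irrefl[of w b] by blast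
    then have "?c w < ?c u" by (rule psubset_card_mono[OF finite_prd])
    with max[OF that] show False by simp
  qed
  let ?W = "W - {w}" and ?G = "graph_of x (prd b w)"
  define R where "R = W - {w} - prd b w"
  have pw: "prd b w \<subseteq> ?W" using Suc.prems(2) w prd_irrefl[of w b] by auto
  have RD: "u \<in> W" "u \<noteq> w" "u \<notin> prd b w" if "u \<in> R" for u using that by (auto simp: R_def)
  have W_eq: "?W = prd b w \<union> R" using pw by (auto simp: R_def)
  have W_eq2: "W = insert w (prd b w \<union> R)" using W_eq w by auto
  have IH: "q (graph_of x ?W) = (\<Prod>u\<in>?W. sample_pr u (graph_of x (prd b u)) (x u))"
  proof (rule Suc.hyps(1))
    show "n = card ?W" using Suc.hyps(2) w Suc.prems(1) by simp
    show "finite ?W" using Suc.prems(1) by simp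
    show "\<forall>u\<in>?W. dom b u \<and> prd b u \<subseteq> ?W"
    proof
      fix u assume "u \<in> ?W"
      then have "u \<in> W" by simp
      with Suc.prems(2) top[OF this] show "dom b u \<and> prd b u \<subseteq> ?W" by auto
    qed
  qed
  have finG: "finite ?G" using finite_prd by simp
  have finR: "finite (graph_of x R)" using Suc.prems(1) by (simp add: R_def)
  have far1: "w \<notin> nball E u k" if u: "u \<in> R" for u
  proof
    assume near: "w \<in> nball E u k"
    have "dom b w" "dom b u" "w \<noteq> u" using Suc.prems(2) w RD[OF u] by auto
    from prd_near[OF this near] have "w \<in> prd b u \<or> u \<in> prd b w" .
    then show False using top[of u] RD[OF u] by auto
  qed
  have far2: "p \<notin> nball E u k" if u: "u \<in> R" and p: "p \<in> prd b w" for u p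
  proof
    assume near: "p \<in> nball E u k"
    have d: "dom b w" "dom b u" "dom b p" "p \<noteq> u" "u \<noteq> w"
      using Suc.prems(2) w RD[OF u] p pw by auto
    from prd_near[OF d(3,2,4) near] have "p \<in> prd b u \<or> u \<in> prd b p" .
    then show False
    proof
      assume "p \<in> prd b u"
      \<comment> \<open>Since \<open>w\<close> is maximal, comparability puts \<open>u\<close> below
        \<open>w\<close>, but \<open>R\<close> contains no predecessor of \<open>w\<close>.\<close>
      from prd_common[OF d(2,1,5) this p] have "u \<in> prd b w \<or> w \<in> prd b u" .
      then show False using top[of u] RD[OF u] by auto
    next
      assume "u \<in> prd b p"
      then have "u \<in> prd b w" by (rule prd_trans[OF p])
      then show False using RD[OF u] by simp
    qed
  qed
  have "q (?G \<union> graph_of x R) = q ?G * q (graph_of x R)"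
    using far2 by (intro q_indep finG finR) (auto simp: graph_of_def)
  then have q1: "q (graph_of x ?W) = q ?G * q (graph_of x R)" by (subst W_eq) (simp add: graph_of_Un)
  have "q (insert (w, x w) ?G \<union> graph_of x R) = q (insert (w, x w) ?G) * q (graph_of x R)"
    using far1 far2 by (intro q_indep finR) (use finG in \<open>auto simp: graph_of_def\<close>)
  \<comment> \<open>The predecessors of \<open>w\<close>, with or without \<open>w\<close> itself,
    are independent of \<open>R\<close>. The common factor \<open>q (graph_of x R)\<close> is kept
    rather than cancelled, so null patterns need no separate case.\<close>
  then have q2: "q (graph_of x W) = q (insert (w, x w) ?G) * q (graph_of x R)"
    by (subst W_eq2) (simp add: graph_of_Un graph_of_insert)
  also have "q (insert (w, x w) ?G) = q ?G * sample_pr w ?G (x w)" by (rule q_sample_pr[OF finG, symmetric])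
  finally have "q (graph_of x W) = sample_pr w ?G (x w) * q (graph_of x ?W)" unfolding q1 by (simp add: mult_ac)
  also have "\<dots> = (\<Prod>u\<in>W. sample_pr u (graph_of x (prd b u)) (x u))"
    unfolding IH using Suc.prems(1) w by (simp add: prod.remove)
  finally show ?case .
qed

end

section \<open>Law of the sampled field\<close>

text \<open>One-sided bounds suffice to identify the law of the sampled field.\<close>

lemma prob_measure_eqI_le:
  assumes \<mu>: "prob_space \<mu>" "sets \<mu> = Pow C" and \<nu>: "prob_space \<nu>" "sets \<nu> = Pow C" and C: "countable C"
    and le: "\<And>a. a \<in> C \<Longrightarrow> emeasure \<mu> {a} \<le> emeasure \<nu> {a}"
  shows "\<mu> = \<nu>"
proof (rule measure_eqI)
  show "sets \<mu> = sets \<nu>" using \<mu> \<nu> by simp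
  have sp: "space \<mu> = C" "space \<nu> = C"
    using \<mu>(2) \<nu>(2) by (metis Pow_top Sup_upper sets.sets_into_space sets.top subset_antisym Pow_iff)+
  have mono: "emeasure \<mu> B \<le> emeasure \<nu> B" if B: "B \<subseteq> C" for B
  proof -
    have cB: "countable B" using B C by (rule countable_subset)
    have "emeasure \<mu> B = (\<integral>\<^sup>+x. emeasure \<mu> {x} \<partial>count_space B)"
      using cB B \<mu>(2) by (intro emeasure_countable_singleton) auto
    also have "\<dots> \<le> (\<integral>\<^sup>+x. emeasure \<nu> {x} \<partial>count_space B)"
      using B le by (intro nn_integral_mono) auto
    also have "\<dots> = emeasure \<nu> B"
      using cB B \<nu>(2) by (intro emeasure_countable_singleton[symmetric]) auto
    finally show ?thesis .
  qed
  interpret a: prob_space \<mu> by fact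
  interpret b: prob_space \<nu> by fact
  fix B assume "B \<in> sets \<mu>"
  then have B: "B \<subseteq> C" using \<mu> by simp
  then have BS: "B \<in> sets \<mu>" "B \<in> sets \<nu>" using \<mu> \<nu> by simp_all
  have "a.prob B \<le> b.prob B" using mono[OF B] by (simp add: a.emeasure_eq_measure b.emeasure_eq_measure)
  \<comment> \<open>As both masses are 1, the bound for the complement is the reverse inequality for
    \<open>B\<close>.\<close>
  moreover have "a.prob (C - B) \<le> b.prob (C - B)"
    using mono[of "C - B"] by (simp add: a.emeasure_eq_measure b.emeasure_eq_measure)
  then have "1 - a.prob B \<le> 1 - b.prob B"
    using a.prob_compl[OF BS(1)] b.prob_compl[OF BS(2)] by (simp add: sp)
  ultimately show "emeasure \<mu> B = emeasure \<nu> B" by (simp add: a.emeasure_eq_measure b.emeasure_eq_measure)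
qed

section \<open>Conditioning on the order around a finite set\<close>

context sampler begin

definition shape_event :: "'v set \<Rightarrow> ('v \<times> 'v) set \<Rightarrow> ('v \<times> nat \<Rightarrow> bool) set" where
  "shape_event W H = {b. \<forall>u\<in>W. dom b u \<and> prd b u = H `` {u}}"

definition sample_event :: "'v set \<Rightarrow> ('v \<times> 'v) set \<Rightarrow> ('v \<Rightarrow> nat) \<Rightarrow> ('v \<times> nat \<Rightarrow> bool) set" where
  "sample_event W H x = {b. \<forall>u\<in>W. sampled b u (graph_of x (H `` {u})) (x u)}"

text \<open>Here \<open>W\<close> is exactly \<open>A\<close> together with its predecessors, and
  \<open>H\<close> has no pairs starting outside \<open>W\<close>. The shape is thus a function of
  the order, which makes the events of different shapes disjoint.\<close>

definition shapes :: "'v set \<Rightarrow> ('v set \<times> ('v \<times> 'v) set) set" where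
  "shapes A = {(W, H). finite W \<and> finite H \<and> A \<subseteq> W \<and> Domain H \<subseteq> W \<and> (\<forall>u\<in>W. H `` {u} \<subseteq> W) \<and>
    W = A \<union> (\<Union>v\<in>A. H `` {v})}"

lemma sets_shape_event: assumes "finite W" shows "shape_event W H \<in> sets (bern \<rho>)"
proof -
  have "shape_event W H = (\<Inter>u\<in>W. {b. dom b u \<and> prd b u = H `` {u}})" by (auto simp: shape_event_def)
  moreover have "fin_open {b. dom b u \<and> prd b u = H `` {u}}" for u
  proof (rule fin_open_locally[of _ u])
    fix b assume *: "dom b u \<and> prd b u = H `` {u}"
    then have "locally_at E u b (\<lambda>b'. dom b' u \<and> prd b' u = prd b u)" by (intro prd_local) simp
    with * show "locally_at E u b (\<lambda>b. dom b u \<and> prd b u = H `` {u})" by simp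
  qed
  ultimately have "fin_open (shape_event W H)" using assms by (simp only: fin_open_INT)
  then show ?thesis by (rule fin_open_sets[OF countable_coords])
qed

lemma dep_shape_event: "dep_on {(v, i) | v i. \<forall>c j. i \<noteq> eS c j} (shape_event W H)"
proof (rule dep_onI)
  fix b b' assume eq: "\<And>p. p \<in> {(v, i) | v i. \<forall>c j. i \<noteq> eS c j} \<Longrightarrow> b p = b' p" and b: "b \<in> shape_event W H"
  have "dom b v = dom b' v \<and> prd b v = prd b' v" for v
    by (rule prd_struct, rule eq) simp
  with b show "b' \<in> shape_event W H" by (simp add: shape_event_def)
qed

lemma sample_event_INT: "sample_event W H x = (\<Inter>u\<in>W. {b. sampled b u (graph_of x (H `` {u})) (x u)})"
  by (auto simp: sample_event_def)

lemma sets_sample_event: assumes "finite W" shows "sample_event W H x \<in> sets (bern \<rho>)"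
proof -
  have "fin_open (sample_event W H x)" unfolding sample_event_INT
    by (intro fin_open_INT assms fin_open_locally[OF sampled_local])
  then show ?thesis by (rule fin_open_sets[OF countable_coords])
qed

text \<open>The order and the tosses at different vertices use disjoint coordinates, so the
  probability factorises. The product over \<open>W\<close> is evaluated by \<open>q_product\<close>
  at any configuration of this shape; if there is none, both sides vanish.\<close>

lemma prob_shape_event_sample_event:
  assumes fin: "finite W" "finite H" and closed: "\<forall>u\<in>W. H `` {u} \<subseteq> W"
  shows "measure (bern \<rho>) (shape_event W H \<inter> sample_event W H x) = measure (bern \<rho>) (shape_event W H) * q (graph_of x W)"
proof (cases "shape_event W H = {}")
  case True then show ?thesis by simp
next
  case False
  then obtain b0 where b0: "b0 \<in> shape_event W H" by blast
  let ?K = "\<lambda>u. {(u, eS c j) | c j. True}"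
  have depS: "dep_on (\<Union>u\<in>W. ?K u) (sample_event W H x)" unfolding sample_event_INT by (intro dep_on_INT dep_sampled)
  have "measure (bern \<rho>) (sample_event W H x) = (\<Prod>u\<in>W. measure (bern \<rho>) {b. sampled b u (graph_of x (H `` {u})) (x u)})"
    unfolding sample_event_INT by (rule prob_INT_dep[OF fin(1) sets_sampled dep_sampled]) (auto simp: disjoint_family_on_def)
  also have "\<dots> = (\<Prod>u\<in>W. sample_pr u (graph_of x (prd b0 u)) (x u))"
  proof (rule prod.cong[OF refl])
    fix u assume "u \<in> W"
    then have "prd b0 u = H `` {u}" using b0 by (simp add: shape_event_def)
    then show "measure (bern \<rho>) {b. sampled b u (graph_of x (H `` {u})) (x u)} = sample_pr u (graph_of x (prd b0 u)) (x u)"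
      using prob_sampled[OF finite_graph_of[OF finite_prd], of u x b0 u "x u"] by simp
  qed
  also have "\<dots> = q (graph_of x W)"
    using b0 closed by (intro q_product[symmetric] fin) (simp add: shape_event_def)
  finally have P: "measure (bern \<rho>) (sample_event W H x) = q (graph_of x W)" .
  have "measure (bern \<rho>) (shape_event W H \<inter> sample_event W H x) = measure (bern \<rho>) (shape_event W H) * measure (bern \<rho>) (sample_event W H x)"
    by (rule prob_Int_dep[OF sets_shape_event[OF fin(1)] sets_sample_event[OF fin(1)] dep_shape_event depS]) auto
  then show ?thesis using P by simp
qed

lemma consistent_shape_event_sample_event:
  assumes "(W, H) \<in> shapes A" "b \<in> shape_event W H \<inter> sample_event W H x" shows "consistent b W x"
proof -
  have W: "finite W" "\<forall>u\<in>W. H `` {u} \<subseteq> W"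
    using assms(1) unfolding shapes_def mem_Collect_eq prod.case by blast+
  have "dom b u" "prd b u = H `` {u}" "sampled b u (graph_of x (H `` {u})) (x u)" if "u \<in> W" for u
    using assms(2) that by (simp_all add: shape_event_def sample_event_def)
  with W show ?thesis by (simp add: consistent_def)
qed

lemma countable_shapes: "countable (shapes A)"
proof -
  have c2: "countable (UNIV :: ('v \<times> 'v) set)"
    using countable_SIGMA[OF vcountable, of "\<lambda>_. UNIV :: 'v set"] vcountable by simp
  have "countable ({W :: 'v set. finite W \<and> W \<subseteq> UNIV} \<times> {H :: ('v \<times> 'v) set. finite H \<and> H \<subseteq> UNIV})"
    by (intro countable_SIGMA countable_Collect_finite_subset vcountable c2)
  moreover have "shapes A \<subseteq> {W. finite W \<and> W \<subseteq> UNIV} \<times> {H. finite H \<and> H \<subseteq> UNIV}"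
    by (auto simp: shapes_def)
  ultimately show ?thesis by (rule countable_subset[rotated])
qed

lemma disjoint_shape_event: "disjoint_family_on (\<lambda>p. shape_event (fst p) (snd p)) (shapes A)"
  unfolding disjoint_family_on_def
proof (intro ballI impI)
  fix p p' assume p: "p \<in> shapes A" "p' \<in> shapes A" "p \<noteq> p'"
  obtain W H W' H' where eq: "p = (W, H)" "p' = (W', H')" by (cases p, cases p')
  show "shape_event (fst p) (snd p) \<inter> shape_event (fst p') (snd p') = {}"
  proof (rule ccontr)
    assume "\<not> ?thesis"
    then obtain b where b: "b \<in> shape_event W H" "b \<in> shape_event W' H'" by (auto simp: eq)
    have W: "A \<subseteq> W" "A \<subseteq> W'" "Domain H \<subseteq> W" "Domain H' \<subseteq> W'" "W = A \<union> (\<Union>v\<in>A. H `` {v})" "W' = A \<union> (\<Union>v\<in>A. H' `` {v})"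
      using p(1,2) by (auto simp: shapes_def eq)
    have e1: "prd b u = H `` {u}" if "u \<in> W" for u using b(1) that by (simp add: shape_event_def)
    have e2: "prd b u = H' `` {u}" if "u \<in> W'" for u using b(2) that by (simp add: shape_event_def)
    have "H `` {v} = H' `` {v}" if "v \<in> A" for v
    proof -
      have "v \<in> W" "v \<in> W'" using that W(1,2) by auto
      then show ?thesis using e1 e2 by metis
    qed
    then have "(\<Union>v\<in>A. H `` {v}) = (\<Union>v\<in>A. H' `` {v})" by (intro SUP_cong refl)
    then have WW: "W = W'" using W(5,6) by simp
    have "(u, w) \<in> H \<longleftrightarrow> (u, w) \<in> H'" for u w
    proof (cases "u \<in> W")
      case True
      then have "H `` {u} = H' `` {u}" using e1[OF True] e2[of u] WW by simp
      then show ?thesis by blast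
    next
      case False
      then show ?thesis using W(3,4) WW by blast
    qed
    then have "H = H'" by (simp add: set_eq_iff split_paired_all)
    with WW p(3) eq show False by simp
  qed
qed

lemma sets_vals: "finite A \<Longrightarrow> {b. \<forall>v\<in>A. val b v (a v)} \<in> sets (bern \<rho>)"
proof -
  assume "finite A"
  moreover have "{b. \<forall>v\<in>A. val b v (a v)} = (\<Inter>v\<in>A. {b. val b v (a v)})" by auto
  ultimately have "fin_open {b. \<forall>v\<in>A. val b v (a v)}"
    by (simp only:) (intro fin_open_INT fin_open_locally[OF val_local])
  then show ?thesis by (rule fin_open_sets[OF countable_coords])
qed

text \<open>Sum over all extensions of \<open>a\<close> to \<open>W\<close>. For \<open>X\<close>
  their cylinders partition \<open>cyl (graph_of a A)\<close>; on the sampled side the corresponding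
  disjoint events are merely contained in the event on the right.\<close>

lemma val_lower_shape:
  assumes A: "finite A" and WH: "(W, H) \<in> shapes A"
  shows "emeasure (bern \<rho>) (shape_event W H) * emeasure M (cyl (graph_of a A)) \<le>
    emeasure (bern \<rho>) (shape_event W H \<inter> {b. \<forall>v\<in>A. val b v (a v)})"
proof -
  interpret O: prob_space "bern \<rho>" by (rule prob_space_bern)
  interpret M: prob_space M by (rule prob_M)
  have W: "finite W" "finite H" "A \<subseteq> W" "\<forall>u\<in>W. H `` {u} \<subseteq> W" using WH by (auto simp: shapes_def)
  \<comment> \<open>Extensional functions, so that each assignment on the finite set
    \<open>W\<close> occurs once and the sum is countable.\<close>
  define Xs where "Xs = {x \<in> PiE W (\<lambda>_. UNIV :: nat set). \<forall>v\<in>A. x v = a v}"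
  have "countable (PiE W (\<lambda>_. UNIV :: nat set))" using W(1) by (intro countable_PiE) auto
  then have cX: "countable Xs" by (rule countable_subset[rotated]) (auto simp: Xs_def)
  have dM: "disjoint_family_on (\<lambda>x. cyl (graph_of x W)) Xs"
    unfolding disjoint_family_on_def
  proof (intro ballI impI, rule ccontr)
    fix x y assume xy: "x \<in> Xs" "y \<in> Xs" "x \<noteq> y" "cyl (graph_of x W) \<inter> cyl (graph_of y W) \<noteq> {}"
    then obtain \<omega> where "\<omega> \<in> cyl (graph_of x W)" "\<omega> \<in> cyl (graph_of y W)" by blast
    then have "x u = y u" if "u \<in> W" for u using that by (auto simp: cyl_def graph_of_def)
    then have "x = y" using xy(1,2) unfolding Xs_def by (intro PiE_ext[of x W "\<lambda>_. UNIV" y]) auto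
    with xy(3) show False by simp
  qed
  have UM: "(\<Union>x\<in>Xs. cyl (graph_of x W)) = cyl (graph_of a A)"
  proof (intro equalityI subsetI)
    fix \<omega> assume "\<omega> \<in> (\<Union>x\<in>Xs. cyl (graph_of x W))"
    then show "\<omega> \<in> cyl (graph_of a A)" using W(3) by (auto simp: cyl_def graph_of_def Xs_def)
  next
    fix \<omega> assume w: "\<omega> \<in> cyl (graph_of a A)"
    let ?x = "restrict (\<lambda>v. X v \<omega>) W"
    have "?x \<in> Xs" using w W(3) by (auto simp: cyl_def graph_of_def Xs_def)
    moreover have "\<omega> \<in> cyl (graph_of ?x W)" using w by (auto simp: cyl_def graph_of_def)
    ultimately show "\<omega> \<in> (\<Union>x\<in>Xs. cyl (graph_of x W))" by blast
  qed
  have dO: "disjoint_family_on (\<lambda>x. shape_event W H \<inter> sample_event W H x) Xs"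
    unfolding disjoint_family_on_def
  proof (intro ballI impI, rule ccontr)
    fix x y assume xy: "x \<in> Xs" "y \<in> Xs" "x \<noteq> y" "(shape_event W H \<inter> sample_event W H x) \<inter> (shape_event W H \<inter> sample_event W H y) \<noteq> {}"
    then obtain b where "b \<in> shape_event W H \<inter> sample_event W H x" "b \<in> shape_event W H \<inter> sample_event W H y" by blast
    then have "consistent b W x" "consistent b W y" using consistent_shape_event_sample_event[OF WH] by blast+
    then have "x u = y u" if "u \<in> W" for u using that consistent_unique by blast
    then have "x = y" using xy(1,2) unfolding Xs_def by (intro PiE_ext[of x W "\<lambda>_. UNIV" y]) auto
    with xy(3) show False by simp
  qed
  have sO: "shape_event W H \<inter> sample_event W H x \<in> sets (bern \<rho>)" for x by (intro sets.Int sets_shape_event sets_sample_event W(1))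
  have sM: "cyl (graph_of x W) \<in> sets M" for x by (intro sets_cyl finite_graph_of W(1))
  have "emeasure (bern \<rho>) (shape_event W H) * emeasure M (cyl (graph_of a A)) =
    emeasure (bern \<rho>) (shape_event W H) * (\<integral>\<^sup>+x. emeasure M (cyl (graph_of x W)) \<partial>count_space Xs)"
    unfolding UM[symmetric] by (subst emeasure_UN_countable[OF sM cX dM]) simp
  also have "\<dots> = (\<integral>\<^sup>+x. emeasure (bern \<rho>) (shape_event W H) * emeasure M (cyl (graph_of x W)) \<partial>count_space Xs)"
    by (rule nn_integral_cmult[symmetric]) simp
  also have "\<dots> = (\<integral>\<^sup>+x. emeasure (bern \<rho>) (shape_event W H \<inter> sample_event W H x) \<partial>count_space Xs)"
    by (intro nn_integral_cong)
      (simp add: O.emeasure_eq_measure M.emeasure_eq_measure prob_shape_event_sample_event[OF W(1,2,4)] q_cyl ennreal_mult)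
  also have "\<dots> = emeasure (bern \<rho>) (\<Union>x\<in>Xs. shape_event W H \<inter> sample_event W H x)"
    by (rule emeasure_UN_countable[OF sO cX dO, symmetric])
  also have "\<dots> \<le> emeasure (bern \<rho>) (shape_event W H \<inter> {b. \<forall>v\<in>A. val b v (a v)})"
  proof (rule emeasure_mono)
    show "shape_event W H \<inter> {b. \<forall>v\<in>A. val b v (a v)} \<in> sets (bern \<rho>)"
      by (intro sets.Int sets_shape_event sets_vals A W(1))
    show "(\<Union>x\<in>Xs. shape_event W H \<inter> sample_event W H x) \<subseteq> shape_event W H \<inter> {b. \<forall>v\<in>A. val b v (a v)}"
    proof
      fix b assume "b \<in> (\<Union>x\<in>Xs. shape_event W H \<inter> sample_event W H x)"
      then obtain x where x: "x \<in> Xs" "b \<in> shape_event W H \<inter> sample_event W H x" by blast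
      have c: "consistent b W x" by (rule consistent_shape_event_sample_event[OF WH x(2)])
      have "val b v (a v)" if "v \<in> A" for v
        unfolding val_def using c that W(3) x(1) by (intro exI[of _ W] exI[of _ x]) (auto simp: Xs_def)
      then show "b \<in> shape_event W H \<inter> {b. \<forall>v\<in>A. val b v (a v)}" using x(2) by simp
    qed
  qed
  finally show ?thesis .
qed

text \<open>Almost every configuration has a shape over \<open>A\<close>, so the bounds for the
  countably many shapes add up. Only an inequality is available here, as it is not yet known that
  values exist almost surely.\<close>

lemma val_lower:
  assumes A: "finite A"
  shows "emeasure M (cyl (graph_of a A)) \<le> emeasure (bern \<rho>) {b. \<forall>v\<in>A. val b v (a v)}"
proof -
  interpret O: prob_space "bern \<rho>" by (rule prob_space_bern)
  let ?V = "{b. \<forall>v\<in>A. val b v (a v)}" and ?E = "\<lambda>p. shape_event (fst p) (snd p)"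
  have sE: "?E p \<in> sets (bern \<rho>)" if "p \<in> shapes A" for p
    using that by (intro sets_shape_event) (auto simp: shapes_def)
  note dE = disjoint_shape_event[of A]
  have dV: "disjoint_family_on (\<lambda>p. ?E p \<inter> ?V) (shapes A)"
    by (rule disjoint_family_on_bisimulation[OF dE]) auto
  have AEU: "AE b in bern \<rho>. b \<in> (\<Union>p\<in>shapes A. ?E p)"
    using AE_dom
  proof eventually_elim
    case (elim b)
    let ?W = "A \<union> (\<Union>v\<in>A. prd b v)"
    let ?H = "Sigma ?W (prd b)"
    have H: "?H `` {u} = prd b u" if "u \<in> ?W" for u using that by auto
    have fW: "finite ?W" using A finite_prd by simp
    have "(?W, ?H) \<in> shapes A"
      unfolding shapes_def mem_Collect_eq prod.case
    proof (intro conjI ballI)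
      show "finite ?H" using fW finite_prd by (intro finite_SigmaI) auto
      show "?H `` {u} \<subseteq> ?W" if "u \<in> ?W" for u
        unfolding H[OF that] using that prd_trans by blast
      have "(\<Union>v\<in>A. ?H `` {v}) = (\<Union>v\<in>A. prd b v)" by (intro SUP_cong refl H) simp
      then show "?W = A \<union> (\<Union>v\<in>A. ?H `` {v})" by simp
    qed (use fW in auto)
    moreover have "b \<in> shape_event ?W ?H" unfolding shape_event_def using elim H by simp
    ultimately show ?case by (intro UN_I[of "(?W, ?H)"]) simp_all
  qed
  have "emeasure M (cyl (graph_of a A)) = emeasure (bern \<rho>) (\<Union>p\<in>shapes A. ?E p) * emeasure M (cyl (graph_of a A))"
  proof -
    have "(\<Union>p\<in>shapes A. ?E p) \<in> sets (bern \<rho>)"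
      by (intro sets.countable_UN'' countable_shapes sE)
    from O.emeasure_eq_1_AE[OF this AEU] show ?thesis by simp
  qed
  also have "\<dots> = (\<integral>\<^sup>+p. emeasure (bern \<rho>) (?E p) \<partial>count_space (shapes A)) * emeasure M (cyl (graph_of a A))"
    by (subst emeasure_UN_countable[OF sE countable_shapes dE]) simp_all
  also have "\<dots> = (\<integral>\<^sup>+p. emeasure (bern \<rho>) (?E p) * emeasure M (cyl (graph_of a A)) \<partial>count_space (shapes A))"
    by (rule nn_integral_multc[symmetric]) simp
  also have "\<dots> \<le> (\<integral>\<^sup>+p. emeasure (bern \<rho>) (?E p \<inter> ?V) \<partial>count_space (shapes A))"
    by (intro nn_integral_mono) (use val_lower_shape[OF A] in \<open>simp add: split_paired_all\<close>)
  also have "\<dots> = emeasure (bern \<rho>) (\<Union>p\<in>shapes A. ?E p \<inter> ?V)"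
    by (rule emeasure_UN_countable[OF _ countable_shapes dV, symmetric]) (intro sets.Int sE sets_vals A)
  also have "\<dots> \<le> emeasure (bern \<rho>) ?V"
    by (rule emeasure_mono) (use sets_vals[OF A] in auto)
  finally show ?thesis .
qed

text \<open>The lower bounds for the single values at \<open>v\<close> already sum to 1. Hence the
  tosses succeed almost surely, without a separate analysis of null patterns.\<close>

lemma AE_val: "AE b in bern \<rho>. \<forall>v. \<exists>s. val b v s"
proof (rule AE_all_vertices)
  fix v
  interpret O: prob_space "bern \<rho>" by (rule prob_space_bern)
  interpret M: prob_space M by (rule prob_M)
  let ?V = "\<lambda>s. {b. val b v s}"
  have le: "q {(v, s)} \<le> O.prob (?V s)" for s
    using val_lower[of "{v}" "\<lambda>_. s"] by (simp add: graph_of_def q_cyl O.emeasure_eq_measure M.emeasure_eq_measure)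
  have "disjoint_family ?V" using val_unique by (auto simp: disjoint_family_on_def)
  then have S: "(\<lambda>s. O.prob (?V s)) sums O.prob (\<Union>s. ?V s)"
    using sets_val by (intro O.finite_measure_UNION) auto
  have "(\<lambda>s. q {(v, s)}) sums 1" using q_sums[of "{}" v] q_empty by simp
  with le have "1 \<le> O.prob (\<Union>s. ?V s)" using S by (rule sums_le)
  then have "O.prob (\<Union>s. ?V s) = 1" using O.prob_le_1[of "\<Union>s. ?V s"] by linarith
  then have "AE b in bern \<rho>. b \<in> (\<Union>s. ?V s)" by (rule O.AE_prob_1)
  then show "AE b in bern \<rho>. \<exists>s. val b v s" by eventually_elim auto
qed

text \<open>The default 0 is the same at every vertex, which keeps the map equivariant at every
  configuration and not just at almost every one.\<close>

definition factor :: "('v \<times> nat \<Rightarrow> bool) \<Rightarrow> 'v \<Rightarrow> nat" where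
  "factor b v = (if \<exists>s. val b v s then THE s. val b v s else 0)"

lemma factor_eq: "val b v s \<Longrightarrow> factor b v = s"
  unfolding factor_def using val_unique by (auto intro!: the_equality)

lemma factor_aut: "\<gamma> \<in> \<Gamma> \<Longrightarrow> factor (\<lambda>p. b (\<gamma> (fst p), snd p)) v = factor b (\<gamma> v)"
proof -
  assume "\<gamma> \<in> \<Gamma>"
  then have "val (\<lambda>p. b (\<gamma> (fst p), snd p)) v = val b (\<gamma> v)" by (intro ext val_aut)
  then show ?thesis unfolding factor_def by (simp only:)
qed

lemma measurable_factor: "(\<lambda>b. factor b v) \<in> measurable (bern \<rho>) (count_space UNIV)"
proof (subst measurable_count_space_eq2_countable, intro conjI ballI)
  fix s
  have sN: "{b. \<exists>s. val b v s} \<in> sets (bern \<rho>)"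
  proof -
    have "{b. \<exists>s. val b v s} = (\<Union>s. {b. val b v s})" by auto
    then show ?thesis using sets_val by (simp only:) (intro sets.countable_UN, auto)
  qed
  have "(\<lambda>b. factor b v) -` {s} \<inter> space (bern \<rho>) = {b. val b v s} \<union> (if s = 0 then space (bern \<rho>) - {b. \<exists>s. val b v s} else {})"
  proof -
    have "factor b v = s \<longleftrightarrow> val b v s \<or> s = 0 \<and> \<not> (\<exists>s. val b v s)" for b
    proof (cases "\<exists>s. val b v s")
      case True
      then obtain t where t: "val b v t" by blast
      then show ?thesis using factor_eq[OF t] val_unique[OF t] by metis
    qed (auto simp: factor_def)
    then have "{b. factor b v = s} = {b. val b v s \<or> s = 0 \<and> \<not> (\<exists>s. val b v s)}" by (simp only:)
    moreover have "(\<lambda>b. factor b v) -` {s} \<inter> space (bern \<rho>) = {b. factor b v = s}" by auto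
    ultimately show ?thesis by (simp only:) auto
  qed
  then show "(\<lambda>b. factor b v) -` {s} \<inter> space (bern \<rho>) \<in> sets (bern \<rho>)"
    using sets_val sN sets.compl_sets[OF sN] by auto
qed auto

text \<open>Finite-dimensional marginals determine the law. On a finite \<open>J\<close> there are
  countably many assignments, so the lower bounds of \<open>val_lower\<close> for single assignments
  identify the marginal.\<close>

lemma law_factor:
  "distr (bern \<rho>) (PiM UNIV (\<lambda>_. count_space UNIV)) factor = distr M (PiM UNIV (\<lambda>_. count_space UNIV)) (\<lambda>\<omega> v. X v \<omega>)"
proof -
  interpret O: prob_space "bern \<rho>" by (rule prob_space_bern)
  interpret M: prob_space M by (rule prob_M)
  let ?P = "PiM (UNIV :: 'v set) (\<lambda>_. count_space (UNIV :: nat set))"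
  have mf: "factor \<in> measurable (bern \<rho>) ?P"
    by (rule measurable_PiM_single') (auto intro: measurable_factor)
  have mX: "(\<lambda>\<omega> v. X v \<omega>) \<in> measurable M ?P"
    by (rule measurable_PiM_single') (auto intro: rv)
  show ?thesis
  proof (rule measure_eqI_PiM_infinite)
    show "finite_measure (distr (bern \<rho>) ?P factor)"
      using O.prob_space_distr[OF mf] by (simp add: prob_space_def)
    fix A :: "'v \<Rightarrow> nat set" and J :: "'v set" assume J: "finite J"
    let ?C = "PiE J (\<lambda>_. UNIV :: nat set)"
    have cC: "countable ?C" using J by (intro countable_PiE) auto
    have r1: "(\<lambda>b. restrict (factor b) J) \<in> measurable (bern \<rho>) (count_space ?C)"
    proof (subst measurable_count_space_eq_countable[OF cC], intro conjI ballI)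
      fix x assume x: "x \<in> ?C"
      have "(\<lambda>b. restrict (factor b) J) -` {x} \<inter> space (bern \<rho>) = {b\<in>space (bern \<rho>). \<forall>j\<in>J. factor b j = x j}"
        using x by (auto simp: fun_eq_iff PiE_def extensional_def restrict_def)
      also have "\<dots> \<in> sets (bern \<rho>)"
      proof (rule sets.sets_Collect_finite_All[OF _ J])
        fix j show "{b\<in>space (bern \<rho>). factor b j = x j} \<in> sets (bern \<rho>)"
          using measurable_sets[OF measurable_factor[of j], of "{x j}"] by (simp add: vimage_def Int_def)
      qed
      finally show "(\<lambda>b. restrict (factor b) J) -` {x} \<inter> space (bern \<rho>) \<in> sets (bern \<rho>)" .
    qed auto
    have r2: "(\<lambda>\<omega>. \<lambda>v\<in>J. X v \<omega>) \<in> measurable M (count_space ?C)"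
    proof (subst measurable_count_space_eq_countable[OF cC], intro conjI ballI)
      fix x assume x: "x \<in> ?C"
      have "(\<lambda>\<omega>. \<lambda>v\<in>J. X v \<omega>) -` {x} \<inter> space M = cyl (graph_of x J)"
        using x by (auto simp: fun_eq_iff PiE_def extensional_def restrict_def cyl_def graph_of_def)
      then show "(\<lambda>\<omega>. \<lambda>v\<in>J. X v \<omega>) -` {x} \<inter> space M \<in> sets M" using J by (simp add: sets_cyl)
    qed auto
    have eq: "distr M (count_space ?C) (\<lambda>\<omega>. \<lambda>v\<in>J. X v \<omega>) = distr (bern \<rho>) (count_space ?C) (\<lambda>b. restrict (factor b) J)"
    proof (rule prob_measure_eqI_le[OF _ _ _ _ cC])
      show "prob_space (distr M (count_space ?C) (\<lambda>\<omega>. \<lambda>v\<in>J. X v \<omega>))" by (rule M.prob_space_distr[OF r2])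
      show "prob_space (distr (bern \<rho>) (count_space ?C) (\<lambda>b. restrict (factor b) J))" by (rule O.prob_space_distr[OF r1])
      fix x assume x: "x \<in> ?C"
      have "emeasure (distr M (count_space ?C) (\<lambda>\<omega>. \<lambda>v\<in>J. X v \<omega>)) {x} = emeasure M (cyl (graph_of x J))"
        using x by (subst emeasure_distr[OF r2])
          (auto simp: fun_eq_iff PiE_def extensional_def restrict_def cyl_def graph_of_def intro!: arg_cong[of _ _ "emeasure M"])
      also have "\<dots> \<le> emeasure (bern \<rho>) {b. \<forall>v\<in>J. val b v (x v)}" by (rule val_lower[OF J])
      also have "\<dots> \<le> emeasure (distr (bern \<rho>) (count_space ?C) (\<lambda>b. restrict (factor b) J)) {x}"
      proof (subst emeasure_distr[OF r1])
        show "{x} \<in> sets (count_space ?C)" using x by simp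
        show "emeasure (bern \<rho>) {b. \<forall>v\<in>J. val b v (x v)} \<le> emeasure (bern \<rho>) ((\<lambda>b. restrict (factor b) J) -` {x} \<inter> space (bern \<rho>))"
        proof (rule emeasure_mono)
          show "(\<lambda>b. restrict (factor b) J) -` {x} \<inter> space (bern \<rho>) \<in> sets (bern \<rho>)"
            using measurable_sets[OF r1, of "{x}"] x by simp
          show "{b. \<forall>v\<in>J. val b v (x v)} \<subseteq> (\<lambda>b. restrict (factor b) J) -` {x} \<inter> space (bern \<rho>)"
            using x factor_eq by (auto simp: fun_eq_iff PiE_def extensional_def restrict_def)
        qed
      qed
      finally show "emeasure (distr M (count_space ?C) (\<lambda>\<omega>. \<lambda>v\<in>J. X v \<omega>)) {x} \<le>
        emeasure (distr (bern \<rho>) (count_space ?C) (\<lambda>b. restrict (factor b) J)) {x}" .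
    qed auto
    let ?B = "prod_emb UNIV (\<lambda>_. count_space (UNIV :: nat set)) J (PiE J A)"
    have B: "?B = {f. \<forall>j\<in>J. f j \<in> A j}"
      by (auto simp: prod_emb_def PiE_iff restrict_def extensional_def)
    have BS: "?B \<in> sets ?P" using J by (intro sets_PiM_I) auto
    have AC: "PiE J A \<subseteq> ?C" by (intro PiE_mono) auto
    have "emeasure (distr (bern \<rho>) ?P factor) ?B = emeasure (bern \<rho>) {b. \<forall>j\<in>J. factor b j \<in> A j}"
      unfolding emeasure_distr[OF mf BS] by (simp add: B vimage_def)
    also have "\<dots> = emeasure (distr (bern \<rho>) (count_space ?C) (\<lambda>b. restrict (factor b) J)) (PiE J A)"
      by (subst emeasure_distr[OF r1]) (use AC in \<open>auto simp: vimage_def PiE_iff\<close>)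
    also have "\<dots> = emeasure M {\<omega>\<in>space M. \<forall>j\<in>J. X j \<omega> \<in> A j}"
      unfolding eq[symmetric]
      by (subst emeasure_distr[OF r2]) (use AC in \<open>auto simp: PiE_iff intro!: arg_cong[of _ _ "emeasure M"]\<close>)
    also have "\<dots> = emeasure (distr M ?P (\<lambda>\<omega> v. X v \<omega>)) ?B"
      unfolding emeasure_distr[OF mX BS] by (simp add: B vimage_def Int_def conj_commute)
    finally show "emeasure (distr (bern \<rho>) ?P factor) ?B = emeasure (distr M ?P (\<lambda>\<omega> v. X v \<omega>)) ?B" .
  qed simp_all
qed

end

section \<open>The finitary coding\<close>

definition bit_alphabet :: "nat \<Rightarrow> nat set" where
  "bit_alphabet i = {0, 1}"

definition encode :: "('v \<times> nat \<Rightarrow> bool) \<Rightarrow> 'v \<Rightarrow> nat \<Rightarrow> nat" where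
  "encode b v i = (if b (v, i) then 1 else 0)"

text \<open>Total also on letters outside the alphabet: anything but 1 is read as
  \<open>False\<close>.\<close>

definition decode :: "('v \<Rightarrow> nat \<Rightarrow> nat) \<Rightarrow> 'v \<times> nat \<Rightarrow> bool" where
  "decode y p \<longleftrightarrow> y (fst p) (snd p) = 1"

lemma decode_encode[simp]: "decode (encode b) = b"
  by (rule ext) (simp add: decode_def encode_def)

lemma measurable_encode_coord:
  assumes "\<And>i. (\<lambda>b. g b i) \<in> measurable N (count_space UNIV)"
  shows "(\<lambda>b i. if g b i then 1 else 0) \<in> measurable N (prod_space bit_alphabet)"
  unfolding prod_space_def
proof (rule measurable_PiM_single')
  fix i
  have "(\<lambda>t. if t then 1 else 0) \<in> measurable (count_space UNIV) (count_space (bit_alphabet i))"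
    by (simp add: bit_alphabet_def)
  from measurable_compose[OF assms this]
  show "(\<lambda>b. if g b i then 1 else 0) \<in> measurable N (count_space (bit_alphabet i))" .
qed (auto simp: bit_alphabet_def PiE_UNIV_domain)

lemma measurable_bern_coord: "(\<lambda>b. b k) \<in> measurable (bern \<rho>) (count_space UNIV)"
proof (rule measurableI)
  fix A :: "bool set"
  have "(\<lambda>b. b k) -` A \<inter> space (bern \<rho>) = (\<Union>c\<in>A. {b. b k = c})" by auto
  also have "\<dots> \<in> sets (bern \<rho>)" by (intro sets.finite_UN finite sets_bern_coord)
  finally show "(\<lambda>b. b k) -` A \<inter> space (bern \<rho>) \<in> sets (bern \<rho>)" .
qed simp

lemma measurable_enc1: "(\<lambda>b. encode b v) \<in> measurable (bern \<rho>) (prod_space bit_alphabet)"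
  unfolding encode_def[abs_def] by (rule measurable_encode_coord[OF measurable_bern_coord])

lemma measurable_encode: "encode \<in> measurable (bern \<rho>) (PiM UNIV (\<lambda>_. prod_space bit_alphabet))"
proof (rule measurable_PiM_single')
  show "(\<lambda>b. encode b v) \<in> measurable (bern \<rho>) (prod_space bit_alphabet)" for v by (rule measurable_enc1)
  show "encode \<in> space (bern \<rho>) \<rightarrow> (\<Pi>\<^sub>E i\<in>UNIV. space (prod_space bit_alphabet))"
    using measurable_space[OF measurable_enc1[of _ \<rho>]] by auto
qed

lemma measurable_decode: "decode \<in> measurable (PiM UNIV (\<lambda>_. prod_space bit_alphabet)) (bern \<rho>)"
  unfolding bern_def
proof (rule measurable_PiM_single')
  fix p :: "'a \<times> nat"
  have "(\<lambda>y. y (fst p)) \<in> measurable (PiM UNIV (\<lambda>_. prod_space bit_alphabet)) (prod_space bit_alphabet)"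
    by (rule measurable_component_singleton) simp
  moreover have "(\<lambda>z. z (snd p)) \<in> measurable (prod_space bit_alphabet) (count_space (bit_alphabet (snd p)))"
    unfolding prod_space_def by (rule measurable_component_singleton) simp
  ultimately have "(\<lambda>y. y (fst p) (snd p)) \<in> measurable (PiM UNIV (\<lambda>_. prod_space bit_alphabet)) (count_space (bit_alphabet (snd p)))"
    by (rule measurable_compose)
  moreover have "(\<lambda>z. z = 1) \<in> measurable (count_space (bit_alphabet (snd p))) (measure_pmf (bernoulli_pmf (\<rho> p)))"
    by (simp add: measurable_count_space_eq1)
  ultimately have "(\<lambda>y. y (fst p) (snd p) = 1) \<in> measurable (PiM UNIV (\<lambda>_. prod_space bit_alphabet)) (measure_pmf (bernoulli_pmf (\<rho> p)))"
    by (rule measurable_compose)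
  then show "(\<lambda>y. decode y p) \<in> measurable (PiM UNIV (\<lambda>_. prod_space bit_alphabet)) (measure_pmf (bernoulli_pmf (\<rho> p)))"
    by (simp add: decode_def)
qed simp

definition bit_field :: "('v \<times> nat \<Rightarrow> real) \<Rightarrow> ('v \<Rightarrow> nat \<Rightarrow> nat) measure" where
  "bit_field \<rho> = distr (bern \<rho>) (PiM UNIV (\<lambda>_. prod_space bit_alphabet)) encode"

text \<open>Grouping independent bits by vertex preserves independence, and the groups are
  identically distributed because the bias depends on the index alone.\<close>

lemma iid_bit_field:
  fixes \<rho> :: "'v \<times> nat \<Rightarrow> real"
  assumes \<rho>: "\<And>v i. \<rho> (v, i) = \<rho>0 i"
  shows "iid_process (bit_field \<rho>) (prod_space bit_alphabet) (\<lambda>v y. y v)"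
proof -
  interpret O: prob_space "bern \<rho>" by (rule prob_space_bern)
  let ?D = "prod_space bit_alphabet" and ?B = "\<lambda>i. measure_pmf (bernoulli_pmf (\<rho> i))"
  interpret N: prob_space "bit_field \<rho>" unfolding bit_field_def by (rule O.prob_space_distr[OF measurable_encode])
  have comp: "(\<lambda>y. y v) \<in> measurable (bit_field \<rho>) ?D" for v
    unfolding bit_field_def measurable_distr_eq1 by (rule measurable_component_singleton) simp
  have law1: "distr (bit_field \<rho>) ?D (\<lambda>y. y v) = distr (bern \<rho>) ?D (\<lambda>b. encode b v)" for v
    unfolding bit_field_def
    by (subst distr_distr[OF _ measurable_encode]) (auto simp: comp_def intro: measurable_component_singleton)
  have ind: "O.indep_vars (\<lambda>v. PiM ({v} \<times> UNIV) ?B) (\<lambda>v b. restrict (\<lambda>p. b p) ({v} \<times> UNIV)) UNIV"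
    by (rule O.indep_vars_restrict[OF indep_vars_bern]) (auto simp: disjoint_family_on_def)
  have m: "(\<lambda>c i. if c (v, i) then 1 else 0) \<in> measurable (PiM ({v} \<times> UNIV) ?B) ?D" for v
  proof (rule measurable_encode_coord)
    fix i show "(\<lambda>c. c (v, i)) \<in> measurable (PiM ({v} \<times> UNIV) ?B) (count_space UNIV)"
      using measurable_component_singleton[of "(v, i)" "{v} \<times> UNIV" ?B] by simp
  qed
  have "O.indep_vars (\<lambda>_. ?D) (\<lambda>v b. (\<lambda>c i. if c (v, i) then 1 else 0) (restrict (\<lambda>p. b p) ({v} \<times> UNIV))) UNIV"
    by (rule O.indep_vars_compose2[OF ind m])
  moreover have "(\<lambda>c i. if c (v, i) then 1 else 0) (restrict (\<lambda>p. b p) ({v} \<times> UNIV)) = encode b v" for b and v :: 'v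
    by (rule ext) (simp add: encode_def)
  ultimately have "O.indep_vars (\<lambda>_. ?D) (\<lambda>v b. encode b v) UNIV" by (simp only:)
  then have N_eq: "bit_field \<rho> = PiM UNIV (\<lambda>v. distr (bern \<rho>) ?D (\<lambda>b. encode b v))"
    using O.indep_vars_iff_distr_eq_PiM'[where I = UNIV and M' = "\<lambda>_. ?D" and X = "\<lambda>v b. encode b v", OF UNIV_not_empty measurable_enc1]
    by (simp add: bit_field_def restrict_UNIV)
  have "distr (bit_field \<rho>) (PiM UNIV (\<lambda>_. ?D)) (\<lambda>y. y) = bit_field \<rho>"
    by (rule distr_id2) (simp add: bit_field_def)
  then have "distr (bit_field \<rho>) (PiM UNIV (\<lambda>_. ?D)) (\<lambda>y. y) = PiM UNIV (\<lambda>v. distr (bit_field \<rho>) ?D (\<lambda>y. y v))"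
    unfolding law1 N_eq[symmetric] .
  then have indN: "N.indep_vars (\<lambda>_. ?D) (\<lambda>v y. y v) UNIV"
    using N.indep_vars_iff_distr_eq_PiM'[where I = UNIV and M' = "\<lambda>_. ?D" and X = "\<lambda>v y. y v", OF UNIV_not_empty comp]
    by (simp add: restrict_UNIV)
  have "distr (bern \<rho>) ?D (\<lambda>b. encode b v) =
    distr (PiM UNIV (\<lambda>i. measure_pmf (bernoulli_pmf (\<rho>0 i)))) ?D (\<lambda>c i. if c i then 1 else 0)" for v
  proof -
    let ?P = "PiM UNIV (\<lambda>i. measure_pmf (bernoulli_pmf (\<rho>0 i)))"
    have "?P = distr (bern \<rho>) ?P (\<lambda>b. \<lambda>i\<in>UNIV. b (v, i))"
      unfolding bern_def using distr_PiM_reindex[of UNIV ?B "\<lambda>i. (v, i)" UNIV] \<rho>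
      by (simp add: measure_pmf.prob_space_axioms inj_on_def)
    then have P: "?P = distr (bern \<rho>) ?P (\<lambda>b i. b (v, i))" by (simp add: restrict_UNIV)
    have m1: "(\<lambda>b i. b (v, i)) \<in> measurable (bern \<rho>) ?P"
      by (rule measurable_PiM_single') (use measurable_bern_coord in auto)
    have m2: "(\<lambda>c i. if c i then 1 else 0) \<in> measurable ?P ?D"
    proof (rule measurable_encode_coord)
      fix i show "(\<lambda>c. c i) \<in> measurable ?P (count_space UNIV)"
        using measurable_component_singleton[of i UNIV "\<lambda>i. measure_pmf (bernoulli_pmf (\<rho>0 i))"] by simp
    qed
    have "distr ?P ?D (\<lambda>c i. if c i then 1 else 0) = distr (bern \<rho>) ?D ((\<lambda>c i. if c i then 1 else 0) \<circ> (\<lambda>b i. b (v, i)))"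
      by (subst P) (rule distr_distr[OF m2 m1])
    also have "(\<lambda>c i. if c i then 1 else 0) \<circ> (\<lambda>b i. b (v, i)) = (\<lambda>b. encode b v)"
      by (intro ext) (simp add: encode_def)
    finally show ?thesis by simp
  qed
  then have "distr (bit_field \<rho>) ?D (\<lambda>y. y u) = distr (bit_field \<rho>) ?D (\<lambda>y. y v)" for u v
    unfolding law1 by (simp only:)
  then show ?thesis
    unfolding iid_process_def random_field_def using indN comp N.prob_space_axioms by blast
qed

context sampler begin

lemma sets_ex_val: "{b. \<exists>s. val b v s} \<in> sets (bern \<rho>)"
proof -
  have "{b. \<exists>s. val b v s} = (\<Union>s. {b. val b v s})" by auto
  then show ?thesis using sets_val by (simp only:) (intro sets.countable_UN, auto)
qed

lemma factor_local:
  assumes "val b v s" shows "locally_at E v b (\<lambda>b'. factor b' v = factor b v)"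
  unfolding factor_eq[OF assms] by (rule locally_mono[OF val_local[OF assms] factor_eq])

text \<open>Finiteness of the coding radius is \<open>AE_val\<close> combined with
  \<open>factor_local\<close>: where a value exists, a finite window determines it. The rest
  translates letters into bits and natural numbers back into \<open>S\<close>.\<close>

lemma finitary_factor_factor:
  fixes S :: "'s set" and X0 :: "'v \<Rightarrow> 'w \<Rightarrow> 's"
  assumes S: "countable S" and X0: "random_field M (count_space S) X0"
    and X: "\<And>v \<omega>. X v \<omega> = to_nat_on S (X0 v \<omega>)" and \<rho>: "\<And>v i. \<rho> (v, i) = \<rho>0 i"
  shows "finitary_factor_of_iid E \<Gamma> o' M S X0"
proof -
  interpret O: prob_space "bern \<rho>" by (rule prob_space_bern)
  interpret M: prob_space M by (rule prob_M)
  let ?D = "prod_space bit_alphabet" and ?N = "bit_field \<rho>"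
  let ?PD = "PiM (UNIV :: 'v set) (\<lambda>_. ?D)" and ?PS = "PiM (UNIV :: 'v set) (\<lambda>_. count_space S)"
  let ?PN = "PiM (UNIV :: 'v set) (\<lambda>_. count_space (UNIV :: nat set))"
  have mX0: "X0 v \<in> measurable M (count_space S)" for v using X0 by (simp add: random_field_def)
  have X0S: "X0 v \<omega> \<in> S" if "\<omega> \<in> space M" for v \<omega> using measurable_space[OF mX0 that] by simp
  have neS: "S \<noteq> {}" using X0S M.not_empty by blast
  define \<phi> where "\<phi> y v = from_nat_into S (factor (decode y) v)" for y v
  have mf: "factor \<in> measurable (bern \<rho>) ?PN"
    by (rule measurable_PiM_single') (auto intro: measurable_factor)
  define g where "g f v = from_nat_into S (f v)" for f :: "'v \<Rightarrow> nat" and v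
  have mg: "g \<in> measurable ?PN ?PS"
  proof (rule measurable_PiM_single')
    fix v
    have "(\<lambda>f. f v) \<in> measurable ?PN (count_space UNIV)" by (rule measurable_component_singleton) simp
    moreover have "from_nat_into S \<in> measurable (count_space UNIV) (count_space S)"
      using from_nat_into[OF neS] by simp
    ultimately show "(\<lambda>f. g f v) \<in> measurable ?PN (count_space S)"
      unfolding g_def by (rule measurable_compose)
  qed (use from_nat_into[OF neS] in \<open>auto simp: g_def PiE_UNIV_domain\<close>)
  have \<phi>_eq: "\<phi> = (\<lambda>y. g (factor (decode y)))" by (intro ext) (simp add: \<phi>_def g_def)
  have m\<phi>: "\<phi> \<in> measurable ?PD ?PS"
    unfolding \<phi>_eq by (rule measurable_compose[OF measurable_compose[OF measurable_decode mf] mg])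
  have equi: "\<phi> (\<lambda>v. y (\<gamma> v)) = (\<lambda>v. \<phi> y (\<gamma> v))" if "\<gamma> \<in> \<Gamma>" for \<gamma> y
  proof
    fix v
    have "decode (\<lambda>v. y (\<gamma> v)) = (\<lambda>p. decode y (\<gamma> (fst p), snd p))" by (rule ext) (simp add: decode_def)
    then show "\<phi> (\<lambda>v. y (\<gamma> v)) v = \<phi> y (\<gamma> v)" unfolding \<phi>_def by (simp only: factor_aut[OF that])
  qed
  have mXX: "(\<lambda>\<omega> v. X v \<omega>) \<in> measurable M ?PN"
    by (rule measurable_PiM_single') (auto intro: rv)
  have mNPS: "\<phi> \<in> measurable ?N ?PS" using m\<phi> by (simp add: bit_field_def)
  have "field_law ?N (count_space S) (\<lambda>v \<omega>. \<phi> (\<lambda>u. \<omega> u) v) = distr ?N ?PS \<phi>"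
    by (simp add: field_law_def)
  also have "\<dots> = distr (bern \<rho>) ?PS (\<phi> \<circ> encode)"
    unfolding bit_field_def by (rule distr_distr[OF m\<phi> measurable_encode])
  also have "\<phi> \<circ> encode = g \<circ> factor" by (intro ext) (simp add: \<phi>_eq)
  also have "distr (bern \<rho>) ?PS (g \<circ> factor) = distr (distr (bern \<rho>) ?PN factor) ?PS g"
    by (rule distr_distr[OF mg mf, symmetric])
  also have "\<dots> = distr (distr M ?PN (\<lambda>\<omega> v. X v \<omega>)) ?PS g" unfolding law_factor by (rule refl)
  also have "\<dots> = distr M ?PS (g \<circ> (\<lambda>\<omega> v. X v \<omega>))" by (rule distr_distr[OF mg mXX])
  also have "\<dots> = distr M ?PS (\<lambda>\<omega> v. X0 v \<omega>)"
    by (rule distr_cong) (simp_all add: g_def X fun_eq_iff S X0S)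
  also have "\<dots> = field_law M (count_space S) X0" by (simp add: field_law_def)
  finally have law: "field_law ?N (count_space S) (\<lambda>v \<omega>. \<phi> (\<lambda>u. \<omega> u) v) = field_law M (count_space S) X0" .
  have "coding \<Gamma> ?N ?D (\<lambda>v y. y v) M (count_space S) X0 \<phi>"
    unfolding coding_def using m\<phi> equi law by simp
  moreover have "AE y in ?N. coding_radius_prod E o' bit_alphabet \<phi> (\<lambda>v. y v) < \<infinity>"
  proof -
    have "AE y in ?N. \<exists>s. val (decode y) o' s"
      unfolding bit_field_def
    proof (subst AE_distr_iff[OF measurable_encode])
      show "{y \<in> space ?PD. \<exists>s. val (decode y) o' s} \<in> sets ?PD"
        using measurable_sets[OF measurable_decode sets_ex_val[of o']] by (simp add: vimage_def Int_def conj_commute)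
      show "AE b in bern \<rho>. \<exists>s. val (decode (encode b)) o' s" using AE_val by eventually_elim simp
    qed
    then show ?thesis
    proof eventually_elim
      case (elim y)
      then obtain s where "val (decode y) o' s" by blast
      from factor_local[OF this] obtain r where r: "\<And>b'. agree E o' r (decode y) b' \<Longrightarrow> factor b' o' = factor (decode y) o'"
        by (auto simp: locally_at_def)
      let ?R = "{r. \<exists>n. \<forall>y'. (\<forall>v i. y' v i \<in> bit_alphabet i) \<and>
        (\<forall>v i. graph_dist E v o' \<le> enat r \<and> i < n \<longrightarrow> y' v i = y v i) \<longrightarrow> \<phi> y' o' = \<phi> y o'}"
      have "r \<in> ?R"
      \<comment> \<open>The same \<open>r\<close> serves as radius and as the number of letter
        components read at each vertex.\<close>
      proof (intro CollectI exI[of _ r] allI impI)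
        fix y' assume "(\<forall>v i. y' v i \<in> bit_alphabet i) \<and> (\<forall>v i. graph_dist E v o' \<le> enat r \<and> i < r \<longrightarrow> y' v i = y v i)"
        then have "agree E o' r (decode y) (decode y')" by (simp add: agree_def decode_def graph_dist_le_iff)
        then show "\<phi> y' o' = \<phi> y o'" unfolding \<phi>_def by (simp only: r)
      qed
      then have "coding_radius_prod E o' bit_alphabet \<phi> y \<le> enat r"
        unfolding coding_radius_prod_def by (rule INF_lower)
      then show ?case by (rule le_less_trans) simp
    qed
  qed
  ultimately have "finitary_factor_prod E \<Gamma> o' ?N bit_alphabet (\<lambda>v y. y v) M S X0"
    unfolding finitary_factor_prod_def by blast
  moreover have "iid_process ?N ?D (\<lambda>v y. y v)" by (rule iid_bit_field[of \<rho> \<rho>0]) (rule \<rho>)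
  moreover have "\<forall>i. finite (bit_alphabet i)" by (simp add: bit_alphabet_def)
  ultimately show ?thesis unfolding finitary_factor_of_iid_def by blast
qed

end

section \<open>Main theorem\<close>

lemma measure_field_law:
  assumes "\<And>v. X v \<in> measurable M D" "B \<in> sets (PiM UNIV (\<lambda>_. D))"
  shows "measure (field_law M D X) B = measure M {\<omega>\<in>space M. (\<lambda>v. X v \<omega>) \<in> B}"
proof -
  have "(\<lambda>\<omega> v. X v \<omega>) \<in> measurable M (PiM UNIV (\<lambda>_. D))"
  proof (rule measurable_PiM_single')
    show "(\<lambda>\<omega> v. X v \<omega>) \<in> space M \<rightarrow> (\<Pi>\<^sub>E v\<in>UNIV. space D)"
      using measurable_space[OF assms(1)] by auto
  qed (rule assms(1))
  then show ?thesis
    unfolding field_law_def by (subst measure_distr[OF _ assms(2)]) (auto simp: vimage_def Int_def conj_commute)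
qed

lemma sets_coordinates:
  assumes "finite P" "fst ` P \<subseteq> U"
  shows "{f\<in>space (PiM U (\<lambda>_. count_space S)). \<forall>p\<in>P. h (f (fst p)) = snd p} \<in> sets (PiM U (\<lambda>_. count_space S))"
proof (rule sets.sets_Collect_finite_All)
  fix p assume "p \<in> P"
  then have "fst p \<in> U" using assms(2) by auto
  then have "(\<lambda>f. f (fst p)) \<in> measurable (PiM U (\<lambda>_. count_space S)) (count_space S)"
    by (rule measurable_component_singleton)
  from measurable_sets[OF this, of "{s\<in>S. h s = snd p}"]
  have "(\<lambda>f. f (fst p)) -` {s\<in>S. h s = snd p} \<inter> space (PiM U (\<lambda>_. count_space S)) \<in> sets (PiM U (\<lambda>_. count_space S))"
    by simp
  also have "(\<lambda>f. f (fst p)) -` {s\<in>S. h s = snd p} \<inter> space (PiM U (\<lambda>_. count_space S)) =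
    {f\<in>space (PiM U (\<lambda>_. count_space S)). h (f (fst p)) = snd p}"
    using \<open>fst p \<in> U\<close> by (auto simp: space_PiM PiE_iff extensional_def)
  finally show "{f\<in>space (PiM U (\<lambda>_. count_space S)). h (f (fst p)) = snd p} \<in> sets (PiM U (\<lambda>_. count_space S))" .
qed (rule assms(1))

text \<open>Invariance and \<open>k\<close>-dependence become identities between probabilities of
  finite patterns, the form in which sampling uses them.\<close>

lemma dependent_field_of_field:
  fixes X :: "'v \<Rightarrow> 'w \<Rightarrow> 's"
  assumes G: "aut_graph E \<Gamma>" and field: "random_field M (count_space S) X"
    and inv: "invariant_field \<Gamma> M (count_space S) X" and dep: "k_dependent E k M (count_space S) X"
  shows "dependent_field E \<Gamma> M (\<lambda>v \<omega>. to_nat_on S (X v \<omega>)) k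
    (\<lambda>P. measure M {\<omega>\<in>space M. \<forall>p\<in>P. to_nat_on S (X (fst p) \<omega>) = snd p})"
proof -
  interpret aut_graph E \<Gamma> by fact
  interpret M: prob_space M using field by (simp add: random_field_def)
  have mX: "X v \<in> measurable M (count_space S)" for v using field by (simp add: random_field_def)
  let ?h = "to_nat_on S"
  show ?thesis
  proof
    fix v show "(\<lambda>\<omega>. ?h (X v \<omega>)) \<in> measurable M (count_space UNIV)"
      by (rule measurable_compose[OF mX]) simp
  next
    fix P :: "('v \<times> nat) set" and \<gamma> assume P: "finite P" and g: "\<gamma> \<in> \<Gamma>"
    let ?B = "{f\<in>space (PiM UNIV (\<lambda>_. count_space S)). \<forall>p\<in>P. ?h (f (fst p)) = snd p}"
    have B: "?B \<in> sets (PiM UNIV (\<lambda>_. count_space S))" by (rule sets_coordinates[OF P]) simp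
    have sp: "(\<lambda>v. X (\<delta> v) \<omega>) \<in> space (PiM UNIV (\<lambda>_. count_space S))" if "\<omega> \<in> space M" for \<delta> :: "'v \<Rightarrow> 'v" and \<omega>
      using measurable_space[OF mX that] by (auto simp: space_PiM PiE_UNIV_domain)
    have "measure (field_law M (count_space S) (\<lambda>v. X (\<gamma> v))) ?B = measure (field_law M (count_space S) X) ?B"
      using inv g by (simp add: invariant_field_def)
    then have "measure M {\<omega>\<in>space M. \<forall>p\<in>P. ?h (X (\<gamma> (fst p)) \<omega>) = snd p} =
      measure M {\<omega>\<in>space M. \<forall>p\<in>P. ?h (X (fst p) \<omega>) = snd p}"
      using sp[of _ \<gamma>] sp[of _ "\<lambda>v. v"] by (simp add: measure_field_law[OF mX B] cong: conj_cong)
    then show "measure M {\<omega>\<in>space M. \<forall>p\<in>map_prod \<gamma> id ` P. ?h (X (fst p) \<omega>) = snd p} =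
      measure M {\<omega>\<in>space M. \<forall>p\<in>P. ?h (X (fst p) \<omega>) = snd p}" by simp
  next
    fix P P' :: "('v \<times> nat) set" assume P: "finite P" "finite P'"
      and far: "\<And>p p'. p \<in> P \<Longrightarrow> p' \<in> P' \<Longrightarrow> fst p \<notin> nball E (fst p') k"
    let ?U = "fst ` P" and ?V = "fst ` P'"
    let ?B = "\<lambda>P. {f\<in>space (PiM (fst ` P) (\<lambda>_. count_space S)). \<forall>p\<in>P. ?h (f (fst p)) = snd p}"
    have "graph_dist E u v > enat k" if "u \<in> ?U" "v \<in> ?V" for u v
      using that far by (auto simp: not_le[symmetric] graph_dist_le_iff)
    then have ind: "M.indep_var (PiM ?U (\<lambda>_. count_space S)) (\<lambda>\<omega>. \<lambda>u\<in>?U. X u \<omega>)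
      (PiM ?V (\<lambda>_. count_space S)) (\<lambda>\<omega>. \<lambda>v\<in>?V. X v \<omega>)"
      using dep unfolding k_dependent_def by blast
    have preimg: "(\<lambda>\<omega>. \<lambda>u\<in>fst ` P. X u \<omega>) -` ?B P \<inter> space M = {\<omega>\<in>space M. \<forall>p\<in>P. ?h (X (fst p) \<omega>) = snd p}"
      for P :: "('v \<times> nat) set"
      using measurable_space[OF mX] by (auto simp: space_PiM)
    have "measure M ((\<lambda>\<omega>. (\<lambda>u\<in>?U. X u \<omega>, \<lambda>v\<in>?V. X v \<omega>)) -` (?B P \<times> ?B P') \<inter> space M) =
      measure M {\<omega>\<in>space M. \<forall>p\<in>P. ?h (X (fst p) \<omega>) = snd p} * measure M {\<omega>\<in>space M. \<forall>p\<in>P'. ?h (X (fst p) \<omega>) = snd p}"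
      unfolding M.indep_varD[OF ind sets_coordinates[OF P(1) subset_refl] sets_coordinates[OF P(2) subset_refl]] preimg
      by (rule refl)
    moreover have "(\<lambda>\<omega>. (\<lambda>u\<in>?U. X u \<omega>, \<lambda>v\<in>?V. X v \<omega>)) -` (?B P \<times> ?B P') \<inter> space M =
      {\<omega>\<in>space M. \<forall>p\<in>P \<union> P'. ?h (X (fst p) \<omega>) = snd p}"
    proof -
      have "(\<lambda>\<omega>. (\<lambda>u\<in>?U. X u \<omega>, \<lambda>v\<in>?V. X v \<omega>)) -` (?B P \<times> ?B P') \<inter> space M =
        ((\<lambda>\<omega>. \<lambda>u\<in>fst ` P. X u \<omega>) -` ?B P \<inter> space M) \<inter> ((\<lambda>\<omega>. \<lambda>u\<in>fst ` P'. X u \<omega>) -` ?B P' \<inter> space M)"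
        by (simp only: vimage_def mem_Times_iff fst_conv snd_conv) blast
      then show ?thesis unfolding preimg by blast
    qed
    ultimately show "measure M {\<omega>\<in>space M. \<forall>p\<in>P \<union> P'. ?h (X (fst p) \<omega>) = snd p} =
      measure M {\<omega>\<in>space M. \<forall>p\<in>P. ?h (X (fst p) \<omega>) = snd p} * measure M {\<omega>\<in>space M. \<forall>p\<in>P'. ?h (X (fst p) \<omega>) = snd p}"
      by simp
  qed (simp_all add: M.prob_space_axioms)
qed

text \<open>Three kinds of bits at each vertex: rounds of the partition stages, labels, and tosses.
  The sum type keeps their coordinates disjoint after numbering.\<close>

type_synonym coord = "nat \<times> nat + nat + nat \<times> nat"

definition cell_bit :: "nat \<Rightarrow> nat \<Rightarrow> nat" where
  "cell_bit n t = to_nat (Inl (n, t) :: coord)"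

definition label_bit :: "nat \<Rightarrow> nat" where
  "label_bit j = to_nat (Inr (Inl j) :: coord)"

definition sample_bit :: "nat \<Rightarrow> nat \<Rightarrow> nat" where
  "sample_bit c j = to_nat (Inr (Inr (c, j)) :: coord)"

lemma coord_bit_simps:
  "cell_bit n t = cell_bit n' t' \<longleftrightarrow> n = n' \<and> t = t'" "label_bit j = label_bit j' \<longleftrightarrow> j = j'"
  "sample_bit c i = sample_bit c' i' \<longleftrightarrow> c = c' \<and> i = i'"
  "cell_bit n t \<noteq> sample_bit c i" "label_bit j \<noteq> sample_bit c i"
  by (simp_all add: cell_bit_def label_bit_def sample_bit_def)

definition bit_prob :: "(nat \<Rightarrow> real) \<Rightarrow> (nat \<Rightarrow> nat \<Rightarrow> real) \<Rightarrow> nat \<Rightarrow> real" where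
  "bit_prob p h i = (case from_nat i :: coord of Inl (n, t) \<Rightarrow> p n | Inr (Inl j) \<Rightarrow> 1 / 2 | Inr (Inr (c, j)) \<Rightarrow> h c j)"

lemma bit_prob_simps:
  "bit_prob p h (cell_bit n t) = p n" "bit_prob p h (label_bit j) = 1 / 2" "bit_prob p h (sample_bit c j) = h c j"
  by (simp_all add: bit_prob_def cell_bit_def label_bit_def sample_bit_def)

lemma bit_prob_bounds:
  "(\<And>n. 0 \<le> p n \<and> p n \<le> 1) \<Longrightarrow> (\<And>c j. 0 \<le> h c j \<and> h c j \<le> 1) \<Longrightarrow> 0 \<le> bit_prob p h i \<and> bit_prob p h i \<le> 1"
  by (auto simp: bit_prob_def split: sum.split prod.split)

theorem theorem1p1:
  fixes E :: "'v set set"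
    and \<Gamma> :: "('v \<Rightarrow> 'v) set"
    and o' :: 'v
    and M :: "'w measure"
    and S :: "'s set"
    and X :: "'v \<Rightarrow> 'w \<Rightarrow> 's"
  assumes "countable (UNIV :: 'v set)"
    and "infinite (UNIV :: 'v set)"
    and "simple_graph E"
    and "locally_finite E"
    and "transitive_graph E"
    and "amenable_graph E"
    and "automorphism_group E \<Gamma>"
    and "acts_transitively \<Gamma>"
    and "countable S"
    and "random_field M (count_space S) X"
    and "invariant_field \<Gamma> M (count_space S) X"
    and "finitely_dependent E M (count_space S) X"
  shows "finitary_factor_of_iid E \<Gamma> o' M S X"
proof -
  have G: "aut_graph E \<Gamma>" by unfold_locales (use assms in auto)
  interpret aut_graph E \<Gamma> by (rule G)
  obtain k where k: "k_dependent E k M (count_space S) X"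
    using assms(12) by (auto simp: finitely_dependent_def)
  let ?X = "\<lambda>v \<omega>. to_nat_on S (X v \<omega>)"
  let ?q = "\<lambda>P. measure M {\<omega>\<in>space M. \<forall>p\<in>P. ?X (fst p) \<omega> = snd p}"
  interpret dependent_field E \<Gamma> M ?X k ?q by (rule dependent_field_of_field[OF G assms(10,11) k])
  from hierarchy_exists[of k] obtain \<O> K f p where
    p: "\<forall>n. 0 \<le> p n \<and> p n \<le> 1" and closed: "\<forall>n. \<forall>A\<in>\<O> n. \<forall>\<gamma>\<in>\<Gamma>. \<gamma> ` A \<in> \<O> n"
    and sub0: "\<forall>n. \<forall>A\<in>\<O> n. \<forall>x\<in>A. A \<subseteq> nball E x (f n)"
    and as: "\<forall>(\<rho> :: 'v \<times> nat \<Rightarrow> real) eN eL. (\<forall>k. 0 \<le> \<rho> k \<and> \<rho> k \<le> 1) \<longrightarrow> (\<forall>n. inj (eN n)) \<longrightarrow> inj eL \<longrightarrow>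
      (\<forall>v n t. \<rho> (v, eN n t) = p n) \<longrightarrow> (\<forall>v j. \<rho> (v, eL j) = 1 / 2) \<longrightarrow>
      (AE b in bern \<rho>. \<forall>v. resolved E \<O> K k (\<lambda>n v t. b (v, eN n t)) (\<lambda>v j. b (v, eL j)) v)"
    by (elim exE conjE)
  have sub: "A \<subseteq> nball E x (f n)" if "A \<in> \<O> n" "x \<in> A" for n A x using sub0 that by blast
  \<comment> \<open>The biases are assembled from the hierarchy and from the conditional laws of
    \<open>X\<close>, neither of which depends on the layout of the bits.\<close>
  define \<rho>0 where "\<rho>0 = bit_prob p hazard_at"
  define \<rho> :: "'v \<times> nat \<Rightarrow> real" where "\<rho> = (\<lambda>(v, i). \<rho>0 i)"
  define cb where "cb b = (\<lambda>n v t. b (v, cell_bit n t))" for b :: "'v \<times> nat \<Rightarrow> bool"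
  define lb where "lb b = (\<lambda>v j. b (v, label_bit j))" for b :: "'v \<times> nat \<Rightarrow> bool"
  define dm where "dm b = resolved E \<O> K k (cb b) (lb b)" for b
  define pr where "pr b = preds E \<O> K k (cb b) (lb b)" for b
  have \<rho>01: "0 \<le> \<rho> i \<and> \<rho> i \<le> 1" for i
    using bit_prob_bounds[of p hazard_at] p hazard_at_bounds by (simp add: \<rho>_def \<rho>0_def split_beta)
  interpret sampler E \<Gamma> M ?X k ?q \<rho> sample_bit dm pr
  proof
    show "0 \<le> \<rho> i \<and> \<rho> i \<le> 1" for i by (rule \<rho>01)
    show "\<rho> (v, sample_bit c j) = hazard_at c j" for v c j by (simp add: \<rho>_def \<rho>0_def bit_prob_simps)
    show "sample_bit c j = sample_bit c' j' \<longleftrightarrow> c = c' \<and> j = j'" for c j c' j' by (rule coord_bit_simps)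
    show "\<exists>r. pr b v \<subseteq> nball E v r" for b v
    proof (intro exI subsetI)
      fix u assume "u \<in> pr b v"
      then have c: "cell \<O> K (cb b) (level E \<O> K k (cb b) v) v u" by (simp add: pr_def preds_def)
      show "u \<in> nball E v (radius f (level E \<O> K k (cb b) v))" by (rule cell_nball[OF _ c]) (rule sub)
    qed
    show "v \<notin> pr b v" for b v unfolding pr_def by (rule preds_irrefl)
    show "w \<in> pr b v" if "u \<in> pr b v" "w \<in> pr b u" for b u v w using that unfolding pr_def by (rule preds_trans)
    show "u \<in> pr b v \<or> v \<in> pr b u" if "dm b u" "dm b v" "u \<noteq> v" "u \<in> nball E v k" for b u v
      using that unfolding pr_def dm_def by (rule preds_comparable_near)
    show "u \<in> pr b v \<or> v \<in> pr b u" if "dm b u" "dm b v" "u \<noteq> v" "w \<in> pr b u" "w \<in> pr b v" for b u v w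
      using that unfolding pr_def dm_def by (rule preds_comparable_common)
    show "locally_at E v b (\<lambda>b'. dm b' v \<and> pr b' v = pr b v)" if d: "dm b v" for b v
    proof -
      have "\<exists>r. \<forall>c' l'. (\<forall>u\<in>nball E v r. (\<forall>m<r. \<forall>t<r. cb b m u t = c' m u t) \<and> (\<forall>j<r. lb b u j = l' u j)) \<longrightarrow>
        resolved E \<O> K k c' l' v \<and> preds E \<O> K k c' l' v = preds E \<O> K k (cb b) (lb b) v"
        by (rule resolved_local[OF sub finite_nball d[unfolded dm_def]])
      then obtain r where r: "\<forall>c' l'. (\<forall>u\<in>nball E v r. (\<forall>m<r. \<forall>t<r. cb b m u t = c' m u t) \<and> (\<forall>j<r. lb b u j = l' u j)) \<longrightarrow>
        resolved E \<O> K k c' l' v \<and> preds E \<O> K k c' l' v = preds E \<O> K k (cb b) (lb b) v" by (elim exE)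
      \<comment> \<open>The window of \<open>resolved_local\<close> is measured in stages, rounds
        and label positions. \<open>R\<close> exceeds the numbers of all the coordinates these stand
        for, as well as the distance \<open>r\<close>.\<close>
      define R where "R = Suc (r + (\<Sum>m<r. \<Sum>t<r. cell_bit m t) + (\<Sum>j<r. label_bit j))"
      have N: "cell_bit m t < R" if "m < r" "t < r" for m t
      proof -
        have "cell_bit m t \<le> (\<Sum>t<r. cell_bit m t)" using that by (intro member_le_sum) auto
        also have "\<dots> \<le> (\<Sum>m<r. \<Sum>t<r. cell_bit m t)"
          using that by (intro member_le_sum[of m "{..<r}" "\<lambda>m. \<Sum>t<r. cell_bit m t"]) auto
        finally show ?thesis by (simp add: R_def)
      qed
      have L: "label_bit j < R" if "j < r" for j
      proof -
        have "label_bit j \<le> (\<Sum>j<r. label_bit j)" using that by (intro member_le_sum) auto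
        then show ?thesis by (simp add: R_def)
      qed
      show ?thesis unfolding locally_at_def
      proof (intro exI[of _ R] allI impI)
        fix b' assume a: "agree E v R b b'"
        have "\<forall>u\<in>nball E v r. (\<forall>m<r. \<forall>t<r. cb b m u t = cb b' m u t) \<and> (\<forall>j<r. lb b u j = lb b' u j)"
        proof
          fix u assume "u \<in> nball E v r"
          then have "u \<in> nball E v R" using nball_mono[of r R E v] by (auto simp: R_def)
          then have "b (u, i) = b' (u, i)" if "i < R" for i using a that by (simp add: agree_def)
          then show "(\<forall>m<r. \<forall>t<r. cb b m u t = cb b' m u t) \<and> (\<forall>j<r. lb b u j = lb b' u j)"
            using N L by (simp add: cb_def lb_def)
        qed
        then show "dm b' v \<and> pr b' v = pr b v" unfolding dm_def pr_def
          by (rule r[THEN spec, THEN spec, THEN mp])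
      qed
    qed
    have cb_aut: "cb (\<lambda>p. b (\<gamma> (fst p), snd p)) = (\<lambda>n v. cb b n (\<gamma> v))" for b \<gamma> by (simp add: cb_def)
    have lb_aut: "lb (\<lambda>p. b (\<gamma> (fst p), snd p)) = (\<lambda>v. lb b (\<gamma> v))" for b \<gamma> by (simp add: lb_def)
    show "dm (\<lambda>p. b (\<gamma> (fst p), snd p)) v = dm b (\<gamma> v)" if "\<gamma> \<in> \<Gamma>" for \<gamma> b v
      unfolding dm_def cb_aut lb_aut by (rule resolved_aut[OF closed that])
    show "u \<in> pr (\<lambda>p. b (\<gamma> (fst p), snd p)) v \<longleftrightarrow> \<gamma> u \<in> pr b (\<gamma> v)" if "\<gamma> \<in> \<Gamma>" for \<gamma> u b v
      unfolding pr_def cb_aut lb_aut by (rule preds_aut[OF closed that])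
    show "dm b v = dm b' v \<and> pr b v = pr b' v"
      if eq: "\<And>v i. (\<And>c j. i \<noteq> sample_bit c j) \<Longrightarrow> b (v, i) = b' (v, i)" for b b' v
    proof -
      have "cb b = cb b'" unfolding cb_def by (intro ext eq coord_bit_simps)
      moreover have "lb b = lb b'" unfolding lb_def by (intro ext eq coord_bit_simps)
      ultimately show ?thesis by (simp add: dm_def pr_def)
    qed
    have "AE b in bern \<rho>. \<forall>v. resolved E \<O> K k (\<lambda>n v t. b (v, cell_bit n t)) (\<lambda>v j. b (v, label_bit j)) v"
      by (rule as[rule_format]) (use \<rho>01 in \<open>auto simp: inj_def coord_bit_simps \<rho>_def \<rho>0_def bit_prob_simps\<close>)
    then show "AE b in bern \<rho>. \<forall>v. dm b v" by (simp add: dm_def cb_def lb_def)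
  qed
  show ?thesis
    by (rule finitary_factor_factor[OF assms(9,10), of \<rho>0]) (simp_all add: \<rho>_def)
qed

end
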